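(* Let $n \ge 2$, $1 < p < n$, $a \in \mathbb{R}$, $\overline{\mu}_a := \left|\frac{n-(a+1)p}{p}\right|^p$, $-\infty < \mu \le \overline{\mu}_a$, and let $\gamma$ be a real root of $$|\gamma|^{p-2}\gamma\,\bigl(n-(a+1)p-(p-1)\gamma\bigr) = \mu .$$ Let $u \in C^{1,\alpha}_{\mathrm{loc}}(\mathbb{R}^n\setminus\{0\})$ be a solution to the problem $$-\operatorname{div}\left(|x|^{-ap}|\nabla u|^{p-2}\nabla u\right) - \frac{\mu}{|x|^{(a+1)p}}u^{p-1} = 0 \ \text{ in } \mathbb{R}^n\setminus\{0\}, \qquad C_1|x|^{-\gamma} \le u(x) \le C_2|x|^{-\gamma} \ \text{ for } x \in \mathbb{R}^n\setminus\{0\},$$ where $C_1, C_2 > 0$ are constants. Then $u(x) = C|x|^{-\gamma}$ in $\mathbb{R}^n\setminus\{0\}$ for some constant $C > 0$.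
   Context: The equation is understood in the weak sense in $\mathbb{R}^n\setminus\{0\}$ (tested against $C_c^\infty(\mathbb{R}^n\setminus\{0\})$ functions). Here $C^{1,\alpha}_{\mathrm{loc}}$ means locally $C^{1,\alpha}$ for some $\alpha\in(0,1)$; positive weak solutions in $W^{1,p}_{\mathrm{loc}}(\mathbb{R}^n\setminus\{0\})$ automatically have this regularity. The expression $|\gamma|^{p-2}\gamma$ is interpreted as $0$ when $\gamma=0$, and likewise $|\nabla u|^{p-2}\nabla u = 0$ where $\nabla u=0$. The case $a=\frac{n-p}{p}$ (where $\overline{\mu}_a=0$) is included. *)

theory Defs
  imports "HOL-Analysis.Analysis"
begin

definition gradient :: "('a::euclidean_space \<Rightarrow> real) \<Rightarrow> 'a \<Rightarrow> 'a" where
  "gradient f x = (THE D. GDERIV f x :> D)"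

lemma gradient_eqI:
  assumes "GDERIV f x :> D"
  shows "gradient f x = D"
  unfolding gradient_def
proof (rule the_equality)
  show "GDERIV f x :> D" by fact
next
  fix D' assume "GDERIV f x :> D'"
  then have "(\<lambda>h. h \<bullet> D') = (\<lambda>h. h \<bullet> D)"
    using assms unfolding gderiv_def by (rule has_derivative_unique)
  then have "(D' - D) \<bullet> D' = (D' - D) \<bullet> D" by (rule fun_cong)
  then have "(D' - D) \<bullet> (D' - D) = 0" by (simp add: inner_diff_right)
  then show "D' = D" by simp
qed

lemma gderiv_gradient:
  assumes "f differentiable (at x)"
  shows "GDERIV f x :> gradient f x"
proof -
  obtain f' where f': "(f has_derivative f') (at x)"
    using assms unfolding differentiable_def by blast
  interpret linear f' using f' by (rule has_derivative_linear)
  define D where "D = (\<Sum>i\<in>Basis. f' i *\<^sub>R i)"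
  have "f' h = h \<bullet> D" for h
  proof -
    have "f' h = f' (\<Sum>i\<in>Basis. (h \<bullet> i) *\<^sub>R i)" by (simp add: euclidean_representation)
    also have "\<dots> = (\<Sum>i\<in>Basis. (h \<bullet> i) * f' i)" by (simp add: sum scale)
    also have "\<dots> = h \<bullet> D" by (simp add: D_def inner_sum_right mult.commute)
    finally show ?thesis .
  qed
  then have "f' = (\<lambda>h. h \<bullet> D)" by (rule ext)
  then have "GDERIV f x :> D" using f' by (simp add: gderiv_def)
  then show ?thesis by (simp add: gradient_eqI)
qed

text \<open>Intended for open \<open>\<Omega>\<close> and \<open>\<alpha> > 0\<close>: the Hoelder bound then makes the gradient continuous.\<close>

definition C1_holder_loc :: "real \<Rightarrow> 'a::euclidean_space set \<Rightarrow> ('a \<Rightarrow> real) \<Rightarrow> bool" where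
  "C1_holder_loc \<alpha> \<Omega> u \<longleftrightarrow>
     (\<forall>x\<in>\<Omega>. u differentiable (at x)) \<and>
     (\<forall>K. compact K \<and> K \<subseteq> \<Omega> \<longrightarrow>
        (\<exists>L. \<forall>x\<in>K. \<forall>y\<in>K. norm (gradient u x - gradient u y) \<le> L * dist x y powr \<alpha>))"

primrec C_k :: "nat \<Rightarrow> ('a::euclidean_space \<Rightarrow> real) \<Rightarrow> bool" where
  "C_k 0 f \<longleftrightarrow> continuous_on UNIV f"
| "C_k (Suc k) f \<longleftrightarrow>
     (\<forall>x. f differentiable (at x)) \<and>
     (\<forall>v. C_k k (\<lambda>x. frechet_derivative f (at x) v))"

text \<open>A function in \<open>C_c^\<infinity>(\<Omega>)\<close> is represented by its extension by zero to the whole space.\<close>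

definition test_function :: "'a::euclidean_space set \<Rightarrow> ('a \<Rightarrow> real) \<Rightarrow> bool" where
  "test_function \<Omega> \<phi> \<longleftrightarrow>
     (\<forall>k. C_k k \<phi>) \<and> compact (closure {x. \<phi> x \<noteq> 0}) \<and> closure {x. \<phi> x \<noteq> 0} \<subseteq> \<Omega>"

text \<open>Weak form on \<open>\<Omega>\<close> of
  \<open>- div (|x|^(-a p) |\<nabla>u|^(p-2) \<nabla>u) - \<mu> |x|^(-(a+1) p) u^(p-1) = 0\<close> for positive \<open>u\<close>.
  If \<open>u\<close> is positive and continuously differentiable on the open set \<open>\<Omega>\<close>, with \<open>0 \<notin> \<Omega>\<close> and
  \<open>p > 1\<close>, both integrands are continuous with compact support in \<open>\<Omega>\<close>, so that the
  integrals exist. Since \<open>0 powr r = 0\<close>, the flux vanishes where \<open>\<nabla>u = 0\<close>.\<close>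

definition weak_solution ::
    "real \<Rightarrow> real \<Rightarrow> real \<Rightarrow> 'a::euclidean_space set \<Rightarrow> ('a \<Rightarrow> real) \<Rightarrow> bool" where
  "weak_solution p a \<mu> \<Omega> u \<longleftrightarrow>
     (\<forall>\<phi>. test_function \<Omega> \<phi> \<longrightarrow>
        (LINT x:\<Omega>|lborel. norm x powr (- a * p) *
            ((norm (gradient u x) powr (p - 2) *\<^sub>R gradient u x) \<bullet> gradient \<phi> x))
        - (LINT x:\<Omega>|lborel. \<mu> / norm x powr ((a + 1) * p) * u x powr (p - 1) * \<phi> x) = 0)"

end

theory Submission
  imports Defs
begin

text \<open>
  Multiplying the equation by \<open>u\<^sup>1\<^sup>-\<^sup>p\<close> gives an equation for \<open>ln u\<close> which involves only \<open>\<nabla> ln u\<close> and is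
  invariant under dilations once it is written with the measure \<open>d\<nu> = |x|\<^sup>-\<^sup>n dx\<close>. Let
  \<open>w = ln u + \<gamma> ln |x|\<close>, a bounded function, and \<open>Q = |x| \<nabla>w\<close>. No regularity theory or maximum principle
  is needed: everything follows from integral identities with logarithmic cutoffs.

  For \<open>\<gamma> \<noteq> 0\<close> the lower order term is \<open>\<beta> \<langle>Q, x/|x|\<rangle>\<close> plus a remainder which, by an exact formula in terms of
  Bregman distances, is controlled by the monotonicity gap \<open>m\<close> of the flux. Testing with \<open>\<plusminus>exp (\<plusminus>L w)\<close>
  absorbs the remainder and turns the linear term into boundary terms; hence \<open>\<integral> m d\<nu>\<close> is finite, and by a
  Poincare inequality \<open>w\<close> is close to constants \<open>c\<^sub>+\<close>, \<open>c\<^sub>-\<close> on far away shells. If \<open>m\<close> did not vanish,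
  the two signs would give \<open>\<beta> (c\<^sub>+ - c\<^sub>-) > 0\<close> and \<open>\<beta> (c\<^sub>+ - c\<^sub>-) < 0\<close>.

  For \<open>\<gamma> = 0\<close> (so \<open>\<mu> = 0\<close>) the lower order term is homogeneous of degree \<open>p - 1\<close> and cannot be absorbed.
  Comparing \<open>u\<close> with its dilations and using convexity gives a Pohozaev identity, which shows first that
  \<open>\<integral> |q|\<^sup>p\<^sup>-\<^sup>2 \<langle>q, x/|x|\<rangle>\<^sup>2 d\<nu>\<close> is finite for \<open>q = |x| \<nabla>u\<close>, and then that it is zero; the Caccioppoli
  identity then forces \<open>q = 0\<close>.
\<close>

section \<open>Smooth functions and mollification\<close>

text \<open>Why the exponent matters: at a pure power \<open>P\<close> equals \<open>R\<close>, of
  norm |\<gamma>|. If \<gamma> \<noteq> 0, the lower order term is differentiable there and its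
  deviation from the linear part is bounded by a multiple of the gap. If \<gamma> = 0, the gap is
  \<open>|P|^p\<close>, while the drift is of order \<open>|P|^(p-1)\<close>, which is larger where
  \<open>P\<close> is small. Why two signs conflict: both test functions increase with
  \<open>w\<close>, so the gap enters both inequalities with the same sign, but their primitives are
  monotone in opposite directions. \<open>w\<close> need not converge at either end: the constants
  may change with the shell, as long as both signs use the same pair. For the root with \<kappa> = p
  \<gamma> the linear term is absent, and each inequality is contradictory by itself. Why the
  cutoffs differ: for \<gamma> \<noteq> 0 the collars have fixed logarithmic width, because their
  mass must be compared in the limit and smallness comes from the tail of the integral of the gap.
  For \<gamma> = 0 no integrability is available at the start, so the width \<open>N\<close> grows
  with the radius, and slopes of order \<open>1/N\<close> work against a measure of order
  \<open>N\<close>.\<close>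

lemma C_k_SucD: "C_k (Suc k) f \<Longrightarrow> C_k k f"
proof (induction k arbitrary: f)
  case 0
  then have "\<forall>x. isCont f x"
    by (auto intro: differentiable_imp_continuous_within)
  then show ?case by (simp add: continuous_at_imp_continuous_on)
next
  case (Suc k)
  then show ?case by simp
qed

lemma C_k_0I: "C_k k f \<Longrightarrow> C_k 0 f"
  by (induction k) (simp, blast dest: C_k_SucD)

lemma C_k_continuous: "C_k k f \<Longrightarrow> continuous_on UNIV f"
  using C_k_0I by force

lemma C_k_SucI:
  assumes "\<And>x. (f has_derivative F x) (at x)" "\<And>v. C_k k (\<lambda>x. F x v)"
  shows "C_k (Suc k) f"
proof -
  have "frechet_derivative f (at x) = F x" for x
    using frechet_derivative_at[OF assms(1)] by simp
  then show ?thesis using assms by (auto simp: differentiable_def)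
qed

lemma C_k_Suc_has_derivative:
  "C_k (Suc k) f \<Longrightarrow> (f has_derivative frechet_derivative f (at x)) (at x)"
  by (simp add: frechet_derivative_works[symmetric])

lemma C_k_const: "C_k k (\<lambda>x. c)"
proof (induction k arbitrary: c)
  case (Suc k)
  show ?case by (rule C_k_SucI[where F = "\<lambda>x h. 0"]) (auto intro: Suc)
qed simp

lemma C_k_add: "C_k k f \<Longrightarrow> C_k k g \<Longrightarrow> C_k k (\<lambda>x. f x + g x)"
proof (induction k arbitrary: f g)
  case 0
  then show ?case by (auto intro: continuous_intros)
next
  case (Suc k)
  show ?case
    by (rule C_k_SucI[OF has_derivative_add[OF C_k_Suc_has_derivative[OF Suc.prems(1)]
            C_k_Suc_has_derivative[OF Suc.prems(2)]]])
      (use Suc in auto)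
qed

lemma C_k_mult: "C_k k f \<Longrightarrow> C_k k g \<Longrightarrow> C_k k (\<lambda>x. f x * g x)"
proof (induction k arbitrary: f g)
  case 0
  then show ?case by (auto intro: continuous_intros)
next
  case (Suc k)
  show ?case
    by (rule C_k_SucI[OF has_derivative_mult[OF C_k_Suc_has_derivative[OF Suc.prems(1)]
            C_k_Suc_has_derivative[OF Suc.prems(2)]]])
      (use Suc C_k_SucD[OF Suc.prems(1)] C_k_SucD[OF Suc.prems(2)] in \<open>auto intro!: C_k_add\<close>)
qed

lemma C_k_inner_const: "C_k k (\<lambda>x::'a::euclidean_space. x \<bullet> c)"
proof (cases k)
  case 0
  then show ?thesis by (auto intro: continuous_intros)
next
  case (Suc m)
  show ?thesis unfolding Suc
    by (rule C_k_SucI[where F = "\<lambda>x h. h \<bullet> c"]) (auto intro!: derivative_eq_intros C_k_const)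
qed

lemma C_k_inner_self: "C_k k (\<lambda>x::'a::euclidean_space. x \<bullet> x)"
proof (cases k)
  case 0
  then show ?thesis by (auto intro: continuous_intros)
next
  case (Suc m)
  have "C_k m (\<lambda>x::'a. x \<bullet> v + v \<bullet> x)" for v
    using C_k_add[OF C_k_inner_const C_k_inner_const, of m v v] by (simp add: inner_commute)
  then show ?thesis unfolding Suc
    by (intro C_k_SucI[where F = "\<lambda>x h. x \<bullet> h + h \<bullet> x"]) (auto intro!: derivative_eq_intros)
qed

section \<open>A smooth bump function\<close>

definition flat_exp :: "nat \<Rightarrow> real \<Rightarrow> real" where
  "flat_exp m s = (if s > 0 then inverse s ^ m / exp (inverse s) else 0)"

lemma flat_exp_tendsto_0: "(flat_exp m \<longlongrightarrow> 0) (at 0)"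
proof (rule filterlim_split_at)
  show "(flat_exp m \<longlongrightarrow> 0) (at_left 0)"
    by (rule tendsto_eventually) (auto simp: flat_exp_def eventually_at_left_field intro: exI[of _ "-1"])
  have "((\<lambda>s::real. inverse s ^ m / exp (inverse s)) \<longlongrightarrow> 0) (at_right 0)"
    using filterlim_compose[OF tendsto_power_div_exp_0 filterlim_inverse_at_top_right] .
  then show "(flat_exp m \<longlongrightarrow> 0) (at_right 0)"
    by (rule Lim_transform_eventually)
      (auto simp: flat_exp_def eventually_at_right_field intro: exI[of _ 1])
qed

text \<open>Differentiation only raises the power of \<open>inverse s\<close>, so the family is
  closed under it and smoothness follows by induction. At \<open>0\<close> the difference quotient
  is itself \<open>flat_exp (m + 1)\<close>.\<close>

lemma flat_exp_deriv:
  "(flat_exp m has_real_derivative (flat_exp (m + 2) s - m * flat_exp (m + 1) s)) (at s)"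
proof -
  consider "s > 0" | "s < 0" | "s = 0" by linarith
  then show ?thesis
  proof cases
    case 1
    let ?g = "\<lambda>s::real. inverse s ^ m / exp (inverse s)"
    have ev: "\<forall>\<^sub>F t in nhds s. ?g t = flat_exp m t"
      using eventually_nhds_in_open[of "{0<..}" s] 1
      by (auto elim!: eventually_mono simp: flat_exp_def)
    have "(?g has_real_derivative
        ((m * inverse s ^ (m - 1) * (- (inverse s)\<^sup>2)) * exp (inverse s)
          - inverse s ^ m * (exp (inverse s) * (- (inverse s)\<^sup>2))) / (exp (inverse s) * exp (inverse s))) (at s)"
      using 1 by (auto intro!: derivative_eq_intros simp: power2_eq_square)
    also have "((m * inverse s ^ (m - 1) * (- (inverse s)\<^sup>2)) * exp (inverse s)
          - inverse s ^ m * (exp (inverse s) * (- (inverse s)\<^sup>2))) / (exp (inverse s) * exp (inverse s))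
        = flat_exp (m + 2) s - m * flat_exp (m + 1) s"
      using 1 by (cases m) (auto simp: flat_exp_def field_simps power2_eq_square)
    finally show ?thesis using ev by (subst DERIV_cong_ev[OF refl _ refl]) (auto elim: eventually_mono)
  next
    case 2
    have ev: "\<forall>\<^sub>F t in nhds s. 0 = flat_exp m t"
      using eventually_nhds_in_open[of "{..<0}" s] 2
      by (auto elim!: eventually_mono simp: flat_exp_def)
    have "((\<lambda>s. 0) has_real_derivative (flat_exp (m + 2) s - m * flat_exp (m + 1) s)) (at s)"
      using 2 by (auto simp: flat_exp_def)
    then show ?thesis using ev by (subst DERIV_cong_ev[OF refl _ refl]) (auto elim: eventually_mono)
  next
    case 3
    have "(flat_exp m t - flat_exp m 0) / (t - 0) = flat_exp (m + 1) t" for t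
      by (auto simp: flat_exp_def field_simps)
    then show ?thesis using flat_exp_tendsto_0[of "m + 1"] 3
      by (simp add: has_field_derivative_iff flat_exp_def[of _ 0])
  qed
qed

lemma C_k_flat_exp:
  fixes f :: "'a::euclidean_space \<Rightarrow> real"
  assumes "\<And>k. C_k k f"
  shows "C_k k (\<lambda>x. flat_exp m (f x))"
proof (induction k arbitrary: m)
  case 0
  have "continuous_on UNIV (flat_exp m)"
    using flat_exp_deriv by (meson DERIV_isCont continuous_at_imp_continuous_on)
  then show ?case
    using assms[of 0] by (auto intro: continuous_on_compose2)
next
  case (Suc k)
  have D: "(f has_derivative frechet_derivative f (at x)) (at x)" for x
    by (rule C_k_Suc_has_derivative[OF assms[of "Suc 0"]])
  have "((\<lambda>x. flat_exp m (f x)) has_derivative (\<lambda>v. (flat_exp (m + 2) (f x) + (- real m) * flat_exp (m + 1) (f x))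
      * frechet_derivative f (at x) v)) (at x)" for x
    using has_derivative_compose[OF D flat_exp_deriv[unfolded has_field_derivative_def]] by simp
  moreover have "C_k k (\<lambda>x. (flat_exp (m + 2) (f x) + (- real m) * flat_exp (m + 1) (f x))
      * frechet_derivative f (at x) v)" for v
    using assms[of "Suc k"] by (intro C_k_mult C_k_add C_k_const Suc.IH) auto
  ultimately show ?case by (rule C_k_SucI)
qed

text \<open>Written with the polynomial \<open>x \<bullet> x\<close> instead of the norm, so that
  the origin is not a special point for smoothness.\<close>

definition ball_bump :: "real \<Rightarrow> 'a::euclidean_space \<Rightarrow> real" where
  "ball_bump d x = flat_exp 0 (d\<^sup>2 - x \<bullet> x)"

lemma C_k_ball_bump: "C_k k (ball_bump d)"
  unfolding ball_bump_def
proof (rule C_k_flat_exp)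
  fix k show "C_k k (\<lambda>x::'a. d\<^sup>2 - x \<bullet> x)"
    using C_k_add[OF C_k_const[of k "d\<^sup>2"] C_k_mult[OF C_k_const[of k "-1"] C_k_inner_self]] by simp
qed

lemma ball_bump_pos: "norm x < d \<Longrightarrow> ball_bump d x > 0"
  by (auto simp: ball_bump_def flat_exp_def dot_square_norm power_strict_mono)

lemma ball_bump_zero: "0 < d \<Longrightarrow> d \<le> norm x \<Longrightarrow> ball_bump d x = 0"
  by (auto simp: ball_bump_def flat_exp_def dot_square_norm power_mono not_less)

lemma ball_bump_nonneg: "ball_bump d x \<ge> 0"
  by (auto simp: ball_bump_def flat_exp_def)

section \<open>Gradients, convolution and mollification\<close>

lemma gderiv_basis_sum:
  fixes f :: "'a::euclidean_space \<Rightarrow> real"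
  assumes "GDERIV f x :> D"
  shows "D = (\<Sum>i\<in>Basis. frechet_derivative f (at x) i *\<^sub>R i)"
proof -
  have "frechet_derivative f (at x) = (\<lambda>h. h \<bullet> D)"
    using assms frechet_derivative_at unfolding gderiv_def by metis
  then show ?thesis by (simp add: inner_commute[of _ D] euclidean_representation)
qed

lemma C_k_gderiv:
  fixes f :: "'a::euclidean_space \<Rightarrow> real"
  assumes "C_k (Suc k) f"
  shows "GDERIV f x :> gradient f x" "continuous_on UNIV (gradient f)"
proof -
  show *: "GDERIV f x :> gradient f x" for x
    using assms by (auto intro: gderiv_gradient)
  have "gradient f = (\<lambda>x. \<Sum>i\<in>Basis. frechet_derivative f (at x) i *\<^sub>R i)"
    using gderiv_basis_sum[OF *] by auto
  moreover have "continuous_on UNIV (\<lambda>x. frechet_derivative f (at x) i)" for i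
    using assms C_k_continuous by auto
  ultimately show "continuous_on UNIV (gradient f)" by (auto intro!: continuous_intros)
qed

text \<open>Every derivative falls on the kernel \<open>b\<close>, so continuity of \<open>f\<close>
  suffices; the fixed box makes Leibniz's rule applicable at every step of the induction.\<close>

lemma C_k_convolution:
  fixes f b :: "'a::euclidean_space \<Rightarrow> real"
  assumes "continuous_on UNIV f" "C_k k b"
  shows "C_k k (\<lambda>x. integral (cbox l u) (\<lambda>y. f y * b (x - y)))"
  using assms(2)
proof (induction k arbitrary: b)
  case 0
  then have bc: "continuous_on UNIV b" by simp
  have "continuous_on (UNIV \<times> cbox l u) (\<lambda>p. b (fst p - snd p))"
    by (rule continuous_on_compose2[OF bc]) (auto intro!: continuous_intros)
  then have "continuous_on (UNIV \<times> cbox l u) (\<lambda>(x,y). f y * b (x - y))"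
    unfolding split_beta
    by (intro continuous_intros continuous_on_compose2[OF assms(1)]) auto
  from integral_continuous_on_param[OF this] show ?case by simp
next
  case (Suc k)
  have gc: "continuous_on UNIV (gradient b)" and gb: "GDERIV b x :> gradient b x" for x
    using C_k_gderiv[OF Suc.prems] by auto
  have bc: "continuous_on UNIV b" by (rule C_k_continuous[OF Suc.prems])
  define D where "D x y = blinfun_inner_left (f y *\<^sub>R gradient b (x - y))" for x y
  have Dc: "continuous_on (UNIV \<times> cbox l u) (\<lambda>(x,y). D x y)"
    unfolding split_beta D_def
    by (intro bounded_linear.continuous_on[OF bounded_linear_blinfun_inner_left] continuous_intros
        continuous_on_compose2[OF assms(1)] continuous_on_compose2[OF gc]) auto
  have der: "((\<lambda>x. integral (cbox l u) (\<lambda>y. f y * b (x - y))) has_derivative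
        integral (cbox l u) (D x)) (at x)" for x
  proof (rule leibniz_rule[where U = UNIV and fx = D, OF _ _ Dc])
    fix x y
    show "((\<lambda>x. f y * b (x - y)) has_derivative D x y) (at x)"
    proof -
      have "((\<lambda>x. x - y) has_derivative (\<lambda>h. h)) (at x)"
        by (auto intro!: derivative_eq_intros)
      from has_derivative_compose[OF this gb[unfolded gderiv_def]]
      have "((\<lambda>x. b (x - y)) has_derivative (\<lambda>h. h \<bullet> gradient b (x - y))) (at x)" .
      from has_derivative_mult_right[OF this, of "f y"] show ?thesis
        unfolding D_def by simp
    qed
    have "continuous_on (cbox l u) (\<lambda>y. b (x - y))"
      by (rule continuous_on_compose2[OF bc]) (auto intro!: continuous_intros)
    then show "(\<lambda>y. f y * b (x - y)) integrable_on cbox l u"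
      by (intro integrable_continuous continuous_on_mult continuous_on_subset[OF assms(1)]) auto
  qed auto
  have Di: "D x integrable_on cbox l u" for x
  proof (rule integrable_continuous)
    have "continuous_on (cbox l u) (\<lambda>y. (x, y))"
      by (rule continuous_on_Pair[OF continuous_on_const continuous_on_id])
    from continuous_on_compose2[OF Dc this] show "continuous_on (cbox l u) (D x)" by auto
  qed
  have eq: "blinfun_apply (integral (cbox l u) (D x)) v
      = integral (cbox l u) (\<lambda>y. f y * frechet_derivative b (at (x - y)) v)" for x v
  proof -
    have "frechet_derivative b (at (x - y)) v = v \<bullet> gradient b (x - y)" for y
      using frechet_derivative_at[OF gb[of "x - y", unfolded gderiv_def]] by metis
    then show ?thesis
      by (simp add: blinfun_apply_integral[OF Di] D_def)
  qed
  have "C_k k (\<lambda>x. blinfun_apply (integral (cbox l u) (D x)) v)" for v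
    unfolding eq using Suc by auto
  then show ?case by (intro C_k_SucI[OF der]) auto
qed

lemma lborel_integral_affine:
  fixes f :: "'a::euclidean_space \<Rightarrow> real"
  assumes [measurable]: "f \<in> borel_measurable borel" and c: "c \<noteq> 0"
  shows "integral\<^sup>L lborel f = \<bar>c\<bar> ^ DIM('a) * integral\<^sup>L lborel (\<lambda>x. f (t + c *\<^sub>R x))"
  by (subst lborel_affine[OF c, of t])
    (simp add: integral_density integral_distr)

lemma borel_integrable_cball:
  fixes f :: "'a::euclidean_space \<Rightarrow> real"
  assumes "continuous_on UNIV f" "\<And>x. r < norm x \<Longrightarrow> f x = 0"
  shows "integrable lborel f"
proof -
  have "integrable lborel (\<lambda>x. indicator (cball 0 r) x *\<^sub>R f x)"
    by (intro borel_integrable_compact continuous_on_subset[OF assms(1)]) auto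
  moreover have "(\<lambda>x. indicator (cball 0 r) x *\<^sub>R f x) = f"
    using assms(2) by (force simp: indicator_def)
  ultimately show ?thesis by simp
qed

text \<open>The difference quotient along \<open>D\<close> itself tends to \<open>|D|^2\<close> and
  is at most \<open>\<epsilon> |D|\<close>. In this way gradient estimates follow from Lipschitz
  estimates.\<close>

lemma norm_gderiv_le:
  assumes g: "GDERIV g x :> D" and r: "r > 0" and "\<epsilon> \<ge> 0"
    and lip: "\<And>y. norm (y - x) < r \<Longrightarrow> \<bar>g y - g x\<bar> \<le> \<epsilon> * norm (y - x)"
  shows "norm D \<le> \<epsilon>"
proof (cases "D = 0")
  case False
  have "((\<lambda>s. x + s *\<^sub>R D) has_derivative (\<lambda>s. s *\<^sub>R D)) (at 0)"
    by (auto intro!: derivative_eq_intros)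
  from has_derivative_compose[OF this, of g "\<lambda>h. h \<bullet> D"] g
  have "((\<lambda>s. g (x + s *\<^sub>R D)) has_derivative (\<lambda>s. (s *\<^sub>R D) \<bullet> D)) (at 0)"
    by (simp add: gderiv_def)
  then have "((\<lambda>s. g (x + s *\<^sub>R D)) has_real_derivative (D \<bullet> D)) (at 0)"
    by (simp add: has_field_derivative_def mult_commute_abs)
  then have "((\<lambda>s. (g (x + s *\<^sub>R D) - g x) / s) \<longlongrightarrow> D \<bullet> D) (at 0)"
    by (simp add: DERIV_def)
  then have lim: "((\<lambda>s. \<bar>(g (x + s *\<^sub>R D) - g x) / s\<bar>) \<longlongrightarrow> \<bar>D \<bullet> D\<bar>) (at 0)"
    by (rule tendsto_rabs)
  have "\<bar>D \<bullet> D\<bar> \<le> \<epsilon> * norm D"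
  proof (rule tendsto_upperbound[OF lim])
    have "\<forall>\<^sub>F s in at 0. \<bar>s::real\<bar> < r / norm D"
      using r False by (auto simp: eventually_at intro!: exI[of _ "r / norm D"])
    then show "\<forall>\<^sub>F s in at 0. \<bar>(g (x + s *\<^sub>R D) - g x) / s\<bar> \<le> \<epsilon> * norm D"
    proof (eventually_elim)
      case (elim s)
      show ?case
      proof (cases "s = 0")
        case False
        have "norm (x + s *\<^sub>R D - x) < r" using elim \<open>D \<noteq> 0\<close> by (simp add: field_simps)
        from lip[OF this] False show ?thesis by (simp add: field_simps)
      qed (use assms in auto)
    qed
  qed auto
  then have "norm D * norm D \<le> \<epsilon> * norm D" by (simp add: dot_square_norm power2_eq_square)
  then show ?thesis using False by simp
qed (use assms in auto)

lemma gderiv_zero_open: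
  assumes "GDERIV f x :> D" "open S" "x \<in> S" "\<And>y. y \<in> S \<Longrightarrow> f y = 0"
  shows "D = 0"
proof -
  obtain r where "r > 0" "ball x r \<subseteq> S" using assms open_contains_ball by blast
  then have "f y = 0" if "norm (y - x) < r" for y
    using assms(4)[of y] that by (auto simp: subset_iff dist_norm norm_minus_commute)
  then have "norm D \<le> 0"
    using assms \<open>r > 0\<close> by (intro norm_gderiv_le[OF assms(1), of r]) auto
  then show ?thesis by simp
qed

lemma uniformly_continuous_bounded_support:
  fixes f :: "'a::euclidean_space \<Rightarrow> 'b::real_normed_vector"
  assumes f: "continuous_on UNIV f" and z: "\<And>x. r < norm x \<Longrightarrow> f x = 0" and "\<epsilon> > 0"
  obtains \<delta> where "\<delta> > 0" "\<And>x y. norm (x - y) < \<delta> \<Longrightarrow> norm (f x - f y) \<le> \<epsilon>"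
proof -
  have "uniformly_continuous_on (cball 0 (r + 1)) f"
    by (intro compact_uniformly_continuous continuous_on_subset[OF f]) auto
  then obtain d where d: "d > 0"
    "\<And>x y. x \<in> cball 0 (r + 1) \<Longrightarrow> y \<in> cball 0 (r + 1) \<Longrightarrow> dist y x < d \<Longrightarrow> dist (f y) (f x) < \<epsilon>"
    using \<open>\<epsilon> > 0\<close> unfolding uniformly_continuous_on_def by meson
  have "norm (f x - f y) \<le> \<epsilon>" if "norm (x - y) < min d 1" for x y
  proof (cases "r < norm x \<and> r < norm y")
    case True
    then show ?thesis using z \<open>\<epsilon> > 0\<close> by simp
  next
    case False
    then have "norm x \<le> r + 1" "norm y \<le> r + 1"
      using that norm_triangle_ineq2[of x y] norm_triangle_ineq2[of y x] by (auto simp: norm_minus_commute)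
    then show ?thesis using d(2)[of y x] that by (auto simp: dist_norm)
  qed
  then show ?thesis using that[of "min d 1"] d by auto
qed

lemma integral_pos_ball:
  fixes f :: "'a::euclidean_space \<Rightarrow> real"
  assumes f: "integrable lborel f" and nn: "\<And>x. 0 \<le> f x" and r: "0 < r" "0 < e"
    and ge: "\<And>x. x \<in> ball x0 r \<Longrightarrow> e \<le> f x"
  shows "0 < integral\<^sup>L lborel f"
proof -
  have "0 < e * measure lborel (ball x0 r)"
    using r content_ball_pos[of r x0] by simp
  also have "\<dots> = (LINT x|lborel. e * indicator (ball x0 r) x)" by simp
  also have "\<dots> \<le> integral\<^sup>L lborel f"
  proof (rule integral_mono)
    show "integrable lborel (\<lambda>x. e * indicator (ball x0 r) x)"
      by (intro integrable_mult_right integrable_real_indicator[OF _ emeasure_lborel_ball_finite]) auto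
  qed (use nn ge f in \<open>auto simp: indicator_def\<close>)
  finally show ?thesis .
qed

text \<open>The weak form admits smooth test functions only, whereas exponentials of
  \<open>w\<close> and powers of \<open>u\<close> are merely \<open>C^1\<close>. Closeness of the
  gradients comes from a Lipschitz bound for \<psi> minus a linear function, not from
  differentiating the convolution.\<close>

lemma C1_approx_test_function:
  fixes \<phi> :: "'a::euclidean_space \<Rightarrow> real"
  assumes der: "\<And>x. GDERIV \<phi> x :> G x" and Gc: "continuous_on UNIV G"
    and supp: "\<And>x. \<phi> x \<noteq> 0 \<Longrightarrow> a \<le> norm x \<and> norm x \<le> r" and "0 < a" "0 < \<epsilon>"
  obtains \<psi> where "test_function (UNIV - {0}) \<psi>"
    "\<And>x. \<psi> x \<noteq> 0 \<Longrightarrow> a / 2 \<le> norm x \<and> norm x \<le> r + 1"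
    "\<And>x. \<bar>\<psi> x - \<phi> x\<bar> \<le> \<epsilon>" "\<And>x. norm (gradient \<psi> x - G x) \<le> \<epsilon>"
proof -
  have \<phi>c: "continuous_on UNIV \<phi>"
    using der unfolding gderiv_def by (meson continuous_at_imp_continuous_on has_derivative_continuous)
  have \<phi>z: "\<phi> x = 0" if "r < norm x" for x using supp[of x] that by force
  have Gz: "G x = 0" if "r < norm x" for x
    by (rule gderiv_zero_open[OF der, of "{x. r < norm x}"]) (auto simp: that \<phi>z intro: open_Collect_less continuous_intros)
  obtain d1 where d1: "d1 > 0" "\<And>x y. norm (x - y) < d1 \<Longrightarrow> norm (\<phi> x - \<phi> y) \<le> \<epsilon>"
    using uniformly_continuous_bounded_support[OF \<phi>c \<phi>z \<open>0 < \<epsilon>\<close>] by auto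
  obtain d2 where d2: "d2 > 0" "\<And>x y. norm (x - y) < d2 \<Longrightarrow> norm (G x - G y) \<le> \<epsilon>"
    using uniformly_continuous_bounded_support[OF Gc Gz \<open>0 < \<epsilon>\<close>] by auto
  \<comment> \<open>\<open>a / 2\<close> keeps the support off the origin and \<open>1\<close> keeps
    it bounded; \<open>d2 / 2\<close> leaves room for two displacements of length \<open>d\<close>
    inside \<open>ball x d2\<close>.\<close>
  define d where "d = min (min d1 (d2 / 2)) (min (a / 2) 1)"
  have d: "d > 0" "d \<le> d1" "d \<le> d2 / 2" "d \<le> a / 2" "d \<le> 1"
    using d1 d2 \<open>0 < a\<close> by (auto simp: d_def)
  define b :: "'a \<Rightarrow> real" where "b = ball_bump d"
  have bz: "b x = 0" if "d \<le> norm x" for x using ball_bump_zero[OF d(1) that] by (simp add: b_def)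
  have bnn: "b x \<ge> 0" for x by (simp add: b_def ball_bump_nonneg)
  have bc: "continuous_on UNIV b" unfolding b_def using C_k_continuous[OF C_k_ball_bump] .
  have bm [measurable]: "b \<in> borel_measurable borel" by (rule borel_measurable_continuous_onI[OF bc])
  have \<phi>m [measurable]: "\<phi> \<in> borel_measurable borel" by (rule borel_measurable_continuous_onI[OF \<phi>c])
  have bi: "integrable lborel b" by (rule borel_integrable_cball[OF bc, of d]) (auto intro: bz)
  define c where "c = integral\<^sup>L lborel b"
  have "c > 0"
  proof -
    have "\<forall>\<^sub>F x in at 0. b 0 / 2 < b x"
      using bc ball_bump_pos[of 0 d] d
      by (intro order_tendstoD(1)[of _ "b 0"]) (auto simp: b_def continuous_on_def)
    then obtain s where "s > 0" "\<And>x. x \<noteq> 0 \<Longrightarrow> norm x < s \<Longrightarrow> b 0 / 2 < b x"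
      by (auto simp: eventually_at)
    moreover have "b 0 > 0" using ball_bump_pos[of "0::'a" d] d by (simp add: b_def)
    ultimately have "b 0 / 2 \<le> b x" if "x \<in> ball 0 s" for x
      using that by (cases "x = 0") (auto intro: less_imp_le)
    with \<open>s > 0\<close> \<open>b 0 > 0\<close> show ?thesis unfolding c_def
      by (intro integral_pos_ball[OF bi bnn, of s "b 0 / 2" 0]) auto
  qed
  obtain l where l: "cball 0 r \<subseteq> cbox (- l) (l::'a)"
    using bounded_subset_cbox_symmetric[OF bounded_cball] by blast
  define \<psi> where "\<psi> x = inverse c * integral (cbox (- l) l) (\<lambda>y. \<phi> y * b (x - y))" for x
  have bcx: "continuous_on UNIV (\<lambda>y. b (x - y))" for x
    by (rule continuous_on_compose2[OF bc]) (auto intro!: continuous_intros)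
  have \<phi>cx: "continuous_on UNIV (\<lambda>y. \<phi> (x - y))" for x
    by (rule continuous_on_compose2[OF \<phi>c]) (auto intro!: continuous_intros)
  have int: "integrable lborel (\<lambda>y. F y * b y)" if "continuous_on UNIV F" for F :: "'a \<Rightarrow> real"
    by (rule borel_integrable_cball[of _ d]) (auto intro!: continuous_intros that bc simp: bz)
  \<comment> \<open>The defining form, with the kernel translated, gives smoothness; this form, with
    \<phi> translated, gives the estimates.\<close>
  have \<psi>_eq: "\<psi> x = inverse c * (LINT y|lborel. \<phi> (x - y) * b y)" for x
  proof -
    have eq: "indicator (cbox (- l) l) y *\<^sub>R (\<phi> y * b (x - y)) = \<phi> y * b (x - y)" for y
      using l \<phi>z[of y] by (cases "norm y \<le> r") (auto simp: subset_iff)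
    have "integrable lborel (\<lambda>y. \<phi> y * b (x - y))"
      by (rule borel_integrable_cball[of _ r]) (auto intro!: continuous_intros \<phi>c bcx simp: \<phi>z)
    then have "set_integrable lborel (cbox (- l) l) (\<lambda>y. \<phi> y * b (x - y))"
      unfolding set_integrable_def eq .
    from set_borel_integral_eq_integral(2)[OF this]
    have "integral (cbox (- l) l) (\<lambda>y. \<phi> y * b (x - y)) = (LINT y|lborel. \<phi> y * b (x - y))"
      unfolding set_lebesgue_integral_def eq by simp
    also have "\<dots> = (LINT y|lborel. \<phi> (x - y) * b y)"
      by (subst lborel_integral_affine[of _ "-1" x]) auto
    finally show ?thesis by (simp add: \<psi>_def)
  qed
  have \<psi>C: "C_k k \<psi>" for k
    unfolding \<psi>_def b_def by (intro C_k_mult C_k_const C_k_convolution \<phi>c C_k_ball_bump)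
  \<comment> \<open>\<open>b / c\<close> is a probability density carried by the ball of radius
    \<open>d\<close>.\<close>
  have avg: "\<bar>inverse c * (LINT y|lborel. F y * b y)\<bar> \<le> e"
    if F: "continuous_on UNIV F" and e: "\<And>y. norm y < d \<Longrightarrow> \<bar>F y\<bar> \<le> e" for F :: "'a \<Rightarrow> real" and e
  proof -
    have "\<bar>LINT y|lborel. F y * b y\<bar> \<le> (LINT y|lborel. e * b y)"
    proof (rule integral_abs_bound[THEN order_trans], rule integral_mono)
      show "\<bar>F y * b y\<bar> \<le> e * b y" for y
        using e[of y] bz[of y] bnn[of y] by (cases "norm y < d") (auto simp: abs_mult mult_right_mono)
    qed (use int[OF F] bi in auto)
    also have "\<dots> = e * c" by (simp add: c_def)
    finally show ?thesis using \<open>c > 0\<close> by (simp add: abs_mult field_simps)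
  qed
  have const: "inverse c * (LINT y|lborel. t * b y) = t" for t
    using \<open>c > 0\<close> by (simp add: c_def)
  have supp\<psi>: "a / 2 \<le> norm x \<and> norm x \<le> r + 1" if "\<psi> x \<noteq> 0" for x
  proof -
    have "\<exists>y. \<phi> (x - y) * b y \<noteq> 0"
    proof (rule ccontr)
      assume "\<not> ?thesis"
      then have "(\<lambda>y. \<phi> (x - y) * b y) = (\<lambda>_. 0)" by auto
      then have "\<psi> x = 0" unfolding \<psi>_eq by simp
      then show False using that by simp
    qed
    then obtain y where "\<phi> (x - y) \<noteq> 0" "norm y < d"
      using bz by (force simp: not_le[symmetric])
    then show ?thesis
      using supp[of "x - y"] d norm_triangle_ineq2[of x y] norm_triangle_ineq4[of x y] by force
  qed
  have close: "\<bar>\<psi> x - \<phi> x\<bar> \<le> \<epsilon>" for x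
  proof -
    have "\<psi> x - \<phi> x = inverse c * (LINT y|lborel. (\<phi> (x - y) - \<phi> x) * b y)"
      unfolding \<psi>_eq using const[of "\<phi> x"] int[OF \<phi>cx] bi
      by (simp add: left_diff_distrib Bochner_Integration.integral_diff algebra_simps)
    also have "\<bar>\<dots>\<bar> \<le> \<epsilon>"
    proof (rule avg)
      show "\<bar>\<phi> (x - y) - \<phi> x\<bar> \<le> \<epsilon>" if "norm y < d" for y
        using d1(2)[of "x - y" x] that d by simp
    qed (auto intro!: continuous_intros \<phi>cx)
    finally show ?thesis .
  qed
  have gclose: "norm (gradient \<psi> x - G x) \<le> \<epsilon>" for x
  proof (rule norm_gderiv_le[of "\<lambda>y. \<psi> y - y \<bullet> G x" x _ d])
    have "GDERIV \<psi> x :> gradient \<psi> x" by (rule C_k_gderiv(1)[OF \<psi>C])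
    then show "GDERIV (\<lambda>y. \<psi> y - y \<bullet> G x) x :> gradient \<psi> x - G x"
      unfolding gderiv_def by (auto intro!: derivative_eq_intros simp: inner_diff_right)
    fix y assume y: "norm (y - x) < d"
    \<comment> \<open>Mean value inequality on \<open>ball x d2\<close>, where \<open>G\<close>
      stays within \<epsilon> of \<open>G x\<close>.\<close>
    have mvt: "\<bar>\<phi> (y - z) - \<phi> (x - z) - (y - x) \<bullet> G x\<bar> \<le> \<epsilon> * norm (y - x)" if z: "norm z < d" for z
    proof -
      have "norm ((\<phi> (y - z) - (y - z) \<bullet> G x) - (\<phi> (x - z) - (x - z) \<bullet> G x)) \<le> \<epsilon> * norm ((y - z) - (x - z))"
      proof (rule differentiable_bound[of "ball x d2"])
        fix t assume t: "t \<in> ball x d2"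
        have "((\<lambda>t. \<phi> t - t \<bullet> G x) has_derivative (\<lambda>h. h \<bullet> G t - h \<bullet> G x)) (at t)"
          by (intro has_derivative_diff der[unfolded gderiv_def] bounded_linear_imp_has_derivative
              bounded_linear_inner_left)
        then show "((\<lambda>t. \<phi> t - t \<bullet> G x) has_derivative (\<lambda>h. h \<bullet> (G t - G x))) (at t within ball x d2)"
          by (auto simp: inner_diff_right intro: has_derivative_at_withinI)
        have "norm (G t - G x) \<le> \<epsilon>" using d2(2)[of t x] t by (simp add: dist_norm norm_minus_commute)
        then have "norm (h \<bullet> (G t - G x)) \<le> \<epsilon> * norm h" for h
          using Cauchy_Schwarz_ineq2[of h "G t - G x"] mult_left_mono[of "norm (G t - G x)" \<epsilon> "norm h"]
          by (simp add: mult.commute)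
        then show "onorm (\<lambda>h. h \<bullet> (G t - G x)) \<le> \<epsilon>" by (rule onorm_le)
      next
        have "norm (y - x - z) < d2" "norm z < d2"
          using y z d norm_triangle_ineq4[of "y - x" z] by (auto intro: le_less_trans)
        then show "y - z \<in> ball x d2" "x - z \<in> ball x d2"
          by (auto simp: dist_norm norm_minus_commute algebra_simps)
      qed auto
      then show ?thesis by (simp add: inner_diff_left algebra_simps)
    qed
    have "(\<psi> y - y \<bullet> G x) - (\<psi> x - x \<bullet> G x)
        = inverse c * (LINT z|lborel. (\<phi> (y - z) - \<phi> (x - z) - (y - x) \<bullet> G x) * b z)"
      unfolding \<psi>_eq using const[of "(y - x) \<bullet> G x"] int[OF \<phi>cx] bi
      by (simp add: left_diff_distrib Bochner_Integration.integral_diff inner_diff_left algebra_simps)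
    also have "\<bar>\<dots>\<bar> \<le> \<epsilon> * norm (y - x)"
      by (rule avg) (auto intro!: continuous_intros \<phi>cx mvt)
    finally show "\<bar>(\<psi> y - y \<bullet> G x) - (\<psi> x - x \<bullet> G x)\<bar> \<le> \<epsilon> * norm (y - x)" .
  qed (use d \<open>0 < \<epsilon>\<close> in auto)
  have "closure {x. \<psi> x \<noteq> 0} \<subseteq> {x. a / 2 \<le> norm x \<and> norm x \<le> r + 1}"
    using supp\<psi> by (intro closure_minimal) (auto intro!: closed_Collect_conj closed_Collect_le continuous_intros)
  moreover have "{x::'a. a / 2 \<le> norm x \<and> norm x \<le> r + 1} \<subseteq> cball 0 (r + 1)" by auto
  ultimately have "test_function (UNIV - {0}) \<psi>"
    unfolding test_function_def using \<psi>C \<open>0 < a\<close>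
    by (auto simp: compact_eq_bounded_closed intro: bounded_subset[OF bounded_cball])
  then show ?thesis using that supp\<psi> close gclose by blast
qed

section \<open>The dilation invariant measure\<close>

text \<open>In polar coordinates this is \<open>dr / r\<close> times the surface measure of the unit
  sphere. Since \<open>0 powr r = 0\<close>, the density vanishes at the origin.\<close>

definition nu :: "'a::euclidean_space measure" where
  "nu = density lborel (\<lambda>x. ennreal (norm x powr (- real DIM('a))))"

definition shell :: "real \<Rightarrow> real \<Rightarrow> 'a::euclidean_space set" where
  "shell a b = {x. a \<le> norm x \<and> norm x \<le> b}"

lemma sets_nu [measurable_cong, simp]: "sets nu = sets borel"
  by (simp add: nu_def)

lemma space_nu [simp]: "space nu = UNIV"
  by (simp add: nu_def)

lemma integral_nu:
  fixes f :: "'a::euclidean_space \<Rightarrow> real"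
  assumes "f \<in> borel_measurable borel"
  shows "integral\<^sup>L nu f = (LINT x|lborel. norm x powr (- real DIM('a)) * f x)"
  unfolding nu_def using assms by (subst integral_density) auto

lemma integrable_nu:
  fixes f :: "'a::euclidean_space \<Rightarrow> real"
  assumes "f \<in> borel_measurable borel"
  shows "integrable nu f \<longleftrightarrow> integrable lborel (\<lambda>x. norm x powr (- real DIM('a)) * f x)"
  unfolding nu_def using assms by (subst integrable_density) auto

lemma compact_shell: "compact (shell a b)"
proof -
  have "closed (shell a b)" "shell a b \<subseteq> cball 0 b" unfolding shell_def
    by (auto intro!: closed_Collect_conj closed_Collect_le continuous_intros)
  then show ?thesis by (auto simp: compact_eq_bounded_closed intro: bounded_subset)
qed

lemma shell_subset: "0 < a \<Longrightarrow> shell a b \<subseteq> - {0}"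
  by (auto simp: shell_def)

lemma shell_sets [measurable]: "shell a b \<in> sets borel"
  by (simp add: borel_compact compact_shell)

lemma borel_measurable_punctured:
  fixes f :: "'a::euclidean_space \<Rightarrow> real"
  shows "continuous_on (- {0}) f \<Longrightarrow> f \<in> borel_measurable borel"
  by (rule borel_measurable_continuous_countable_exceptions[of "{0}"]) auto

lemma integrable_lborel_shell:
  fixes f :: "'a::euclidean_space \<Rightarrow> real"
  assumes f: "continuous_on (- {0}) f" and "0 < a" "\<And>x. f x \<noteq> 0 \<Longrightarrow> x \<in> shell a b"
  shows "integrable lborel f"
proof -
  have "integrable lborel (\<lambda>x. indicator (shell a b) x *\<^sub>R f x)"
    using shell_subset[OF \<open>0 < a\<close>]
    by (intro borel_integrable_compact compact_shell continuous_on_subset[OF f]) auto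
  also have "(\<lambda>x. indicator (shell a b) x *\<^sub>R f x) = f"
    using assms(3) by (force simp: indicator_def)
  finally show ?thesis .
qed

lemma integrable_nu_shell:
  fixes f :: "'a::euclidean_space \<Rightarrow> real"
  assumes f: "continuous_on (- {0}) f" and "0 < a" "\<And>x. f x \<noteq> 0 \<Longrightarrow> x \<in> shell a b"
  shows "integrable nu f"
  unfolding integrable_nu[OF borel_measurable_punctured[OF f]]
  using assms by (intro integrable_lborel_shell[of _ a b]) (auto intro!: continuous_intros)

lemma integrable_nu_indicator_shell:
  fixes f :: "'a::euclidean_space \<Rightarrow> real"
  assumes f: "continuous_on (- {0}) f" and r: "0 < r"
  shows "integrable nu (\<lambda>x. indicator (shell r s) x * f x)"
proof -
  have fm: "f \<in> borel_measurable borel" by (rule borel_measurable_punctured[OF f])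
  have "integrable lborel (\<lambda>x. indicator (shell r s) x *\<^sub>R (norm x powr (- real DIM('a)) * f x))"
    using shell_subset[OF r, of s]
    by (intro borel_integrable_compact compact_shell continuous_on_mult continuous_on_subset[OF f] continuous_intros) auto
  then show ?thesis
    using fm by (subst integrable_nu) (auto simp: mult.left_commute)
qed

lemma continuous_on_dilation:
  assumes "0 < t" "continuous_on (- {0}) (f :: 'a::euclidean_space \<Rightarrow> 'b::topological_space)"
  shows "continuous_on (- {0}) (\<lambda>x. f (t *\<^sub>R x))"
  using assms(1) by (intro continuous_on_compose2[OF assms(2)]) (auto intro!: continuous_intros)

lemma integral_nu_dilation:
  fixes f :: "'a::euclidean_space \<Rightarrow> real"
  assumes [measurable]: "f \<in> borel_measurable borel" and c: "0 < c"
  shows "(LINT x|nu. f (c *\<^sub>R x)) = integral\<^sup>L nu f"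
proof -
  have "integral\<^sup>L nu f = (LINT x|lborel. norm x powr (- real DIM('a)) * f x)"
    by (rule integral_nu) measurable
  also have "\<dots> = c ^ DIM('a) * (LINT x|lborel. norm (c *\<^sub>R x) powr (- real DIM('a)) * f (c *\<^sub>R x))"
    using c by (subst lborel_integral_affine[of _ c 0]) auto
  also have "\<dots> = (LINT x|lborel. norm x powr (- real DIM('a)) * f (c *\<^sub>R x))"
    using c by (subst integral_mult_right_zero[symmetric])
      (simp add: powr_mult powr_minus powr_realpow field_simps)
  also have "\<dots> = (LINT x|nu. f (c *\<^sub>R x))"
    by (rule integral_nu[symmetric]) measurable
  finally show ?thesis by simp
qed

section \<open>Measure of shells\<close>

lemma integrable_indicator_shell: "0 < a \<Longrightarrow> integrable nu (indicator (shell a b) :: 'a::euclidean_space \<Rightarrow> real)"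
proof -
  assume a: "0 < a"
  have "integrable lborel (\<lambda>x::'a. indicator (shell a b) x *\<^sub>R norm x powr (- real DIM('a)))"
    using shell_subset[OF a, of b] by (intro borel_integrable_compact compact_shell continuous_intros) auto
  then show ?thesis by (subst integrable_nu) (auto simp: mult.commute)
qed

lemma emeasure_nu_shell_finite: "0 < a \<Longrightarrow> emeasure nu (shell a b) < \<infinity>"
proof -
  assume "0 < a"
  then have "integrable nu (indicator (shell a b) :: 'a \<Rightarrow> real)"
    by (rule integrable_indicator_shell)
  then show "emeasure nu (shell a b :: 'a set) < \<infinity>" by (simp add: integrable_indicator_iff)
qed

lemma measure_nu_shell_dilation:
  assumes "0 < c"
  shows "measure nu (shell (c * a) (c * b) :: 'a::euclidean_space set) = measure nu (shell a b :: 'a set)"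
proof -
  have "indicator (shell (c * a) (c * b)) (c *\<^sub>R x) = (indicator (shell a b) x :: real)" for x :: 'a
    using assms by (auto simp: shell_def indicator_def)
  then have "integral\<^sup>L nu (\<lambda>x::'a. indicator (shell a b) x :: real)
    = integral\<^sup>L nu (\<lambda>x::'a. indicator (shell (c * a) (c * b)) (c *\<^sub>R x) :: real)" by simp
  also have "\<dots> = integral\<^sup>L nu (\<lambda>x::'a. indicator (shell (c * a) (c * b)) x :: real)"
    by (rule integral_nu_dilation) (use assms in auto)
  finally show ?thesis by simp
qed

text \<open>Each step adds two dilates of \<open>shell 1 (exp 1)\<close>, one at each end. The
  summand \<open>shell 1 1\<close> is the value at \<open>k = 0\<close>.\<close>

lemma measure_nu_shell_linear:
  "measure nu (shell (exp (- real k)) (exp (real k)) :: 'a::euclidean_space set)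
    \<le> 2 * real k * measure nu (shell 1 (exp 1) :: 'a set) + measure nu (shell 1 1 :: 'a set)"
proof (induction k)
  case (Suc k)
  let ?V = "measure nu (shell 1 (exp 1) :: 'a set)"
  let ?E = "shell (exp (- real k)) (exp (real k)) :: 'a set"
  let ?A = "shell (exp (real k)) (exp (real (Suc k))) :: 'a set"
  let ?B = "shell (exp (- real (Suc k))) (exp (- real k)) :: 'a set"
  have A: "measure nu ?A = ?V"
    using measure_nu_shell_dilation[of "exp (real k)" 1 "exp 1"] by (simp add: exp_add mult.commute)
  have B: "measure nu ?B = ?V"
    using measure_nu_shell_dilation[of "exp (- real (Suc k))" 1 "exp 1"]
    by (simp add: exp_add[symmetric])
  have fm: "shell a b \<in> fmeasurable nu" if "0 < a" for a b :: real
    using emeasure_nu_shell_finite[OF that] by (auto simp: fmeasurable_def)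
  have "shell (exp (- real (Suc k))) (exp (real (Suc k))) \<subseteq> (?E \<union> ?A) \<union> ?B"
    by (auto simp: shell_def)
  then have "measure nu (shell (exp (- real (Suc k))) (exp (real (Suc k))) :: 'a set)
      \<le> measure nu ((?E \<union> ?A) \<union> ?B)"
    by (intro measure_mono_fmeasurable fmeasurable.Un fm) auto
  also have "\<dots> \<le> measure nu (?E \<union> ?A) + measure nu ?B"
    by (intro measure_Un_le) auto
  also have "\<dots> \<le> measure nu ?E + measure nu ?A + measure nu ?B"
    by (intro add_right_mono measure_Un_le) auto
  finally show ?case using Suc A B by (simp add: algebra_simps)
qed simp

section \<open>Continuously differentiable functions on the punctured space\<close>

text \<open>Carrying the gradient as an argument lets the product and chain rules compute it. The
  values of \<open>f\<close> and \<open>G\<close> at the origin are unconstrained.\<close>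

definition C1_punctured :: "('a::euclidean_space \<Rightarrow> real) \<Rightarrow> ('a \<Rightarrow> 'a) \<Rightarrow> bool" where
  "C1_punctured f G \<longleftrightarrow> (\<forall>x. x \<noteq> 0 \<longrightarrow> GDERIV f x :> G x) \<and> continuous_on (- {0}) G"

lemma C1_punctured_gderiv: "C1_punctured f G \<Longrightarrow> x \<noteq> 0 \<Longrightarrow> GDERIV f x :> G x"
  and C1_punctured_continuous_gradient: "C1_punctured f G \<Longrightarrow> continuous_on (- {0}) G"
  by (auto simp: C1_punctured_def)

lemma C1_punctured_continuous:
  assumes "C1_punctured f G"
  shows "continuous_on (- {0}) f"
proof (intro continuous_at_imp_continuous_on ballI)
  fix x :: 'a assume "x \<in> - {0}"
  then show "isCont f x"
    using C1_punctured_gderiv[OF assms, of x] unfolding gderiv_def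
    by (auto dest: has_derivative_continuous)
qed

lemma C1_punctured_mult:
  assumes "C1_punctured f F" "C1_punctured g G"
  shows "C1_punctured (\<lambda>x. f x * g x) (\<lambda>x. f x *\<^sub>R G x + g x *\<^sub>R F x)"
  using C1_punctured_continuous[OF assms(1)] C1_punctured_continuous[OF assms(2)] assms
  unfolding C1_punctured_def by (auto intro!: GDERIV_mult continuous_intros)

lemma C1_punctured_add:
  assumes "C1_punctured f F" "C1_punctured g G"
  shows "C1_punctured (\<lambda>x. f x + g x) (\<lambda>x. F x + G x)"
  using assms unfolding C1_punctured_def by (auto intro!: GDERIV_add continuous_intros)

lemma C1_punctured_diff:
  assumes "C1_punctured f F" "C1_punctured g G"
  shows "C1_punctured (\<lambda>x. f x - g x) (\<lambda>x. F x - G x)"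
  using assms unfolding C1_punctured_def by (auto intro!: GDERIV_diff continuous_intros)

lemma C1_punctured_const: "C1_punctured (\<lambda>x. c) (\<lambda>x. 0)"
  unfolding C1_punctured_def by (auto intro!: GDERIV_const continuous_intros)

lemma C1_punctured_compose:
  assumes f: "C1_punctured f F" and S: "\<And>x. x \<noteq> 0 \<Longrightarrow> f x \<in> S"
    and g: "\<And>s. s \<in> S \<Longrightarrow> (g has_real_derivative g' s) (at s)" "continuous_on S g'"
  shows "C1_punctured (\<lambda>x. g (f x)) (\<lambda>x. g' (f x) *\<^sub>R F x)"
  unfolding C1_punctured_def
proof (intro conjI allI impI continuous_intros)
  show "continuous_on (- {0}) (\<lambda>x. g' (f x))"
    using S by (intro continuous_on_compose2[OF g(2) C1_punctured_continuous[OF f]]) auto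
  show "GDERIV (\<lambda>x. g (f x)) x :> g' (f x) *\<^sub>R F x" if "x \<noteq> 0" for x
    using GDERIV_DERIV_compose[OF C1_punctured_gderiv[OF f that] g(1)[OF S[OF that]]] .
qed (rule C1_punctured_continuous_gradient[OF f])

lemma C1_punctured_cong:
  assumes "C1_punctured f F" "\<And>x. x \<noteq> 0 \<Longrightarrow> f x = g x" "\<And>x. x \<noteq> 0 \<Longrightarrow> F x = G x"
  shows "C1_punctured g G"
  unfolding C1_punctured_def gderiv_def
proof (intro conjI allI impI)
  show "continuous_on (- {0}) G"
    using assms by (subst continuous_on_cong[OF refl, of _ _ F]) (auto simp: C1_punctured_def)
  fix x :: 'a assume "x \<noteq> 0"
  then have "(f has_derivative (\<lambda>h. h \<bullet> G x)) (at x)"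
    using assms by (auto simp: C1_punctured_def gderiv_def)
  from has_derivative_transform_within_open[OF this, of "- {0}" g] \<open>x \<noteq> 0\<close>
  show "(g has_derivative (\<lambda>h. h \<bullet> G x)) (at x)" by (auto simp: assms)
qed

lemma C1_punctured_norm: "C1_punctured norm sgn"
  unfolding C1_punctured_def by (auto intro: GDERIV_norm continuous_on_sgn continuous_intros)

lemma C1_punctured_powr: "C1_punctured (\<lambda>x. norm x powr s) (\<lambda>x. (s * norm x powr (s - 1)) *\<^sub>R sgn x)"
  by (rule C1_punctured_compose[OF C1_punctured_norm, of "{0<..}"])
    (auto intro!: derivative_eq_intros continuous_intros)

lemma C1_punctured_ln: "C1_punctured (\<lambda>x. ln (norm x)) (\<lambda>x. (1 / norm x) *\<^sub>R sgn x)"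
  by (rule C1_punctured_compose[OF C1_punctured_norm, of "{0<..}"])
    (auto intro!: derivative_eq_intros continuous_intros)

lemma C1_punctured_dilation:
  assumes "C1_punctured f G" "c \<noteq> 0"
  shows "C1_punctured (\<lambda>x. f (c *\<^sub>R x)) (\<lambda>x. c *\<^sub>R G (c *\<^sub>R x))"
  unfolding C1_punctured_def gderiv_def
proof (intro conjI allI impI)
  have "continuous_on (- {0}) (\<lambda>x. G (c *\<^sub>R x))"
    using assms by (intro continuous_on_compose2[OF C1_punctured_continuous_gradient[OF assms(1)]])
      (auto intro!: continuous_intros)
  then show "continuous_on (- {0}) (\<lambda>x. c *\<^sub>R G (c *\<^sub>R x))" by (intro continuous_intros)
  fix x :: 'a assume "x \<noteq> 0"
  have "((\<lambda>x. c *\<^sub>R x) has_derivative (\<lambda>h. c *\<^sub>R h)) (at x)" by (auto intro!: derivative_eq_intros)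
  from has_derivative_compose[OF this, of f "\<lambda>h. h \<bullet> G (c *\<^sub>R x)"] \<open>x \<noteq> 0\<close> assms
  show "((\<lambda>x. f (c *\<^sub>R x)) has_derivative (\<lambda>h. h \<bullet> c *\<^sub>R G (c *\<^sub>R x))) (at x)"
    by (simp add: C1_punctured_def gderiv_def)
qed

lemma gradient_zero_outside_shell:
  assumes "C1_punctured f G" "\<And>x. f x \<noteq> 0 \<Longrightarrow> x \<in> shell a b" "x \<noteq> 0" "x \<notin> shell a b"
  shows "G x = 0"
proof (rule gderiv_zero_open[OF C1_punctured_gderiv[OF assms(1,3)], of "- shell a b"])
  show "open (- shell a b)" by (simp add: compact_imp_closed compact_shell open_Compl)
qed (use assms in auto)

text \<open>Mollification works on the whole space. The function vanishes near the origin, so only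
  the arbitrary value of \<open>G\<close> at \<open>0\<close> has to be corrected.\<close>

lemma C1_punctured_extend:
  assumes f: "C1_punctured f G" and "0 < c" "\<And>x. f x \<noteq> 0 \<Longrightarrow> x \<in> shell c d"
  defines "G0 \<equiv> (\<lambda>x. if x = 0 then 0 else G x)"
  shows "GDERIV f x :> G0 x" "continuous_on UNIV G0"
proof -
  have z: "f y = 0" if "y \<in> ball 0 c" for y using assms(3)[of y] that by (auto simp: shell_def)
  have "((\<lambda>x. 0::real) has_derivative (\<lambda>h. 0)) (at (0::'a))" by simp
  then have "(f has_derivative (\<lambda>h. 0)) (at 0)"
    by (rule has_derivative_transform_within_open[OF _ open_ball[of 0 c]]) (use z \<open>0 < c\<close> in auto)
  then have "GDERIV f 0 :> 0" by (simp add: gderiv_def)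
  then show "GDERIV f x :> G0 x" using C1_punctured_gderiv[OF f, of x] by (auto simp: G0_def)
  have "G0 y = 0" if "y \<in> ball 0 c" for y
    using gradient_zero_outside_shell[OF f assms(3), of y] that by (auto simp: G0_def shell_def)
  then have 1: "continuous_on (ball 0 c) G0"
    using continuous_on_const by (subst continuous_on_cong[OF refl, of _ _ "\<lambda>_. 0"]) auto
  have 2: "continuous_on (- {0}) G0"
    using C1_punctured_continuous_gradient[OF f] by (rule continuous_on_eq) (auto simp: G0_def)
  have "continuous_on (ball 0 c \<union> - {0}) G0" by (rule continuous_on_open_Un[OF _ _ 1 2]) auto
  moreover have "ball 0 c \<union> - {0} = (UNIV :: 'a set)" using \<open>0 < c\<close> by auto
  ultimately show "continuous_on UNIV G0" by simp
qed

lemma sgn_inner_self: "x \<noteq> 0 \<Longrightarrow> sgn x \<bullet> sgn x = (1::real)"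
  by (simp add: norm_sgn dot_square_norm)

lemma norm_scaleR_sgn: "norm x *\<^sub>R sgn x = x"
  by (cases "x = 0") (simp_all add: sgn_div_norm)

lemma continuous_on_sgn_punctured: "continuous_on (- {0}) (sgn :: 'a::euclidean_space \<Rightarrow> 'a)"
  by (rule C1_punctured_continuous_gradient[OF C1_punctured_norm])

lemma C1_punctured_constant:
  fixes f :: "'a::euclidean_space \<Rightarrow> real"
  assumes dim: "2 \<le> DIM('a)" and f: "C1_punctured f G" and G: "\<And>x. x \<noteq> 0 \<Longrightarrow> G x = 0"
  obtains c where "\<And>x. x \<noteq> 0 \<Longrightarrow> f x = c"
proof -
  obtain b :: 'a where "b \<in> Basis" using nonempty_Basis by blast
  then have b: "b \<noteq> 0" by auto
  have "f x = f b" if "x \<noteq> 0" for x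
  proof (rule has_derivative_zero_unique_connected[of "- {0}" f])
    show "connected (- {0::'a})" by (rule connected_punctured_universe[OF dim])
    fix y :: 'a assume "y \<in> - {0}"
    then show "(f has_derivative (\<lambda>x. 0)) (at y)"
      using C1_punctured_gderiv[OF f, of y] G[of y] by (auto simp: gderiv_def)
  qed (use that b in auto)
  then show ?thesis using that by blast
qed

lemma C1_holder_loc_imp_C1_punctured:
  assumes u: "C1_holder_loc \<alpha> (UNIV - {0}) u" and "0 < \<alpha>"
  shows "C1_punctured u (gradient u)"
  unfolding C1_punctured_def
proof (intro conjI allI impI continuous_at_imp_continuous_on ballI)
  show "GDERIV u x :> gradient u x" if "x \<noteq> 0" for x
    using u that by (intro gderiv_gradient) (auto simp: C1_holder_loc_def)
  fix x :: 'a assume "x \<in> - {0}"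
  then have x: "x \<noteq> 0" by simp
  let ?K = "cball x (norm x / 2)"
  have "?K \<subseteq> UNIV - {0}" using x by (auto simp: dist_norm)
  then obtain L where L: "\<And>y z. y \<in> ?K \<Longrightarrow> z \<in> ?K \<Longrightarrow> norm (gradient u y - gradient u z) \<le> L * dist y z powr \<alpha>"
    using u unfolding C1_holder_loc_def by (meson compact_cball)
  have "((\<lambda>y. dist y x) \<longlongrightarrow> 0) (at x)"
    using tendsto_dist_iff[of "\<lambda>y. y" x "at x"] tendsto_ident_at by auto
  then have "((\<lambda>y. dist y x powr \<alpha>) \<longlongrightarrow> 0 powr \<alpha>) (at x)"
    using \<open>0 < \<alpha>\<close> by (intro tendsto_powr' tendsto_const) auto
  then have 0: "((\<lambda>y. L * dist y x powr \<alpha>) \<longlongrightarrow> 0) (at x)"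
    by (intro tendsto_mult_right_zero) simp
  have "((\<lambda>y. gradient u y - gradient u x) \<longlongrightarrow> 0) (at x)"
  proof (rule Lim_null_comparison[OF _ 0])
    have "\<forall>\<^sub>F y in at x. y \<in> ball x (norm x / 2)"
      using x by (intro eventually_at_in_open') auto
    then show "\<forall>\<^sub>F y in at x. norm (gradient u y - gradient u x) \<le> L * dist y x powr \<alpha>"
      by eventually_elim (use L in \<open>auto intro: less_imp_le\<close>)
  qed
  then show "isCont (gradient u) x" unfolding isCont_def by (simp add: LIM_zero_iff)
qed

section \<open>Differentiation along dilations\<close>

lemma dilation_derivative:
  assumes f: "C1_punctured f G" and "x \<noteq> 0" "t > 0"
  shows "((\<lambda>t. f (t *\<^sub>R x)) has_real_derivative (x \<bullet> G (t *\<^sub>R x))) (at t)"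
proof -
  have "((\<lambda>t. t *\<^sub>R x) has_derivative (\<lambda>h. h *\<^sub>R x)) (at t)" by (auto intro!: derivative_eq_intros)
  from has_derivative_compose[OF this, of f "\<lambda>h. h \<bullet> G (t *\<^sub>R x)"] assms
  show ?thesis by (simp add: C1_punctured_def gderiv_def has_field_derivative_def mult_commute_abs)
qed

text \<open>Majorant for dominated convergence. With y = s x, the radial derivative x \<bullet> G(s
  x) is y \<bullet> G(y) divided by s; the numerator is bounded on the enlarged compact shell, and 1
  / s \<le> 2.\<close>

lemma dilation_lipschitz:
  fixes f :: "'a::euclidean_space \<Rightarrow> real"
  assumes f: "C1_punctured f G" and "0 < a"
  obtains M where "M \<ge> 0"
    "\<And>x t. x \<in> shell a b \<Longrightarrow> 1 / 2 \<le> t \<Longrightarrow> t \<le> 2 \<Longrightarrow> \<bar>f (t *\<^sub>R x) - f x\<bar> \<le> M * \<bar>t - 1\<bar>"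
proof -
  have "compact ((\<lambda>x. x \<bullet> G x) ` shell (a / 2) (2 * b))"
    using \<open>0 < a\<close> shell_subset[of "a / 2"] C1_punctured_continuous_gradient[OF f]
    by (intro compact_continuous_image compact_shell continuous_intros) (auto intro: continuous_on_subset)
  then obtain M where M: "\<And>x. x \<in> shell (a / 2) (2 * b) \<Longrightarrow> \<bar>x \<bullet> G x\<bar> \<le> M"
    by (force dest!: compact_imp_bounded simp: bounded_iff)
  show thesis
  proof (rule that[of "2 * \<bar>M\<bar>"])
    fix x :: 'a and t :: real assume x: "x \<in> shell a b" and t: "1 / 2 \<le> t" "t \<le> 2"
    have x0: "x \<noteq> 0" using x \<open>0 < a\<close> by (auto simp: shell_def)
    have "norm (f (t *\<^sub>R x) - f (1 *\<^sub>R x)) \<le> 2 * \<bar>M\<bar> * norm (t - 1)"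
    proof (rule field_differentiable_bound[of "{1/2..2}" "\<lambda>t. f (t *\<^sub>R x)" "\<lambda>s. x \<bullet> G (s *\<^sub>R x)"])
      fix s :: real assume s: "s \<in> {1/2..2}"
      show "((\<lambda>t. f (t *\<^sub>R x)) has_field_derivative x \<bullet> G (s *\<^sub>R x)) (at s within {1/2..2})"
        using dilation_derivative[OF f x0, of s] s by (simp add: has_field_derivative_at_within)
      have "a * (1 / 2) \<le> norm x * s" "s * norm x \<le> 2 * b"
        using x s \<open>0 < a\<close> mult_mono[of a "norm x" "1 / 2" s] mult_mono[of s 2 "norm x" b]
        by (auto simp: shell_def)
      then have "s *\<^sub>R x \<in> shell (a / 2) (2 * b)"
        using s by (simp add: shell_def mult.commute)
      from M[OF this] have "s * \<bar>x \<bullet> G (s *\<^sub>R x)\<bar> \<le> \<bar>M\<bar>" using s by (simp add: abs_mult)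
      moreover have "1 / 2 * \<bar>x \<bullet> G (s *\<^sub>R x)\<bar> \<le> s * \<bar>x \<bullet> G (s *\<^sub>R x)\<bar>"
        using s by (intro mult_right_mono) auto
      ultimately show "norm (x \<bullet> G (s *\<^sub>R x)) \<le> 2 * \<bar>M\<bar>" by simp
    qed (use t in auto)
    then show "\<bar>f (t *\<^sub>R x) - f x\<bar> \<le> 2 * \<bar>M\<bar> * \<bar>t - 1\<bar>" by simp
  qed auto
qed

lemma dilation_quotient_tendsto:
  assumes "C1_punctured f G" "x \<noteq> 0" "t \<longlonglongrightarrow> 1" "\<And>i. t i \<noteq> (1::real)"
  shows "(\<lambda>i. (f (t i *\<^sub>R x) - f x) / (t i - 1)) \<longlonglongrightarrow> x \<bullet> G x"
proof -
  have "((\<lambda>s. (f (s *\<^sub>R x) - f (1 *\<^sub>R x)) / (s - 1)) \<longlongrightarrow> x \<bullet> G (1 *\<^sub>R x)) (at 1)"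
    using dilation_derivative[OF assms(1,2), of 1] by (simp add: has_field_derivative_iff)
  moreover have "filterlim t (at 1) sequentially"
    using assms by (auto simp: filterlim_at)
  ultimately show ?thesis by (auto dest: filterlim_compose)
qed

lemma integral_nu_dilation_quotient:
  fixes f :: "'a::euclidean_space \<Rightarrow> real"
  assumes f: "C1_punctured f G" and h: "continuous_on (- {0}) h" and "0 < a"
    and supp: "\<And>x s. 1 / 2 \<le> s \<Longrightarrow> s \<le> 2 \<Longrightarrow> x \<noteq> 0 \<Longrightarrow> (f (s *\<^sub>R x) - f x) * h x \<noteq> 0 \<Longrightarrow> x \<in> shell a b"
    and t: "t \<longlonglongrightarrow> 1" "\<And>i. t i \<noteq> 1" "\<And>i. 1 / 2 \<le> t i" "\<And>i. t i \<le> 2"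
  shows "(\<lambda>i. (LINT x|nu. (f (t i *\<^sub>R x) - f x) / (t i - 1) * h x)) \<longlonglongrightarrow> (LINT x|nu. (x \<bullet> G x) * h x)"
proof -
  obtain M where M: "M \<ge> 0"
    "\<And>x t. x \<in> shell a b \<Longrightarrow> 1 / 2 \<le> t \<Longrightarrow> t \<le> 2 \<Longrightarrow> \<bar>f (t *\<^sub>R x) - f x\<bar> \<le> M * \<bar>t - 1\<bar>"
    using dilation_lipschitz[OF f \<open>0 < a\<close>] by blast
  have "compact (h ` shell a b)"
    using shell_subset[OF \<open>0 < a\<close>] by (intro compact_continuous_image compact_shell continuous_on_subset[OF h]) auto
  then obtain B where B: "\<And>x. x \<in> shell a b \<Longrightarrow> \<bar>h x\<bar> \<le> B"
    by (force dest!: compact_imp_bounded simp: bounded_iff)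
  have fc: "continuous_on (- {0}) f" by (rule C1_punctured_continuous[OF f])
  have ft: "continuous_on (- {0}) (\<lambda>x. f (t i *\<^sub>R x))" for i
    using t(3)[of i] by (intro continuous_on_compose2[OF fc]) (auto intro!: continuous_intros)
  have AE0: "AE x in nu. x \<noteq> (0::'a)"
    unfolding nu_def by (subst AE_density) (auto intro: AE_mp[OF AE_lborel_singleton[of 0]])
  show ?thesis
  proof (rule integral_dominated_convergence[where w = "\<lambda>x. M * B * indicator (shell a b) x"])
    show "(\<lambda>x. (x \<bullet> G x) * h x) \<in> borel_measurable nu"
      unfolding measurable_cong_sets[OF sets_nu refl]
      by (intro borel_measurable_punctured continuous_intros C1_punctured_continuous_gradient[OF f] h)
    show "(\<lambda>x. (f (t i *\<^sub>R x) - f x) / (t i - 1) * h x) \<in> borel_measurable nu" for i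
      unfolding measurable_cong_sets[OF sets_nu refl] using t(2)[of i]
      by (intro borel_measurable_punctured continuous_intros fc ft h) auto
    show "integrable nu (\<lambda>x::'a. M * B * indicator (shell a b) x)"
      by (intro integrable_mult_right integrable_indicator_shell \<open>0 < a\<close>)
    show "AE x in nu. (\<lambda>i. (f (t i *\<^sub>R x) - f x) / (t i - 1) * h x) \<longlonglongrightarrow> (x \<bullet> G x) * h x"
      using AE0 by eventually_elim (intro tendsto_intros dilation_quotient_tendsto[OF f _ t(1,2)])
    show "AE x in nu. norm ((f (t i *\<^sub>R x) - f x) / (t i - 1) * h x) \<le> M * B * indicator (shell a b) x" for i
      using AE0
    proof eventually_elim
      case (elim x)
      show ?case
      proof (cases "x \<in> shell a b")
        case True
        have "\<bar>f (t i *\<^sub>R x) - f x\<bar> / \<bar>t i - 1\<bar> \<le> M"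
          using M(2)[OF True t(3,4)] t(2)[of i] by (simp add: field_simps)
        then have "\<bar>f (t i *\<^sub>R x) - f x\<bar> / \<bar>t i - 1\<bar> * \<bar>h x\<bar> \<le> M * B"
          using B[OF True] M(1) by (intro mult_mono) auto
        then show ?thesis using True by (simp add: abs_mult)
      next
        case False
        then have "(f (t i *\<^sub>R x) - f x) * h x = 0" using supp[OF t(3,4) elim] by blast
        then show ?thesis using False by simp
      qed
    qed
  qed
qed

text \<open>The integral of f(t x) does not depend on t; this is its derivative at t = 1. It serves
  as integration by parts for the radial field \<open>x |x|^(-n)\<close>, which is divergence free
  off the origin.\<close>

lemma integral_nu_radial_derivative:
  fixes f :: "'a::euclidean_space \<Rightarrow> real"
  assumes f: "C1_punctured f G" and "0 < a" and supp: "\<And>x. f x \<noteq> 0 \<Longrightarrow> x \<in> shell a b"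
  shows "(LINT x|nu. x \<bullet> G x) = 0"
proof -
  define t where "t i = 1 + 1 / (real i + 2)" for i
  have t: "t \<longlonglongrightarrow> 1" "t i \<noteq> 1" "1 / 2 \<le> t i" "t i \<le> 2" "0 < t i" for i
  proof -
    have "(\<lambda>i. 1 + 1 / (real i + 2)) \<longlonglongrightarrow> 1" by real_asymp
    then show "t \<longlonglongrightarrow> 1" by (simp add: t_def[abs_def])
  qed (auto simp: t_def field_simps)
  have fc: "continuous_on (- {0}) f" by (rule C1_punctured_continuous[OF f])
  have supp': "x \<in> shell (a / 2) (2 * b)" if "f (s *\<^sub>R x) \<noteq> 0" "1 / 2 \<le> s" "s \<le> 2" for x s
  proof -
    have "a \<le> s * norm x" "s * norm x \<le> b" using supp[OF that(1)] that by (auto simp: shell_def)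
    moreover have "s * norm x \<le> 2 * norm x" "1/2 * norm x \<le> s * norm x"
      using mult_right_mono[of s 2 "norm x"] mult_right_mono[of "1 / 2" s "norm x"] that by auto
    ultimately show ?thesis by (auto simp: shell_def)
  qed
  have lim: "(\<lambda>i. (LINT x|nu. (f (t i *\<^sub>R x) - f x) / (t i - 1) * 1)) \<longlonglongrightarrow> (LINT x|nu. (x \<bullet> G x) * 1)"
  proof (rule integral_nu_dilation_quotient[OF f, of _ "a / 2" "2 * b"])
    fix x :: 'a and s :: real
    assume "1 / 2 \<le> s" "s \<le> 2" "(f (s *\<^sub>R x) - f x) * 1 \<noteq> 0"
    then show "x \<in> shell (a / 2) (2 * b)"
      using supp'[of s x] supp'[of 1 x] by (cases "f x = 0") auto
  qed (use t \<open>0 < a\<close> in auto)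
  have z: "(LINT x|nu. (f (t i *\<^sub>R x) - f x) / (t i - 1) * 1) = 0" for i
  proof -
    have "integrable nu (\<lambda>x. f (t i *\<^sub>R x))"
      using t(3,4)[of i] t(5)[of i] \<open>0 < a\<close>
      by (intro integrable_nu_shell[of _ "a / 2" "2 * b"] continuous_on_compose2[OF fc])
        (auto intro!: continuous_intros supp'[of "t i"])
    moreover have "integrable nu f" by (rule integrable_nu_shell[OF fc \<open>0 < a\<close> supp])
    moreover have "(LINT x|nu. f (t i *\<^sub>R x)) = integral\<^sup>L nu f"
      by (rule integral_nu_dilation[OF borel_measurable_punctured[OF fc] t(5)])
    ultimately show ?thesis by simp
  qed
  show ?thesis using LIMSEQ_unique[OF lim[unfolded z] tendsto_const] by simp
qed

text \<open>\<open>c\<close> and \<open>S\<close> depend on \<open>f\<close> only, so the bound is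
  uniform over all cutoffs of \<open>f\<close> that equal \<open>f\<close> on the shell.\<close>

lemma nu_integral_lower_bound:
  fixes f :: "'a::euclidean_space \<Rightarrow> real"
  assumes f: "continuous_on (- {0}) f" and x0: "x0 \<noteq> 0" "0 < f x0"
  obtains c S where "0 < c" "0 < S"
    "\<And>g. integrable nu g \<Longrightarrow> (\<And>x. 0 \<le> g x) \<Longrightarrow>
      (\<And>x. x \<in> shell (exp (- S)) (exp S) \<Longrightarrow> f x \<le> g x) \<Longrightarrow> c \<le> integral\<^sup>L nu g"
proof -
  have "isCont f x0"
    using f x0 continuous_on_eq_continuous_at[of "- {0}" f] by auto
  then have "\<forall>\<^sub>F x in at x0. f x0 / 2 < f x"
    using x0 by (intro order_tendstoD(1)[of _ "f x0"]) (auto simp: isCont_def)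
  then obtain s where s: "s > 0" "\<And>x. x \<noteq> x0 \<Longrightarrow> dist x x0 < s \<Longrightarrow> f x0 / 2 < f x"
    by (auto simp: eventually_at)
  define r where "r = min s (norm x0 / 2)"
  have r: "0 < r" "r \<le> s" "r \<le> norm x0 / 2" using s x0 by (auto simp: r_def)
  have fge: "f x0 / 2 \<le> f x" if "x \<in> ball x0 r" for x
    using s(2)[of x] that r x0 by (cases "x = x0") (auto simp: dist_commute intro: less_imp_le)
  have nx: "norm x0 / 2 \<le> norm x" "norm x \<le> 2 * norm x0" if "x \<in> ball x0 r" for x
    using that r norm_triangle_ineq2[of x0 x] norm_triangle_ineq2[of x x0]
    by (auto simp: dist_norm norm_minus_commute)
  \<comment> \<open>On the ball around \<open>x0\<close> the norm lies between
    \<open>|x0| / 2\<close> and \<open>2 |x0|\<close>; \<open>S\<close> is large enough for the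
    logarithms of both.\<close>
  define S where "S = \<bar>ln (norm x0 / 2)\<bar> + \<bar>ln (2 * norm x0)\<bar> + 1"
  have S: "0 < S" by (simp add: S_def)
  have bS: "ball x0 r \<subseteq> shell (exp (- S)) (exp S)"
  proof
    fix x assume x: "x \<in> ball x0 r"
    have "exp (- S) \<le> exp (ln (norm x0 / 2))" "exp (ln (2 * norm x0)) \<le> exp S"
      unfolding exp_le_cancel_iff S_def by linarith+
    then show "x \<in> shell (exp (- S)) (exp S)" using nx[OF x] x0 by (simp add: shell_def)
  qed
  define c where "c = (LINT x|nu. f x0 / 2 * indicator (ball x0 r) x)"
  have bi: "integrable nu (indicator (ball x0 r) :: 'a \<Rightarrow> real)"
  proof (rule Bochner_Integration.integrable_bound)
    show "integrable nu (indicator (shell (exp (- S)) (exp S)) :: 'a \<Rightarrow> real)"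
      by (rule integrable_indicator_shell) simp
    show "indicator (ball x0 r) \<in> borel_measurable nu"
      by (rule borel_measurable_indicator) simp
    show "AE x in nu. norm (indicator (ball x0 r) x :: real) \<le> norm (indicator (shell (exp (- S)) (exp S)) x :: real)"
      using bS by (intro AE_I2) (auto simp: indicator_def)
  qed
  have "0 < (LINT x|lborel. norm x powr (- real DIM('a)) * (f x0 / 2 * indicator (ball x0 r) x))"
  proof (rule integral_pos_ball)
    show "integrable lborel (\<lambda>x. norm x powr (- real DIM('a)) * (f x0 / 2 * indicator (ball x0 r) x))"
      by (subst integrable_nu[symmetric]) (use bi in auto)
    show "0 < r" by fact
    show "0 < (2 * norm x0) powr (- real DIM('a)) * (f x0 / 2)" using x0 by simp
    fix x assume x: "x \<in> ball x0 r"
    have "0 < norm x" using nx[OF x] x0 by auto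
    then have "(2 * norm x0) powr (- real DIM('a)) \<le> norm x powr (- real DIM('a))"
      using nx[OF x] by (intro powr_mono2') auto
    then show "(2 * norm x0) powr (- real DIM('a)) * (f x0 / 2)
        \<le> norm x powr (- real DIM('a)) * (f x0 / 2 * indicator (ball x0 r) x)"
      using x x0 by (simp add: mult_right_mono)
  qed (use x0 in \<open>auto simp: indicator_def\<close>)
  moreover have "(\<lambda>x. f x0 / 2 * indicator (ball x0 r) x) \<in> borel_measurable borel"
    by (intro borel_measurable_times borel_measurable_const borel_measurable_indicator) auto
  ultimately have "0 < c" unfolding c_def using integral_nu by metis
  show ?thesis
  proof (rule that[OF \<open>0 < c\<close> S])
    fix g :: "'a \<Rightarrow> real" assume g: "integrable nu g" "\<And>x. 0 \<le> g x"
      "\<And>x. x \<in> shell (exp (- S)) (exp S) \<Longrightarrow> f x \<le> g x"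
    show "c \<le> integral\<^sup>L nu g" unfolding c_def
    proof (rule integral_mono)
      fix x :: 'a
      show "f x0 / 2 * indicator (ball x0 r) x \<le> g x"
        using g(2)[of x] g(3)[of x] fge[of x] bS by (cases "x \<in> ball x0 r") force+
    qed (use bi g in auto)
  qed
qed

section \<open>Radial cutoff functions\<close>

lemma has_real_derivative_pos_part_power:
  assumes "m \<ge> 2"
  shows "((\<lambda>t::real. max 0 t ^ m) has_real_derivative (real m * max 0 t ^ (m - 1))) (at t)"
proof -
  consider "t > 0" | "t < 0" | "t = 0" by linarith
  then show ?thesis
  proof cases
    case 1
    have "((\<lambda>t::real. t ^ m) has_real_derivative (real m * max 0 t ^ (m - 1))) (at t)"
      using 1 by (auto intro!: derivative_eq_intros)
    then show ?thesis
      by (rule has_field_derivative_transform_within_open[of _ _ _ "{0<..}"]) (use 1 in auto)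
  next
    case 2
    have "((\<lambda>t::real. 0) has_real_derivative (real m * max 0 t ^ (m - 1))) (at t)"
      using 2 assms by (auto simp: power_0_left)
    then show ?thesis
      by (rule has_field_derivative_transform_within_open[of _ _ _ "{..<0}"]) (use 2 assms in auto)
  next
    case 3
    have "((\<lambda>h::real. \<bar>h\<bar>) \<longlongrightarrow> 0) (at 0)" by (rule tendsto_rabs_zero) (rule tendsto_ident_at)
    then have "((\<lambda>h::real. max 0 h ^ m / h) \<longlongrightarrow> 0) (at 0)"
    proof (rule Lim_null_comparison[rotated])
      have "\<forall>\<^sub>F h::real in at 0. \<bar>h\<bar> < 1" by (auto simp: eventually_at intro!: exI[of _ 1])
      then show "\<forall>\<^sub>F h::real in at 0. norm (max 0 h ^ m / h) \<le> \<bar>h\<bar>"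
      proof eventually_elim
        case (elim h)
        show ?case
        proof (cases "h > 0")
          case True
          have "h ^ m \<le> h ^ 2" using elim True assms by (intro power_decreasing) auto
          then show ?thesis using True by (simp add: field_simps power2_eq_square)
        qed (use assms in \<open>auto simp: max_def power_0_left\<close>)
      qed
    qed
    then show ?thesis using 3 assms by (simp add: has_field_derivative_iff power_0_left)
  qed
qed

text \<open>Equal to 1 for \<open>s \<le> 0\<close> and to 0 for \<open>s \<ge> 1\<close>. The power
  \<open>m\<close> is there for \<open>step'_bound\<close>: if \<open>m \<ge> p\<close>, then
  \<open>m - 1 \<ge> m (p - 1) / p\<close>, hence the slope is dominated by the power
  \<open>(p - 1) / p\<close> of the function, which Young's inequality can absorb.\<close>

definition step :: "nat \<Rightarrow> real \<Rightarrow> real" where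
  "step m s = max 0 (1 - max 0 s ^ 2) ^ m"

definition step' :: "nat \<Rightarrow> real \<Rightarrow> real" where
  "step' m s = - (2 * real m) * max 0 (1 - max 0 s ^ 2) ^ (m - 1) * max 0 s"

lemma step_deriv:
  assumes "m \<ge> 2"
  shows "(step m has_real_derivative step' m s) (at s)"
proof -
  have "((\<lambda>s. 1 - max 0 s ^ 2) has_real_derivative (- (2 * max 0 s))) (at s)"
    using DERIV_diff[OF DERIV_const has_real_derivative_pos_part_power[of 2 s]] by simp
  from DERIV_chain2[OF has_real_derivative_pos_part_power[OF assms] this]
  show ?thesis unfolding step_def[abs_def] step'_def by (simp add: algebra_simps)
qed

lemma step_bounds: "0 \<le> step m s" "step m s \<le> 1"
  by (auto simp: step_def intro!: power_le_one)

lemma step_base_eq_0: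
  assumes "s \<ge> 1"
  shows "max 0 (1 - max 0 s ^ 2) = (0::real)"
proof -
  have "max 0 s = s" using assms by simp
  then have "1 - max 0 s ^ 2 \<le> 0" using one_le_power[OF assms, of 2] by linarith
  then show ?thesis by (rule max_absorb1)
qed

lemma step_eq_1: "s \<le> 0 \<Longrightarrow> step m s = 1" and step_eq_0: "m \<ge> 1 \<Longrightarrow> s \<ge> 1 \<Longrightarrow> step m s = 0"
  unfolding step_def by (simp add: max_def) (simp only: step_base_eq_0, simp)

lemma step'_nonpos: "step' m s \<le> 0"
  by (auto simp: step'_def mult_nonneg_nonneg)

lemma step'_eq_0: "s \<le> 0 \<Longrightarrow> step' m s = 0" "m \<ge> 2 \<Longrightarrow> s \<ge> 1 \<Longrightarrow> step' m s = 0"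
  unfolding step'_def by (simp add: max_def) (simp only: step_base_eq_0, simp)

lemma step'_continuous: "continuous_on S (step' m)"
  unfolding step'_def[abs_def] by (intro continuous_intros)

lemma step'_bound:
  assumes "m \<ge> 2" "real m \<ge> p" "p > 1"
  shows "\<bar>step' m s\<bar> \<le> 2 * real m * step m s powr ((p - 1) / p)"
proof (cases "s < 1")
  case True
  define q where "q = max 0 (1 - max 0 s ^ 2)"
  have q: "0 < q" "q \<le> 1" using True by (auto simp: q_def max_def power_less_one_iff power_le_one)
  have "q ^ (m - 1) = q powr (real (m - 1))" using q by (simp add: powr_realpow)
  also have "\<dots> \<le> q powr (real m * ((p - 1) / p))"
    using q assms by (intro powr_mono') (auto simp: field_simps of_nat_diff)
  also have "\<dots> = (q ^ m) powr ((p - 1) / p)" using q by (simp add: powr_realpow[symmetric] powr_powr)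
  finally have "q ^ (m - 1) * max 0 s \<le> (q ^ m) powr ((p - 1) / p) * 1"
    using True q by (intro mult_mono) auto
  moreover have "\<bar>step' m s\<bar> = 2 * real m * (q ^ (m - 1) * max 0 s)"
    using q by (simp add: step'_def q_def[symmetric] abs_mult)
  ultimately show ?thesis using assms by (simp add: step_def q_def[symmetric])
qed (use assms in \<open>simp add: step'_eq_0\<close>)

text \<open>The origin is treated separately because \<open>ln 0 = 0\<close> would give the value 1 there.\<close>

definition cutoff :: "nat \<Rightarrow> real \<Rightarrow> real \<Rightarrow> 'a::euclidean_space \<Rightarrow> real" where
  "cutoff m T N x = (if x = 0 then 0 else step m ((ln (norm x) - T) / N) * step m ((- ln (norm x) - T) / N))"

text \<open>Derivative of \<open>cutoff\<close> with respect to \<open>ln |x|\<close>, that is, x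
  times its gradient. The product rule leaves a plain difference because, for \<open>T > 0\<close>
  and \<open>N > 0\<close>, one factor equals 1 wherever the other varies.\<close>

definition cutoff' :: "nat \<Rightarrow> real \<Rightarrow> real \<Rightarrow> 'a::euclidean_space \<Rightarrow> real" where
  "cutoff' m T N x = (if x = 0 then 0 else
     (step' m ((ln (norm x) - T) / N) - step' m ((- ln (norm x) - T) / N)) / N)"

lemma cutoff'_cases:
  assumes "T > 0" "N > 0" "x \<noteq> 0"
  obtains "ln (norm x) \<ge> 0" "cutoff' m T N x = step' m ((ln (norm x) - T) / N) / N"
      "cutoff m T N x = step m ((ln (norm x) - T) / N)" "step' m ((- ln (norm x) - T) / N) = 0"
      "step m ((- ln (norm x) - T) / N) = 1"
  | "ln (norm x) \<le> 0" "cutoff' m T N x = - step' m ((- ln (norm x) - T) / N) / N"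
      "cutoff m T N x = step m ((- ln (norm x) - T) / N)" "step' m ((ln (norm x) - T) / N) = 0"
      "step m ((ln (norm x) - T) / N) = 1"
proof (cases "ln (norm x) \<ge> 0")
  case True
  then have "(- ln (norm x) - T) / N \<le> 0" using assms(1,2) by (intro divide_nonpos_pos) linarith+
  then show ?thesis using that(1) True assms by (auto simp: cutoff_def cutoff'_def step'_eq_0 step_eq_1)
next
  case False
  then have "(ln (norm x) - T) / N \<le> 0" using assms(1,2) by (intro divide_nonpos_pos) linarith+
  then show ?thesis using that(2) False assms by (auto simp: cutoff_def cutoff'_def step'_eq_0 step_eq_1)
qed

lemma cutoff_C1:
  assumes "m \<ge> 2" "T > 0" "N > 0"
  shows "C1_punctured (cutoff m T N) (\<lambda>x. (cutoff' m T N x / norm x) *\<^sub>R sgn x)"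
proof -
  have d: "((\<lambda>s. step m ((c * s - T) / N)) has_real_derivative step' m ((c * s - T) / N) * (c / N)) (at s)" for c s
  proof -
    have "((\<lambda>s. (c * s - T) / N) has_real_derivative c / N) (at s)"
      using assms by (auto intro!: derivative_eq_intros)
    from DERIV_chain2[OF step_deriv[OF assms(1)] this] show ?thesis .
  qed
  have 1: "C1_punctured (\<lambda>x. step m ((ln (norm x) - T) / N))
      (\<lambda>x. (step' m ((ln (norm x) - T) / N) / N) *\<^sub>R ((1 / norm x) *\<^sub>R sgn x))"
    using assms
    by (intro C1_punctured_compose[OF C1_punctured_ln, of UNIV "\<lambda>s. step m ((s - T) / N)"]
        continuous_intros continuous_on_compose2[OF step'_continuous])
      (use d[of 1] in auto)
  have 2: "C1_punctured (\<lambda>x. step m ((- ln (norm x) - T) / N))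
      (\<lambda>x. (- step' m ((- ln (norm x) - T) / N) / N) *\<^sub>R ((1 / norm x) *\<^sub>R sgn x))"
    using assms
    by (intro C1_punctured_compose[OF C1_punctured_ln, of UNIV "\<lambda>s. step m ((- s - T) / N)"]
        continuous_intros continuous_on_compose2[OF step'_continuous])
      (use d[of "- 1"] in auto)
  show ?thesis
  proof (rule C1_punctured_cong[OF C1_punctured_mult[OF 1 2]])
    fix x :: 'a assume "x \<noteq> 0"
    then show "step m ((ln (norm x) - T) / N) * step m ((- ln (norm x) - T) / N) = cutoff m T N x"
      by (simp add: cutoff_def)
    show "step m ((ln (norm x) - T) / N) *\<^sub>R ((- step' m ((- ln (norm x) - T) / N) / N) *\<^sub>R ((1 / norm x) *\<^sub>R sgn x)) +
      step m ((- ln (norm x) - T) / N) *\<^sub>R ((step' m ((ln (norm x) - T) / N) / N) *\<^sub>R ((1 / norm x) *\<^sub>R sgn x))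
        = (cutoff' m T N x / norm x) *\<^sub>R sgn x"
      by (rule cutoff'_cases[OF assms(2,3) \<open>x \<noteq> 0\<close>, of m]) auto
  qed
qed

lemma cutoff_bounds: "0 \<le> cutoff m T N x" "cutoff m T N x \<le> 1"
  using step_bounds[of m] by (auto simp: cutoff_def intro!: mult_le_one)

lemma exp_bounds_norm: "x \<noteq> 0 \<Longrightarrow> x \<in> shell (exp a) (exp b) \<longleftrightarrow> a \<le> ln (norm x) \<and> ln (norm x) \<le> b"
  unfolding shell_def mem_Collect_eq
  by (metis exp_le_cancel_iff exp_ln zero_less_norm_iff)

lemma cutoff_eq_1:
  assumes "N > 0" "x \<in> shell (exp (- T)) (exp T)"
  shows "cutoff m T N x = 1"
proof -
  have x: "x \<noteq> 0" using assms(2) by (auto simp: shell_def)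
  then have "- T \<le> ln (norm x)" "ln (norm x) \<le> T" using assms(2) by (auto simp: exp_bounds_norm)
  then show ?thesis using assms x by (simp add: cutoff_def step_eq_1 field_simps)
qed

lemma cutoff_supp:
  assumes "N > 0" "m \<ge> 1" "cutoff m T N x \<noteq> 0"
  shows "x \<in> shell (exp (- (T + N))) (exp (T + N))"
proof -
  have x: "x \<noteq> 0" using assms by (auto simp: cutoff_def)
  then have "(ln (norm x) - T) / N < 1" "(- ln (norm x) - T) / N < 1"
    using assms step_eq_0[of m] by (auto simp: cutoff_def not_le[symmetric])
  then show ?thesis using x assms by (simp add: exp_bounds_norm field_simps)
qed

lemma cutoff'_supp:
  assumes "T > 0" "N > 0" "m \<ge> 2" "cutoff' m T N x \<noteq> 0"
  shows "x \<in> shell (exp T) (exp (T + N)) \<union> shell (exp (- (T + N))) (exp (- T))"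
proof -
  have x: "x \<noteq> 0" using assms by (auto simp: cutoff'_def)
  show ?thesis
  proof (rule cutoff'_cases[OF assms(1,2) x, of m])
    assume *: "cutoff' m T N x = step' m ((ln (norm x) - T) / N) / N"
    then have "0 < (ln (norm x) - T) / N" "(ln (norm x) - T) / N < 1"
      using assms(3,4) step'_eq_0 by (auto simp: not_le[symmetric])
    then have "x \<in> shell (exp T) (exp (T + N))" using x assms by (simp add: exp_bounds_norm field_simps)
    then show ?thesis by simp
  next
    assume *: "cutoff' m T N x = - step' m ((- ln (norm x) - T) / N) / N"
    then have "0 < (- ln (norm x) - T) / N" "(- ln (norm x) - T) / N < 1"
      using assms(3,4) step'_eq_0 by (auto simp: not_le[symmetric])
    then have "x \<in> shell (exp (- (T + N))) (exp (- T))" using x assms by (simp add: exp_bounds_norm field_simps)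
    then show ?thesis by simp
  qed
qed

lemma cutoff'_supp_shell:
  assumes "T > 0" "N > 0" "m \<ge> 2" "cutoff' m T N x \<noteq> 0"
  shows "x \<in> shell (exp (- (T + N))) (exp (T + N))"
proof -
  have "exp (- (T + N)) \<le> exp T" "exp (- T) \<le> exp (T + N)" using assms by auto
  moreover have "exp T \<le> norm x \<and> norm x \<le> exp (T + N) \<or> exp (- (T + N)) \<le> norm x \<and> norm x \<le> exp (- T)"
    using cutoff'_supp[OF assms] by (simp only: shell_def Un_iff mem_Collect_eq)
  ultimately show ?thesis unfolding shell_def mem_Collect_eq by linarith
qed

lemma cutoff'_continuous:
  assumes "T > 0" "N > 0"
  shows "continuous_on (- {0}) (cutoff' m T N)"
proof -
  have "continuous_on (- {0::'a}) (\<lambda>x. (step' m ((ln (norm x) - T) / N) - step' m ((- ln (norm x) - T) / N)) / N)"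
    using assms by (intro continuous_intros continuous_on_compose2[OF step'_continuous[of UNIV]]) auto
  then show ?thesis by (rule continuous_on_eq) (auto simp: cutoff'_def)
qed

lemma cutoff'_bound:
  assumes "T > 0" "N > 0" "m \<ge> 2" "real m \<ge> p" "p > 1"
  shows "\<bar>cutoff' m T N x\<bar> \<le> 2 * real m / N * cutoff m T N x powr ((p - 1) / p)"
proof (cases "x = 0")
  case False
  have *: "\<bar>step' m s\<bar> / N \<le> 2 * real m / N * step m s powr ((p - 1) / p)" for s
    using divide_right_mono[OF step'_bound[OF assms(3-5)], of N s] assms(2) by simp
  show ?thesis
    by (rule cutoff'_cases[OF assms(1,2) False, of m]) (use * assms in auto)
qed (use assms in \<open>simp add: cutoff'_def\<close>)

lemma cutoff'_le:
  assumes "T > 0" "N > 0" "m \<ge> 2"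
  shows "\<bar>cutoff' m T N x\<bar> \<le> 2 * real m / N"
proof -
  have "\<bar>cutoff' m T N x\<bar> \<le> 2 * real m / N * cutoff m T N x powr ((real m - 1) / real m)"
    using assms by (intro cutoff'_bound) auto
  also have "\<dots> \<le> 2 * real m / N * 1"
    using assms cutoff_bounds[of m T N x] by (intro mult_left_mono powr_le1) auto
  finally show ?thesis by simp
qed

lemma integrable_cutoff:
  assumes "T > 0" "N > 0" "m \<ge> 2" "continuous_on (- {0}) f"
  shows "integrable nu (\<lambda>x. cutoff m T N x * f x)" "integrable nu (\<lambda>x. cutoff' m T N x * f x)"
proof -
  show "integrable nu (\<lambda>x. cutoff m T N x * f x)"
    using assms cutoff_supp[of N m T]
    by (intro integrable_nu_shell[of _ "exp (- (T + N))" "exp (T + N)"] continuous_intros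
        C1_punctured_continuous[OF cutoff_C1]) auto
  show "integrable nu (\<lambda>x. cutoff' m T N x * f x)"
    using assms cutoff'_supp_shell[of T N m]
    by (intro integrable_nu_shell[of _ "exp (- (T + N))" "exp (T + N)"] continuous_intros
        cutoff'_continuous) auto
qed

text \<open>The rise at the inner collar and the fall at the outer one have equal mass.\<close>

lemma cutoff_integral_zero:
  assumes "m \<ge> 2" "0 < T" "0 < N"
  shows "integral\<^sup>L nu (cutoff' m T N :: 'a::euclidean_space \<Rightarrow> real) = 0"
proof -
  have "integral\<^sup>L nu (\<lambda>x::'a. x \<bullet> ((cutoff' m T N x / norm x) *\<^sub>R sgn x)) = 0"
    using cutoff_supp[of N m T] assms
    by (intro integral_nu_radial_derivative[OF cutoff_C1[OF assms], of "exp (- (T + N))" "exp (T + N)"]) auto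
  moreover have "x \<bullet> ((cutoff' m T N x / norm x) *\<^sub>R sgn x) = cutoff' m T N x" for x :: 'a
    by (cases "x = 0") (auto simp: cutoff'_def sgn_div_norm dot_square_norm power2_eq_square)
  ultimately show ?thesis by simp
qed

text \<open>With \<open>t = c powr (1 / p) * z\<close> this reads B t^(p-1) \<le> e t^p + const,
  split according to whether B \<le> e t. The constant is explicit in \<open>B\<close> because later
  \<open>B\<close> is of order \<open>1 / N\<close>, and the decay \<open>N powr (- p)\<close> is
  needed.\<close>

lemma powr_young:
  fixes B c e z p :: real
  assumes "0 \<le> B" "0 \<le> c" "0 \<le> z" "0 < e" "1 < p"
  shows "B * c powr ((p - 1) / p) * z powr (p - 1) \<le> e * (c * z powr p) + B powr p * e powr (1 - p)"
proof -
  define t where "t = c powr (1 / p) * z"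
  have t0: "0 \<le> t" using assms by (simp add: t_def)
  have t1: "t powr (p - 1) = c powr ((p - 1) / p) * z powr (p - 1)"
    using assms by (simp add: t_def powr_mult powr_powr)
  have t2: "t powr p = c * z powr p" using assms by (simp add: t_def powr_mult powr_powr)
  have ext: "0 \<le> s \<Longrightarrow> s powr p = s * s powr (p - 1)" for s :: real
    by (cases "s = 0") (auto simp: powr_diff)
  have "B * t powr (p - 1) \<le> e * t powr p + B powr p * e powr (1 - p)"
  proof (cases "B \<le> e * t")
    case True
    then have "B * t powr (p - 1) \<le> e * t * t powr (p - 1)" by (intro mult_right_mono) auto
    then show ?thesis using ext[OF t0] by (simp add: add_increasing2)
  next
    case False
    then have "t \<le> B / e" using assms by (simp add: field_simps)
    then have "t powr (p - 1) \<le> (B / e) powr (p - 1)" using t0 assms by (intro powr_mono2) auto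
    then have "B * t powr (p - 1) \<le> B * (B / e) powr (p - 1)" using assms by (intro mult_left_mono) auto
    also have "\<dots> = B powr p * e powr (1 - p)"
      using assms ext[of B] powr_minus_divide[of e "p - 1"] by (simp add: powr_divide)
    finally show ?thesis using assms by (simp add: add_increasing)
  qed
  then show ?thesis using t1 t2 by (simp add: mult.assoc)
qed

section \<open>The flux\<close>

definition flux :: "real \<Rightarrow> 'a::real_inner \<Rightarrow> 'a" where
  "flux p P = norm P powr (p - 2) *\<^sub>R P"

lemma powr_split: "0 \<le> s \<Longrightarrow> s * s powr (q - 1) = (s::real) powr q"
  by (cases "s = 0") (auto simp: powr_diff)

lemma norm_flux: "norm (flux p P) = norm P powr (p - 1)"
  using powr_split[of "norm P" "p - 1"] by (simp add: flux_def mult.commute)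

lemma flux_inner_self: "flux p P \<bullet> P = norm P powr p"
proof -
  have "flux p P \<bullet> P = norm P * (norm P * norm P powr (p - 2))"
    by (simp add: flux_def dot_square_norm power2_eq_square)
  also have "\<dots> = norm P powr p"
    using powr_split[of "norm P" "p - 1"] powr_split[of "norm P" p] by simp
  finally show ?thesis .
qed

lemma flux_inner_le: "flux p P \<bullet> R \<le> norm P powr (p - 1) * norm R"
  using norm_cauchy_schwarz[of "flux p P" R] by (simp add: norm_flux)

lemma flux_continuous:
  assumes "1 < p"
  shows "continuous_on S (flux p :: 'a::real_inner \<Rightarrow> 'a)"
proof (intro continuous_at_imp_continuous_on ballI)
  fix x :: 'a
  show "isCont (flux p) x"
  proof (cases "x = 0")
    case False
    then show ?thesis unfolding flux_def[abs_def] by (intro continuous_intros) auto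
  next
    case True
    have "((\<lambda>P::'a. norm P powr (p - 1)) \<longlongrightarrow> 0 powr (p - 1)) (at 0)"
      using assms by (intro tendsto_powr' tendsto_norm_zero tendsto_ident_at tendsto_const) auto
    then have "((\<lambda>P::'a. norm (flux p P)) \<longlongrightarrow> 0) (at 0)" by (simp add: norm_flux)
    then have "(flux p \<longlongrightarrow> (0::'a)) (at 0)" by (simp add: tendsto_norm_zero_iff)
    then show ?thesis using True by (simp add: isCont_def flux_def)
  qed
qed

lemma flux_scaleR: "0 < c \<Longrightarrow> flux p (c *\<^sub>R P) = c powr (p - 1) *\<^sub>R flux p P"
  using powr_split[of c "p - 1"] by (simp add: flux_def powr_mult mult.commute mult.left_commute)

section \<open>Bregman distances and the monotonicity gap\<close>

definition bregman :: "real \<Rightarrow> 'a::real_inner \<Rightarrow> 'a \<Rightarrow> real" where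
  "bregman p P R = norm P powr p - norm R powr p - p * (flux p R \<bullet> (P - R))"

definition mono_gap :: "real \<Rightarrow> 'a::real_inner \<Rightarrow> 'a \<Rightarrow> real" where
  "mono_gap p P R = (flux p P - flux p R) \<bullet> (P - R)"

lemma young_powr: 
  fixes r s p :: real
  assumes "0 \<le> r" "0 \<le> s" "1 < p"
  shows "p * (r powr (p - 1) * s) \<le> s powr p + (p - 1) * r powr p"
proof -
  have "s * r powr (p - 1) \<le> s powr p / p + (r powr (p - 1)) powr (p / (p - 1)) / (p / (p - 1))"
    using assms by (intro Youngs_inequality) (auto simp: field_simps)
  then have "s * r powr (p - 1) \<le> (1 / p) * s powr p + ((p - 1) / p) * r powr p"
    using assms by (simp add: powr_powr mult.commute)
  then have "p * (s * r powr (p - 1)) \<le> p * ((1 / p) * s powr p + ((p - 1) / p) * r powr p)"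
    using assms by (intro mult_left_mono) auto
  moreover have "p * ((1 / p) * s powr p + ((p - 1) / p) * r powr p) = s powr p + (p - 1) * r powr p"
    using assms by (simp add: distrib_left)
  ultimately show ?thesis by (simp add: mult.commute)
qed

text \<open>This is convexity of \<open>|.|^p\<close>, whose gradient is \<open>p\<close> times the
  flux; Cauchy-Schwarz reduces it to Young's inequality for the two norms.\<close>

lemma bregman_nonneg:
  assumes "1 < p"
  shows "0 \<le> bregman p P R"
proof -
  have "p * (flux p R \<bullet> P) \<le> p * (norm R powr (p - 1) * norm P)"
    using assms flux_inner_le[of p R P] by (intro mult_left_mono) auto
  also have "\<dots> \<le> norm P powr p + (p - 1) * norm R powr p"
    using assms by (intro young_powr) auto
  finally show ?thesis by (simp add: bregman_def inner_diff_right flux_inner_self algebra_simps)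
qed

text \<open>Both distances being nonnegative, each one is controlled by the gap.\<close>

lemma bregman_add: "bregman p P R + bregman p R P = p * mono_gap p P R"
  by (simp add: bregman_def mono_gap_def inner_diff_left inner_diff_right algebra_simps)

lemma mono_gap_nonneg: "1 < p \<Longrightarrow> 0 \<le> mono_gap p P R"
  using bregman_add[of p P R] bregman_nonneg[of p P R] bregman_nonneg[of p R P]
  by (metis add_nonneg_nonneg le_less less_trans zero_less_one mult_neg_pos not_le mult.commute)

lemma mono_gap_norm_ge:
  "(norm P powr (p - 1) - norm R powr (p - 1)) * (norm P - norm R) \<le> mono_gap p P R"
proof -
  have "mono_gap p P R = norm P powr p + norm R powr p - flux p P \<bullet> R - flux p R \<bullet> P"
    by (simp add: mono_gap_def inner_diff_left inner_diff_right flux_inner_self)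
  then show ?thesis
    using flux_inner_le[of p P R] flux_inner_le[of p R P] powr_split[of "norm P" p] powr_split[of "norm R" p]
    by (simp add: algebra_simps)
qed

text \<open>\<open>mono_gap_norm_ge\<close> first forces equal norms; then both fluxes carry the
  same scalar factor, and the gap is that factor times \<open>|P - R|^2\<close>.\<close>

lemma mono_gap_eq_0D:
  assumes "1 < p" "mono_gap p P R = 0"
  shows "P = R"
proof -
  have eq: "norm P = norm R"
  proof (rule ccontr)
    assume "norm P \<noteq> norm R"
    then consider "norm P < norm R" | "norm R < norm P" by linarith
    then have "0 < (norm P powr (p - 1) - norm R powr (p - 1)) * (norm P - norm R)"
    proof cases
      case 1
      then have "norm P powr (p - 1) < norm R powr (p - 1)" using assms(1) by (intro powr_less_mono2) auto
      with 1 show ?thesis by (intro mult_neg_neg) auto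
    next
      case 2
      then have "norm R powr (p - 1) < norm P powr (p - 1)" using assms(1) by (intro powr_less_mono2) auto
      with 2 show ?thesis by (intro mult_pos_pos) auto
    qed
    with mono_gap_norm_ge[of P p R] assms(2) show False by simp
  qed
  have "mono_gap p P R = norm R powr (p - 2) * ((P - R) \<bullet> (P - R))"
    by (simp add: mono_gap_def flux_def eq scaleR_diff_right[symmetric])
  then have "R = 0 \<or> P = R" using assms(2) by auto
  then show ?thesis using eq by auto
qed

lemma mono_gap_growth:
  assumes "1 < p" "0 \<le> g"
  obtains K where "K \<ge> 0" "\<And>P R::'a::real_inner. norm R = g \<Longrightarrow> norm P powr p \<le> 2 * mono_gap p P R + K"
proof -
  \<comment> \<open>Once \<open>|P| > k g\<close>, each of the cross terms
    \<open>|P|^(p-1) g\<close> and \<open>g^(p-1) |P|\<close> is at most a quarter of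
    \<open>|P|^p\<close>.\<close>
  define k where "k = max 4 (4 powr (1 / (p - 1)))"
  have k: "k \<ge> 4" "k powr (p - 1) \<ge> 4"
  proof -
    have "4 = (4 powr (1 / (p - 1))) powr (p - 1)" using assms by (simp add: powr_powr)
    also have "\<dots> \<le> k powr (p - 1)" using assms by (intro powr_mono2) (auto simp: k_def)
    finally show "k powr (p - 1) \<ge> 4" .
  qed (simp add: k_def)
  show ?thesis
  proof (rule that[of "(k * g) powr p"])
    fix P R :: 'a assume R: "norm R = g"
    show "norm P powr p \<le> 2 * mono_gap p P R + (k * g) powr p"
    proof (cases "norm P \<le> k * g")
      case True
      then have "norm P powr p \<le> (k * g) powr p" using assms by (intro powr_mono2) auto
      then show ?thesis using mono_gap_nonneg[OF assms(1), of P R] by simp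
    next
      case False
      have "4 * g \<le> k * g" using k assms by (intro mult_right_mono) auto
      then have "norm P powr (p - 1) * (4 * g) \<le> norm P powr (p - 1) * norm P"
        using False by (intro mult_left_mono) auto
      then have 1: "4 * (norm P powr (p - 1) * g) \<le> norm P powr p"
        using powr_split[of "norm P" p] by (simp add: algebra_simps)
      have "4 * g powr (p - 1) \<le> k powr (p - 1) * g powr (p - 1)" using k by (intro mult_right_mono) auto
      also have "\<dots> = (k * g) powr (p - 1)" using k assms by (simp add: powr_mult)
      also have "\<dots> \<le> norm P powr (p - 1)" using False assms k by (intro powr_mono2) auto
      finally have "4 * g powr (p - 1) * norm P \<le> norm P powr (p - 1) * norm P"
        by (intro mult_right_mono) auto
      then have 2: "4 * (g powr (p - 1) * norm P) \<le> norm P powr p"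
        using powr_split[of "norm P" p] by (simp add: algebra_simps)
      have "norm P powr p + g powr p - norm P powr (p - 1) * g - g powr (p - 1) * norm P \<le> mono_gap p P R"
        using mono_gap_norm_ge[of P p R] R powr_split[of "norm P" p] powr_split[of g p] assms
        by (simp add: algebra_simps)
      moreover have "0 \<le> g powr p" "0 \<le> (k * g) powr p" by auto
      ultimately show ?thesis using 1 2 by linarith
    qed
  qed auto
qed

text \<open>The component of the flux along \<open>Q\<close> increases along the ray from
  \<open>R\<close> in direction \<open>Q\<close>.\<close>

lemma mono_gap_scale:
  assumes "1 < p" "0 < s" "s \<le> 1"
  shows "mono_gap p (R + s *\<^sub>R Q) R \<le> s * mono_gap p (R + Q) R"
proof (cases "s = 1")
  case False
  have "0 \<le> mono_gap p (R + Q) (R + s *\<^sub>R Q)" by (rule mono_gap_nonneg[OF assms(1)])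
  also have "\<dots> = (1 - s) * ((flux p (R + Q) - flux p (R + s *\<^sub>R Q)) \<bullet> Q)"
    by (simp add: mono_gap_def inner_diff_right algebra_simps)
  finally have "0 \<le> (flux p (R + Q) - flux p (R + s *\<^sub>R Q)) \<bullet> Q"
    using assms False by (simp add: zero_le_mult_iff)
  then have "(flux p (R + s *\<^sub>R Q) - flux p R) \<bullet> Q \<le> (flux p (R + Q) - flux p R) \<bullet> Q"
    by (simp add: inner_diff_left)
  then show ?thesis using assms by (simp add: mono_gap_def)
qed simp

text \<open>The gap vanishes to order higher than one at \<open>Q = 0\<close>, so a bound linear in
  it costs the additive \<open>d\<close>. On \<open>|Q| = d\<close> compactness of the two spheres
  gives a positive minimum, uniform in \<open>R\<close>, and \<open>mono_gap_scale\<close> carries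
  it over to \<open>|Q| > d\<close>.\<close>

lemma norm_le_mono_gap:
  fixes p g d :: real
  assumes "1 < p" "0 < d"
  obtains C where "C \<ge> 0" "\<And>R Q::'a::euclidean_space. norm R = g \<Longrightarrow> norm Q \<le> d + C * mono_gap p (R + Q) R"
proof -
  let ?K = "sphere (0::'a) g \<times> sphere (0::'a) d"
  have main: "\<exists>C\<ge>0. \<forall>R Q::'a. norm R = g \<longrightarrow> norm Q \<le> d + C * mono_gap p (R + Q) R"
  proof (cases "?K = {}")
    case True
    obtain b :: 'a where b: "b \<in> Basis" using nonempty_Basis by blast
    have "norm (d *\<^sub>R b) = d" using assms b by (simp add: norm_Basis)
    then have "d *\<^sub>R b \<in> sphere 0 d" by simp
    then have "\<forall>R::'a. norm R \<noteq> g" using True by (metis SigmaI empty_iff mem_sphere_0)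
    then show ?thesis by (intro exI[of _ 0]) auto
  next
    case False
    have cont: "continuous_on ?K (\<lambda>(R, Q). mono_gap p (R + Q) R)"
      unfolding mono_gap_def split_beta
      by (intro continuous_intros continuous_on_compose2[OF flux_continuous[OF assms(1), of UNIV]]) auto
    have "compact ?K" by (intro compact_Times compact_sphere)
    from continuous_attains_inf[OF this False cont]
    obtain z where z: "z \<in> ?K"
      "\<forall>y\<in>?K. (case z of (R, Q) \<Rightarrow> mono_gap p (R + Q) R) \<le> (case y of (R, Q) \<Rightarrow> mono_gap p (R + Q) R)"
      by blast
    define R0 Q0 where "R0 = fst z" and "Q0 = snd z"
    have 0: "norm R0 = g" "norm Q0 = d" using z(1) by (auto simp: R0_def Q0_def)
    have min: "mono_gap p (R0 + Q0) R0 \<le> mono_gap p (R + Q) R" if "norm R = g" "norm Q = d" for R Q :: 'a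
      using bspec[OF z(2), of "(R, Q)"] that by (auto simp: R0_def Q0_def split_beta)
    define \<mu> where "\<mu> = mono_gap p (R0 + Q0) R0"
    have "\<mu> \<noteq> 0" using mono_gap_eq_0D[OF assms(1), of "R0 + Q0" R0] 0 assms by (auto simp: \<mu>_def)
    then have \<mu>: "\<mu> > 0" using mono_gap_nonneg[OF assms(1), of "R0 + Q0" R0] by (simp add: \<mu>_def)
    have "norm Q \<le> d + (d / \<mu>) * mono_gap p (R + Q) R" if R: "norm R = g" for R Q :: 'a
    proof (cases "norm Q \<le> d")
      case True
      then show ?thesis using \<mu> assms mono_gap_nonneg[OF assms(1), of "R + Q" R] by (simp add: add_increasing2)
    next
      case False
      have Q: "0 < norm Q" using False assms by linarith
      have "\<mu> \<le> mono_gap p (R + (d / norm Q) *\<^sub>R Q) R"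
        unfolding \<mu>_def using Q assms R by (intro min) auto
      also have "\<dots> \<le> (d / norm Q) * mono_gap p (R + Q) R"
        using False assms Q by (intro mono_gap_scale) (auto simp: field_simps)
      finally have "norm Q \<le> (d / \<mu>) * mono_gap p (R + Q) R"
        using \<mu> Q by (simp add: field_simps)
      then show ?thesis using assms by simp
    qed
    then show ?thesis using \<mu> assms by (intro exI[of _ "d / \<mu>"]) auto
  qed
  then show ?thesis using that by blast
qed

text \<open>Pairing with \<open>R\<close> instead of \<open>e\<close>, Euler's relation
  \<open>flux p P \<bullet> P = |P|^p\<close> expresses the error of the linearization exactly
  through the two Bregman distances. No second derivatives occur, so the degenerate range p > 2 and
  the singular range p < 2 are treated alike.\<close>

lemma flux_inner_direction:
  fixes P e :: "'a::real_inner"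
  assumes "norm e = 1" "\<gamma> \<noteq> 0" "p \<noteq> 0"
  defines "R \<equiv> - \<gamma> *\<^sub>R e"
  shows "(flux p P - flux p R) \<bullet> e = (p - 1) * \<bar>\<gamma>\<bar> powr (p - 2) * ((P - R) \<bullet> e)
      - ((p - 1) * bregman p P R - bregman p R P) / (p * \<gamma>)"
proof -
  have n: "norm R = \<bar>\<gamma>\<bar>" using assms by simp
  have fR: "flux p R = \<bar>\<gamma>\<bar> powr (p - 2) *\<^sub>R R" by (simp add: flux_def n)
  have 1: "p * ((flux p P - flux p R) \<bullet> R)
      = ((p - 1) * bregman p P R - bregman p R P) + p * (p - 1) * (flux p R \<bullet> (P - R))"
    by (simp add: bregman_def inner_diff_left inner_diff_right flux_inner_self algebra_simps)
  have e: "\<gamma> * (V \<bullet> e) = - (V \<bullet> R)" for V by (simp add: R_def)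
  have "p * \<gamma> * ((flux p P - flux p R) \<bullet> e) = - (p * ((flux p P - flux p R) \<bullet> R))"
    unfolding mult.assoc e by simp
  also have "\<dots> = - ((p - 1) * bregman p P R - bregman p R P)
      + p * (p - 1) * (\<bar>\<gamma>\<bar> powr (p - 2) * \<gamma> * ((P - R) \<bullet> e))"
    unfolding 1 unfolding fR by (simp add: R_def inner_commute)
  finally show ?thesis using assms(2,3) by (simp add: field_simps)
qed

lemma flux_inner_direction_le:
  fixes P e :: "'a::real_inner"
  assumes "norm e = 1" "\<gamma> \<noteq> 0" "1 < p"
  defines "R \<equiv> - \<gamma> *\<^sub>R e"
  shows "\<bar>(flux p P - flux p R) \<bullet> e - (p - 1) * \<bar>\<gamma>\<bar> powr (p - 2) * ((P - R) \<bullet> e)\<bar> \<le> p / \<bar>\<gamma>\<bar> * mono_gap p P R"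
proof -
  let ?X = "bregman p P R" and ?Y = "bregman p R P"
  have nn: "0 \<le> ?X" "0 \<le> ?Y" using bregman_nonneg[OF assms(3)] by auto
  have "\<bar>(p - 1) * ?X - ?Y\<bar> \<le> p * (?X + ?Y)"
  proof -
    have "0 \<le> p * ?X" "0 \<le> p * ?Y" "?Y \<le> p * ?Y" "0 \<le> (p - 1) * ?X"
      using nn assms mult_right_mono[of 1 p ?Y] by auto
    then show ?thesis using nn by (simp add: abs_le_iff algebra_simps)
  qed
  then have "\<bar>(p - 1) * ?X - ?Y\<bar> / \<bar>p * \<gamma>\<bar> \<le> p * (p * mono_gap p P R) / \<bar>p * \<gamma>\<bar>"
    unfolding bregman_add by (rule divide_right_mono) simp
  also have "\<dots> = p / \<bar>\<gamma>\<bar> * mono_gap p P R" using assms by (simp add: abs_mult)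
  finally show ?thesis
    using flux_inner_direction[OF assms(1,2), of p P, folded R_def] assms(3)
    by (simp add: R_def[symmetric] abs_divide)
qed

text \<open>The lower order term of the equation for \<open>ln u\<close>, minus its linearization at \<open>P = R\<close>.\<close>

lemma drift_remainder_le:
  fixes P e :: "'a::real_inner"
  assumes "norm e = 1" "\<gamma> \<noteq> 0" "1 < p"
  defines "R \<equiv> - \<gamma> *\<^sub>R e"
  shows "\<bar>(p - 1) * (norm P powr p - \<bar>\<gamma>\<bar> powr p) + \<kappa> * ((flux p P - flux p R) \<bullet> e)
      - (p - 1) * \<bar>\<gamma>\<bar> powr (p - 2) * (\<kappa> - p * \<gamma>) * ((P - R) \<bullet> e)\<bar>
    \<le> (p * (p - 1) + \<bar>\<kappa>\<bar> * p / \<bar>\<gamma>\<bar>) * mono_gap p P R"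
proof -
  let ?X = "bregman p P R"
  let ?D = "(flux p P - flux p R) \<bullet> e - (p - 1) * \<bar>\<gamma>\<bar> powr (p - 2) * ((P - R) \<bullet> e)"
  have n: "norm R = \<bar>\<gamma>\<bar>" using assms by simp
  have "norm P powr p - \<bar>\<gamma>\<bar> powr p = ?X + p * (flux p R \<bullet> (P - R))"
    by (simp add: bregman_def n)
  also have "flux p R \<bullet> (P - R) = - (\<bar>\<gamma>\<bar> powr (p - 2) * \<gamma> * ((P - R) \<bullet> e))"
    unfolding flux_def n by (simp add: R_def inner_commute)
  finally have E: "norm P powr p - \<bar>\<gamma>\<bar> powr p = ?X + p * - (\<bar>\<gamma>\<bar> powr (p - 2) * \<gamma> * ((P - R) \<bullet> e))" .
  have eq: "(p - 1) * (norm P powr p - \<bar>\<gamma>\<bar> powr p) + \<kappa> * ((flux p P - flux p R) \<bullet> e)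
      - (p - 1) * \<bar>\<gamma>\<bar> powr (p - 2) * (\<kappa> - p * \<gamma>) * ((P - R) \<bullet> e) = (p - 1) * ?X + \<kappa> * ?D"
    unfolding E by (simp add: algebra_simps)
  have 1: "\<bar>(p - 1) * ?X\<bar> \<le> (p - 1) * (p * mono_gap p P R)"
    using bregman_add[of p P R] bregman_nonneg[OF assms(3), of P R] bregman_nonneg[OF assms(3), of R P] assms(3)
    by (simp add: abs_mult)
  have 2: "\<bar>\<kappa> * ?D\<bar> \<le> \<bar>\<kappa>\<bar> * (p / \<bar>\<gamma>\<bar> * mono_gap p P R)"
    unfolding abs_mult R_def using flux_inner_direction_le[OF assms(1-3), of P] by (intro mult_left_mono) auto
  have "(p - 1) * (p * mono_gap p P R) + \<bar>\<kappa>\<bar> * (p / \<bar>\<gamma>\<bar> * mono_gap p P R)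
      = (p * (p - 1) + \<bar>\<kappa>\<bar> * p / \<bar>\<gamma>\<bar>) * mono_gap p P R" by (simp add: algebra_simps)
  then show ?thesis unfolding eq using 1 2 abs_triangle_ineq[of "(p - 1) * ?X" "\<kappa> * ?D"] by linarith
qed

section \<open>The equation for the logarithm of the solution\<close>

locale positive_solution =
  fixes u :: "'a::euclidean_space \<Rightarrow> real" and p a \<mu> \<gamma> c1 c2 :: real
  assumes p: "1 < p"
    and root: "\<bar>\<gamma>\<bar> powr (p - 2) * \<gamma> * (real DIM('a) - (a + 1) * p - (p - 1) * \<gamma>) = \<mu>"
    and u_C1: "C1_punctured u (gradient u)"
    and weak: "weak_solution p a \<mu> (UNIV - {0}) u"
    and c1: "0 < c1"
    and bounds: "\<And>x. x \<noteq> 0 \<Longrightarrow> c1 * norm x powr (- \<gamma>) \<le> u x \<and> u x \<le> c2 * norm x powr (- \<gamma>)"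
begin

text \<open>Coefficient of the first order term once the equation is written with \<open>nu\<close>;
  see the exponent of the weight in \<open>riccati\<close>.\<close>

definition \<kappa> where "\<kappa> = real DIM('a) - (a + 1) * p"

lemma u_pos: "x \<noteq> 0 \<Longrightarrow> 0 < u x"
  using bounds[of x] c1 by (auto intro!: less_le_trans[of 0 "c1 * norm x powr (- \<gamma>)" "u x"] mult_pos_pos)

lemma u_cont: "continuous_on (- {0}) u"
  by (rule C1_punctured_continuous[OF u_C1])

lemma gu_cont: "continuous_on (- {0}) (gradient u)"
  by (rule C1_punctured_continuous_gradient[OF u_C1])

lemma flux_gu_cont: "continuous_on (- {0}) (\<lambda>x. flux p (gradient u x))"
  by (rule continuous_on_compose2[OF flux_continuous[OF p, of UNIV] gu_cont]) auto

text \<open>Passage from smooth to \<open>C^1\<close> test functions: the approximations of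
  \<open>C1_approx_test_function\<close> change both integrands by at most \<open>e\<close> times a
  fixed integrable function.\<close>

lemma weak_C1:
  assumes \<psi>: "C1_punctured \<psi> G" and c: "0 < c" and supp: "\<And>x. \<psi> x \<noteq> 0 \<Longrightarrow> x \<in> shell c d"
  shows "(LINT x|lborel. norm x powr (- a * p) * (flux p (gradient u x) \<bullet> G x)
      - \<mu> / norm x powr ((a + 1) * p) * u x powr (p - 1) * \<psi> x) = 0"
proof -
  define F where "F x = norm x powr (- a * p) *\<^sub>R flux p (gradient u x)" for x
  define g where "g x = \<mu> / norm x powr ((a + 1) * p) * u x powr (p - 1)" for x
  have Fc: "continuous_on (- {0}) F"
    unfolding F_def by (intro continuous_intros flux_gu_cont) auto
  have gc: "continuous_on (- {0}) g"
    unfolding g_def using u_pos by (intro continuous_intros u_cont) (auto simp: less_imp_neq[symmetric])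
  have F0: "F 0 = 0" by (simp add: F_def)
  define G0 where "G0 = (\<lambda>x. if x = 0 then 0 else G x)"
  have ext: "\<And>x. GDERIV \<psi> x :> G0 x" "continuous_on UNIV G0"
    unfolding G0_def using C1_punctured_extend[OF \<psi> c supp] by auto
  \<comment> \<open>Contains the supports of all approximations, whatever their accuracy, so that
    \<open>B\<close> below does not depend on \<open>e\<close>.\<close>
  let ?S = "shell (c / 2) (d + 1) :: 'a set"
  define B where "B = (LINT x|lborel. indicator ?S x * (norm (F x) + \<bar>g x\<bar>))"
  have Bi: "integrable lborel (\<lambda>x. indicator ?S x * (norm (F x) + \<bar>g x\<bar>))"
  proof -
    have "integrable lborel (\<lambda>x. indicator ?S x *\<^sub>R (norm (F x) + \<bar>g x\<bar>))"
      using shell_subset[of "c / 2" "d + 1"] c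
      by (intro borel_integrable_compact compact_shell continuous_intros continuous_on_subset[OF Fc]
        continuous_on_subset[OF gc]) auto
    then show ?thesis by simp
  qed
  have int: "integrable lborel (\<lambda>x. F x \<bullet> D x)" "integrable lborel (\<lambda>x. g x * f x)"
    if f: "C1_punctured f D" "\<And>x. f x \<noteq> 0 \<Longrightarrow> x \<in> ?S" for f D
  proof -
    show "integrable lborel (\<lambda>x. F x \<bullet> D x)"
    proof (rule integrable_lborel_shell[of _ "c / 2" "d + 1"])
      fix x assume "F x \<bullet> D x \<noteq> 0"
      then have "x \<noteq> 0" "D x \<noteq> 0" using F0 by auto
      then show "x \<in> ?S" using gradient_zero_outside_shell[OF f] by blast
    qed (use c in \<open>auto intro!: continuous_intros Fc C1_punctured_continuous_gradient[OF f(1)]\<close>)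
    show "integrable lborel (\<lambda>x. g x * f x)"
      using c f(2) by (intro integrable_lborel_shell[of _ "c / 2" "d + 1"] continuous_intros gc
          C1_punctured_continuous[OF f(1)]) auto
  qed
  have supp': "x \<in> ?S" if "\<psi> x \<noteq> 0" for x using supp[OF that] c by (auto simp: shell_def)
  have \<psi>0: "C1_punctured \<psi> G0" using ext by (auto simp: C1_punctured_def intro: continuous_on_subset)
  have "\<bar>LINT x|lborel. F x \<bullet> G0 x - g x * \<psi> x\<bar> \<le> e * B" if "e > 0" for e
  proof -
    obtain f where f: "test_function (UNIV - {0}) f"
      and fs: "\<And>x. f x \<noteq> 0 \<Longrightarrow> c / 2 \<le> norm x \<and> norm x \<le> d + 1"
      and fe: "\<And>x. \<bar>f x - \<psi> x\<bar> \<le> e" "\<And>x. norm (gradient f x - G0 x) \<le> e"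
      using C1_approx_test_function[OF ext(1,2), of c d e] supp c \<open>e > 0\<close> by (auto simp: shell_def)
    have fC: "C1_punctured f (gradient f)"
      using C_k_gderiv[of 0 f] f unfolding test_function_def C1_punctured_def
      by (auto intro: continuous_on_subset)
    have fs': "x \<in> ?S" if "f x \<noteq> 0" for x using fs[OF that] by (simp add: shell_def)
    have e1: "(LINT x:UNIV - {0}|lborel. norm x powr (- a * p) *
            ((norm (gradient u x) powr (p - 2) *\<^sub>R gradient u x) \<bullet> gradient f x))
        = (LINT x|lborel. F x \<bullet> gradient f x)"
      unfolding set_lebesgue_integral_def F_def flux_def
      by (intro Bochner_Integration.integral_cong) (auto simp: indicator_def)
    have e2: "(LINT x:UNIV - {0}|lborel. \<mu> / norm x powr ((a + 1) * p) * u x powr (p - 1) * f x)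
        = (LINT x|lborel. g x * f x)"
      unfolding set_lebesgue_integral_def g_def
      by (intro Bochner_Integration.integral_cong) (auto simp: indicator_def)
    have w: "(LINT x|lborel. F x \<bullet> gradient f x) - (LINT x|lborel. g x * f x) = 0"
      using weak f unfolding weak_solution_def e1[symmetric] e2[symmetric] by blast
    have "(LINT x|lborel. F x \<bullet> G0 x - g x * \<psi> x)
      = (LINT x|lborel. F x \<bullet> (G0 x - gradient f x) - g x * (\<psi> x - f x))"
      using w int[OF \<psi>0 supp'] int[OF fC fs'] by (simp add: inner_diff_right right_diff_distrib)
    also have "\<bar>\<dots>\<bar> \<le> (LINT x|lborel. e * (indicator ?S x * (norm (F x) + \<bar>g x\<bar>)))"
    proof (rule integral_abs_bound[THEN order_trans], rule integral_mono)
      show "integrable lborel (\<lambda>x. \<bar>F x \<bullet> (G0 x - gradient f x) - g x * (\<psi> x - f x)\<bar>)"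
        using int[OF \<psi>0 supp'] int[OF fC fs'] by (simp add: inner_diff_right right_diff_distrib)
      show "integrable lborel (\<lambda>x. e * (indicator ?S x * (norm (F x) + \<bar>g x\<bar>)))" using Bi by simp
      show "\<bar>F x \<bullet> (G0 x - gradient f x) - g x * (\<psi> x - f x)\<bar> \<le> e * (indicator ?S x * (norm (F x) + \<bar>g x\<bar>))" for x
      proof (cases "x \<in> ?S")
        case True
        have "\<bar>F x \<bullet> (G0 x - gradient f x)\<bar> \<le> norm (F x) * e"
          using Cauchy_Schwarz_ineq2[of "F x" "G0 x - gradient f x"] fe(2)[of x]
            mult_left_mono[of "norm (G0 x - gradient f x)" e "norm (F x)"]
          by (simp add: norm_minus_commute)
        moreover have "\<bar>g x * (\<psi> x - f x)\<bar> \<le> \<bar>g x\<bar> * e"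
          using fe(1)[of x] unfolding abs_mult by (intro mult_left_mono) (auto simp: abs_minus_commute)
        moreover have "e * (indicator ?S x * (norm (F x) + \<bar>g x\<bar>)) = norm (F x) * e + \<bar>g x\<bar> * e"
          using True by (simp add: algebra_simps)
        ultimately show ?thesis
          using abs_triangle_ineq4[of "F x \<bullet> (G0 x - gradient f x)" "g x * (\<psi> x - f x)"] by linarith
      next
        case False
        then have "\<psi> x = 0" "f x = 0" using supp' fs' by auto
        moreover have "G0 x = 0" "gradient f x = 0" if "x \<noteq> 0"
          using gradient_zero_outside_shell[OF \<psi>0 supp' that False]
            gradient_zero_outside_shell[OF fC fs' that False] by auto
        ultimately show ?thesis using F0 False by (cases "x = 0") auto
      qed
    qed
    finally show ?thesis by (simp add: B_def)
  qed
  then have "(LINT x|lborel. F x \<bullet> G0 x - g x * \<psi> x) = 0"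
  proof -
    assume *: "\<And>e. e > 0 \<Longrightarrow> \<bar>LINT x|lborel. F x \<bullet> G0 x - g x * \<psi> x\<bar> \<le> e * B"
    have "\<bar>LINT x|lborel. F x \<bullet> G0 x - g x * \<psi> x\<bar> \<le> 0"
    proof (rule field_le_epsilon)
      fix e :: real assume "0 < e"
      have "\<bar>LINT x|lborel. F x \<bullet> G0 x - g x * \<psi> x\<bar> \<le> e / (\<bar>B\<bar> + 1) * B"
        using \<open>0 < e\<close> by (intro *) (auto intro!: divide_pos_pos)
      also have "\<dots> \<le> e" using \<open>0 < e\<close> by (simp add: field_simps mult_left_mono abs_if)
      finally show "\<bar>LINT x|lborel. F x \<bullet> G0 x - g x * \<psi> x\<bar> \<le> 0 + e" by simp
    qed
    then show ?thesis by simp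
  qed
  moreover have "F x \<bullet> G0 x = norm x powr (- a * p) * (flux p (gradient u x) \<bullet> G x)" for x
    by (simp add: F_def G0_def)
  ultimately show ?thesis by (simp add: g_def)
qed

text \<open>\<open>|x|\<close> times the gradient of \<open>ln u\<close>; \<open>R\<close> is the
  same expression for the pure power \<open>|x|^(-\<gamma>)\<close>.\<close>

definition P :: "'a \<Rightarrow> 'a" where "P x = (norm x / u x) *\<^sub>R gradient u x"

definition R :: "'a \<Rightarrow> 'a" where "R x = - \<gamma> *\<^sub>R sgn x"

lemma P_cont: "continuous_on (- {0}) P"
  unfolding P_def using u_pos by (intro continuous_intros u_cont gu_cont) (auto simp: less_imp_neq[symmetric])

lemma R_cont: "continuous_on (- {0}) R"
  unfolding R_def by (intro continuous_intros continuous_on_sgn_punctured)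

lemma flux_P_cont: "continuous_on (- {0}) (\<lambda>x. flux p (P x))"
  by (rule continuous_on_compose2[OF flux_continuous[OF p, of UNIV] P_cont]) auto

lemma flux_R_cont: "continuous_on (- {0}) (\<lambda>x. flux p (R x))"
  by (rule continuous_on_compose2[OF flux_continuous[OF p, of UNIV] R_cont]) auto

text \<open>Tested with \<open>\<psi> * W\<close>. The factor \<open>u powr (1 - p)\<close> removes
  the homogeneity in \<open>u\<close> and produces the term \<open>(p - 1) |P|^p\<close>; the factor
  \<open>norm x powr (- \<kappa>)\<close> is the one for which all powers of \<open>|x|\<close>
  collapse to the density of \<open>nu\<close>, and it produces the term with \<kappa>.\<close>

lemma riccati:
  assumes \<psi>: "C1_punctured \<psi> G" and c: "0 < c" and supp: "\<And>x. \<psi> x \<noteq> 0 \<Longrightarrow> x \<in> shell c d"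
  shows "(LINT x|nu. flux p (P x) \<bullet> (norm x *\<^sub>R G x)
    - \<psi> x * ((p - 1) * norm (P x) powr p + \<kappa> * (flux p (P x) \<bullet> sgn x) + \<mu>)) = 0"
    (is "integral\<^sup>L nu ?f = 0")
proof -
  define W where "W x = u x powr (1 - p) * norm x powr (- \<kappa>)" for x
  have "C1_punctured (\<lambda>x. u x powr (1 - p)) (\<lambda>x. ((1 - p) * u x powr (1 - p - 1)) *\<^sub>R gradient u x)"
    using u_pos by (intro C1_punctured_compose[OF u_C1, of "{0<..}"])
      (auto intro!: derivative_eq_intros continuous_intros)
  from C1_punctured_mult[OF this C1_punctured_powr[of "- \<kappa>"]]
  have W: "C1_punctured W (\<lambda>x. (W x / norm x) *\<^sub>R ((1 - p) *\<^sub>R P x - \<kappa> *\<^sub>R sgn x))"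
  proof (rule C1_punctured_cong)
    fix x :: 'a assume x: "x \<noteq> 0"
    have 1: "u x powr (1 - p - 1) = u x powr (1 - p) / u x" using u_pos[OF x] by (simp add: powr_diff powr_minus_divide)
    have 2: "norm x powr (- \<kappa> - 1) = norm x powr (- \<kappa>) / norm x" using x by (simp add: powr_diff)
    show "u x powr (1 - p) *\<^sub>R (- \<kappa> * norm x powr (- \<kappa> - 1)) *\<^sub>R sgn x +
        norm x powr (- \<kappa>) *\<^sub>R ((1 - p) * u x powr (1 - p - 1)) *\<^sub>R gradient u x
        = (W x / norm x) *\<^sub>R ((1 - p) *\<^sub>R P x - \<kappa> *\<^sub>R sgn x)"
      unfolding 1 2 using x u_pos[OF x] by (simp add: W_def P_def scaleR_diff_right mult_ac)
  qed (simp add: W_def)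
  have "C1_punctured (\<lambda>x. \<psi> x * W x) (\<lambda>x. \<psi> x *\<^sub>R ((W x / norm x) *\<^sub>R ((1 - p) *\<^sub>R P x - \<kappa> *\<^sub>R sgn x)) + W x *\<^sub>R G x)"
    by (rule C1_punctured_mult[OF \<psi> W])
  from weak_C1[OF this c, of d] supp
  have 0: "(LINT x|lborel. norm x powr (- a * p) * (flux p (gradient u x) \<bullet>
      (\<psi> x *\<^sub>R ((W x / norm x) *\<^sub>R ((1 - p) *\<^sub>R P x - \<kappa> *\<^sub>R sgn x)) + W x *\<^sub>R G x))
      - \<mu> / norm x powr ((a + 1) * p) * u x powr (p - 1) * (\<psi> x * W x)) = 0" by auto
  have eq: "norm x powr (- a * p) * (flux p (gradient u x) \<bullet>
      (\<psi> x *\<^sub>R ((W x / norm x) *\<^sub>R ((1 - p) *\<^sub>R P x - \<kappa> *\<^sub>R sgn x)) + W x *\<^sub>R G x))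
      - \<mu> / norm x powr ((a + 1) * p) * u x powr (p - 1) * (\<psi> x * W x)
      = norm x powr (- real DIM('a)) * ?f x" for x
  proof (cases "x = 0")
    case False
    let ?r = "norm x" and ?A = "flux p (P x)"
    have r: "0 < ?r" and u: "0 < u x" using False u_pos by auto
    have "gradient u x = (u x / ?r) *\<^sub>R P x" using r u by (simp add: P_def)
    then have fl: "flux p (gradient u x) = (u x / ?r) powr (p - 1) *\<^sub>R ?A"
      using r u by (simp add: flux_scaleR)
    have k1: "?r powr (- a * p) * (u x / ?r) powr (p - 1) * W x = ?r powr (- real DIM('a)) * ?r"
    proof -
      have "?r powr (- a * p) * (u x / ?r) powr (p - 1) * W x
        = (u x powr (p - 1) * u x powr (1 - p)) * (?r powr (- a * p) * ?r powr (1 - p) * ?r powr (- \<kappa>))"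
        using r u powr_minus_divide[of ?r "p - 1"] by (simp add: W_def powr_divide)
      also have "\<dots> = ?r powr (- a * p + (1 - p) + - \<kappa>)"
        using r u unfolding powr_add[symmetric] by simp
      also have "- a * p + (1 - p) + - \<kappa> = - real DIM('a) + 1" by (simp add: \<kappa>_def algebra_simps)
      finally show ?thesis using r by (simp add: powr_diff powr_minus_divide)
    qed
    have k2: "\<mu> / ?r powr ((a + 1) * p) * u x powr (p - 1) * W x = \<mu> * ?r powr (- real DIM('a))"
    proof -
      have "\<mu> / ?r powr ((a + 1) * p) * u x powr (p - 1) * W x
        = \<mu> * (u x powr (p - 1) * u x powr (1 - p)) * (?r powr (- ((a + 1) * p)) * ?r powr (- \<kappa>))"
        by (simp add: W_def powr_minus_divide)
      also have "\<dots> = \<mu> * ?r powr (- ((a + 1) * p) + - \<kappa>)"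
        using r u unfolding powr_add[symmetric] by simp
      finally show ?thesis by (simp add: \<kappa>_def)
    qed
    have "?r powr (- a * p) * (flux p (gradient u x) \<bullet>
      (\<psi> x *\<^sub>R ((W x / ?r) *\<^sub>R ((1 - p) *\<^sub>R P x - \<kappa> *\<^sub>R sgn x)) + W x *\<^sub>R G x))
      = (?r powr (- a * p) * (u x / ?r) powr (p - 1) * W x) *
        (?A \<bullet> G x + \<psi> x / ?r * ((1 - p) * (?A \<bullet> P x) - \<kappa> * (?A \<bullet> sgn x)))"
      unfolding fl by (simp add: inner_add_right inner_diff_right algebra_simps)
    also have "\<dots> = ?r powr (- real DIM('a)) * (?A \<bullet> (?r *\<^sub>R G x) + \<psi> x * ((1 - p) * (?A \<bullet> P x) - \<kappa> * (?A \<bullet> sgn x)))"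
      unfolding k1 using r by (simp add: algebra_simps)
    finally show ?thesis using arg_cong[OF k2, of "\<lambda>t. t * \<psi> x"]
      by (simp add: flux_inner_self algebra_simps)
  qed simp
  have "continuous_on (- {0}) ?f"
    using p by (intro continuous_intros flux_P_cont P_cont C1_punctured_continuous_gradient[OF \<psi>]
        C1_punctured_continuous[OF \<psi>] continuous_on_sgn_punctured continuous_on_powr') auto
  from integral_nu[OF borel_measurable_punctured[OF this]] 0 show ?thesis
    unfolding eq by simp
qed

lemma flux_R: "flux p (R x) = - (\<bar>\<gamma>\<bar> powr (p - 2) * \<gamma>) *\<^sub>R sgn x"
  by (cases "x = 0") (simp_all add: R_def flux_def norm_sgn)

text \<open>The equation for \<gamma> says that the zero order bracket in \<open>riccati\<close>
  vanishes at \<open>P = R\<close>.\<close>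

lemma root': "(p - 1) * \<bar>\<gamma>\<bar> powr p - \<kappa> * (\<bar>\<gamma>\<bar> powr (p - 2) * \<gamma>) + \<mu> = 0"
proof -
  have "\<bar>\<gamma>\<bar> powr p = \<bar>\<gamma>\<bar> powr (p - 2) * \<gamma> * \<gamma>"
  proof -
    have "\<bar>\<gamma>\<bar> powr p = (\<bar>\<gamma>\<bar> * \<bar>\<gamma>\<bar>) * \<bar>\<gamma>\<bar> powr (p - 2)"
      using powr_split[of "\<bar>\<gamma>\<bar>" "p - 1"] powr_split[of "\<bar>\<gamma>\<bar>" p]
      by (simp add: mult.assoc del: abs_mult_self_eq)
    then show ?thesis by simp
  qed
  then show ?thesis using root unfolding \<kappa>_def by (simp add: algebra_simps)
qed

definition M :: "'a \<Rightarrow> 'a" where "M x = flux p (P x) - flux p (R x)"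

definition b :: "'a \<Rightarrow> real" where
  "b x = (p - 1) * (norm (P x) powr p - \<bar>\<gamma>\<bar> powr p) + \<kappa> * (M x \<bullet> sgn x)"

lemma M_cont: "continuous_on (- {0}) M"
  unfolding M_def by (intro continuous_intros flux_P_cont flux_R_cont)

lemma b_cont: "continuous_on (- {0}) b"
  unfolding b_def using p
  by (intro continuous_intros M_cont P_cont continuous_on_sgn_punctured continuous_on_powr') auto

text \<open>Subtracts the equation of the pure power. Its flux is a constant multiple of
  \<open>sgn x\<close>, so against the gradient of \<psi> it contributes a multiple of a radial
  derivative, whose \<open>nu\<close>-integral is zero; \<mu> cancels by
  \<open>root'\<close>.\<close>

lemma riccati_difference:
  assumes \<psi>: "C1_punctured \<psi> G" and c: "0 < c" and supp: "\<And>x. \<psi> x \<noteq> 0 \<Longrightarrow> x \<in> shell c d"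
  shows "(LINT x|nu. M x \<bullet> (norm x *\<^sub>R G x) - \<psi> x * b x) = 0"
proof -
  let ?g = "\<lambda>x. flux p (P x) \<bullet> (norm x *\<^sub>R G x)
    - \<psi> x * ((p - 1) * norm (P x) powr p + \<kappa> * (flux p (P x) \<bullet> sgn x) + \<mu>)"
  let ?s = "\<bar>\<gamma>\<bar> powr (p - 2) * \<gamma>"
  have Gs: "x \<in> shell c d" if "x \<noteq> 0" "G x \<noteq> 0" for x
    using gradient_zero_outside_shell[OF \<psi> supp] that by blast
  have eq: "M x \<bullet> (norm x *\<^sub>R G x) - \<psi> x * b x = ?g x + ?s * (x \<bullet> G x)" for x
  proof (cases "x = 0")
    case True
    then show ?thesis using supp[of 0] c by (auto simp: shell_def)
  next
    case False
    have 1: "flux p (R x) \<bullet> (norm x *\<^sub>R G x) = - ?s * (x \<bullet> G x)"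
    proof -
      have "flux p (R x) \<bullet> (norm x *\<^sub>R G x) = - ?s * ((norm x *\<^sub>R sgn x) \<bullet> G x)"
        unfolding flux_R by simp
      then show ?thesis unfolding norm_scaleR_sgn .
    qed
    have 2: "flux p (R x) \<bullet> sgn x = - ?s"
      unfolding flux_R using sgn_inner_self[OF False] by simp
    have "b x = (p - 1) * norm (P x) powr p + \<kappa> * (flux p (P x) \<bullet> sgn x) - ((p - 1) * \<bar>\<gamma>\<bar> powr p - \<kappa> * ?s)"
      unfolding b_def M_def inner_diff_left 2 by (simp add: algebra_simps)
    also have "(p - 1) * \<bar>\<gamma>\<bar> powr p - \<kappa> * ?s = - \<mu>" using root' by simp
    finally have 3: "b x = (p - 1) * norm (P x) powr p + \<kappa> * (flux p (P x) \<bullet> sgn x) + \<mu>" by simp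
    show ?thesis unfolding 3 M_def inner_diff_left 1 by simp
  qed
  have "integrable nu ?g"
  proof (rule integrable_nu_shell[OF _ c, of _ d])
    show "continuous_on (- {0}) ?g"
      using p by (intro continuous_intros flux_P_cont P_cont C1_punctured_continuous_gradient[OF \<psi>]
          C1_punctured_continuous[OF \<psi>] continuous_on_sgn_punctured continuous_on_powr') auto
    fix x assume "?g x \<noteq> 0"
    then show "x \<in> shell c d"
      using supp[of x] Gs[of x] by (cases "x = 0"; cases "\<psi> x = 0"; cases "G x = 0") auto
  qed
  moreover have "integrable nu (\<lambda>x. ?s * (x \<bullet> G x))"
  proof (rule integrable_nu_shell[OF _ c, of _ d])
    show "continuous_on (- {0}) (\<lambda>x. ?s * (x \<bullet> G x))"
      by (intro continuous_intros C1_punctured_continuous_gradient[OF \<psi>])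
    fix x assume "?s * (x \<bullet> G x) \<noteq> 0"
    then show "x \<in> shell c d" using Gs[of x] by (cases "x = 0"; cases "G x = 0") auto
  qed
  moreover have "(LINT x|nu. ?s * (x \<bullet> G x)) = 0"
    using integral_nu_radial_derivative[OF \<psi> c supp] by simp
  ultimately show ?thesis
    unfolding eq using riccati[OF \<psi> c supp] by (subst Bochner_Integration.integral_add) auto
qed

section \<open>The bounded function \<open>w\<close> and its energy identity\<close>

definition w :: "'a \<Rightarrow> real" where "w x = ln (u x) + \<gamma> * ln (norm x)"

definition Q :: "'a \<Rightarrow> 'a" where "Q x = P x - R x"

lemma Q_cont: "continuous_on (- {0}) Q"
  unfolding Q_def by (intro continuous_intros P_cont R_cont)

lemma w_C1: "C1_punctured w (\<lambda>x. (1 / norm x) *\<^sub>R Q x)"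
proof -
  have 1: "C1_punctured (\<lambda>x. ln (u x)) (\<lambda>x. (1 / u x) *\<^sub>R gradient u x)"
    using u_pos by (intro C1_punctured_compose[OF u_C1, of "{0<..}"])
      (auto intro!: derivative_eq_intros continuous_intros)
  show ?thesis
    by (rule C1_punctured_cong[OF C1_punctured_add[OF 1 C1_punctured_mult[OF C1_punctured_const[of \<gamma>] C1_punctured_ln]]])
      (auto simp: w_def Q_def P_def R_def scaleR_add_right)
qed

lemma w_cont: "continuous_on (- {0}) w"
  by (rule C1_punctured_continuous[OF w_C1])

lemma w_bounds:
  assumes "x \<noteq> 0"
  shows "ln c1 \<le> w x" "w x \<le> ln c2"
proof -
  have r: "0 < norm x" using assms by simp
  have c2: "0 < c2"
    using bounds[OF assms] u_pos[OF assms] by (metis less_le_trans mult_pos_pos not_le zero_less_mult_pos2 powr_gt_zero r less_imp_neq)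
  have "ln (c1 * norm x powr (- \<gamma>)) \<le> ln (u x)" "ln (u x) \<le> ln (c2 * norm x powr (- \<gamma>))"
    using bounds[OF assms] u_pos[OF assms] c1 c2 r by auto
  then show "ln c1 \<le> w x" "w x \<le> ln c2" using c1 c2 r by (auto simp: w_def ln_mult ln_powr)
qed

text \<open>\<open>f1\<close> is \<open>riccati_difference\<close> tested with the cutoff times
  \<open>h(w)\<close>. Since h(w) (Q \<bullet> sgn x) is the radial derivative of H(w),
  \<open>f2\<close> moves the linear term onto the cutoff. The sum holds for any real \<beta>, which
  is later chosen to cancel the linear part of \<open>b\<close>.\<close>

lemma energy_identity:
  assumes H: "\<And>s. (H has_real_derivative h s) (at s)" "\<And>s. (h has_real_derivative h' s) (at s)"
      "continuous_on UNIV h'"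
    and m: "m \<ge> 2" and T: "0 < T" and N: "0 < N"
  shows "(LINT x|nu. cutoff m T N x * (h' (w x) * (M x \<bullet> Q x) - h (w x) * (b x - \<beta> * (Q x \<bullet> sgn x)))
      + cutoff' m T N x * (h (w x) * (M x \<bullet> sgn x) + \<beta> * H (w x))) = 0"
proof -
  let ?a = "exp (- (T + N))" and ?b = "exp (T + N)"
  have hc: "continuous_on UNIV h" "continuous_on UNIV H"
    using H by (meson DERIV_isCont continuous_at_imp_continuous_on)+
  note cut = cutoff_C1[OF m T N]
  have hw: "C1_punctured (\<lambda>x. h (w x)) (\<lambda>x. h' (w x) *\<^sub>R ((1 / norm x) *\<^sub>R Q x))"
    by (rule C1_punctured_compose[OF w_C1, of UNIV]) (use H in auto)
  have Hw: "C1_punctured (\<lambda>x. H (w x)) (\<lambda>x. h (w x) *\<^sub>R ((1 / norm x) *\<^sub>R Q x))"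
    by (rule C1_punctured_compose[OF w_C1, of UNIV]) (use H hc in auto)
  have supp: "x \<in> shell ?a ?b" if "cutoff m T N x * y \<noteq> 0" for x :: 'a and y
    using cutoff_supp[OF N, of m T x] m that by auto
  have supp': "x \<in> shell ?a ?b" if "cutoff' m T N x \<noteq> 0" for x :: 'a
    by (rule cutoff'_supp_shell[OF T N m that])
  define f1 where "f1 x = cutoff m T N x * (h' (w x) * (M x \<bullet> Q x) - h (w x) * b x)
      + cutoff' m T N x * (h (w x) * (M x \<bullet> sgn x))" for x
  define f2 where "f2 x = cutoff m T N x * (h (w x) * (Q x \<bullet> sgn x)) + cutoff' m T N x * H (w x)" for x
  have cc: "continuous_on (- {0}) (cutoff m T N)" by (rule C1_punctured_continuous[OF cut])
  have cc': "continuous_on (- {0}) (cutoff' m T N)" by (rule cutoff'_continuous[OF T N])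
  have wc: "continuous_on (- {0}) (\<lambda>x. h (w x))" "continuous_on (- {0}) (\<lambda>x. h' (w x))"
    "continuous_on (- {0}) (\<lambda>x. H (w x))"
    by (rule continuous_on_compose2[OF _ w_cont], rule H hc, simp)+
  have i1: "integrable nu f1" unfolding f1_def
  proof (rule integrable_nu_shell[where a = ?a and b = ?b])
    show "continuous_on (- {0}) (\<lambda>x. cutoff m T N x * (h' (w x) * (M x \<bullet> Q x) - h (w x) * b x)
      + cutoff' m T N x * (h (w x) * (M x \<bullet> sgn x)))"
      by (intro continuous_intros cc cc' wc M_cont Q_cont b_cont continuous_on_sgn_punctured)
  qed (use supp supp' in \<open>force+\<close>)
  have i2: "integrable nu f2" unfolding f2_def
  proof (rule integrable_nu_shell[where a = ?a and b = ?b])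
    show "continuous_on (- {0}) (\<lambda>x. cutoff m T N x * (h (w x) * (Q x \<bullet> sgn x)) + cutoff' m T N x * H (w x))"
      by (intro continuous_intros cc cc' wc M_cont Q_cont b_cont continuous_on_sgn_punctured)
  qed (use supp supp' in \<open>force+\<close>)
  have "integral\<^sup>L nu f1 = 0"
  proof -
    have "f1 x = M x \<bullet> (norm x *\<^sub>R (cutoff m T N x *\<^sub>R (h' (w x) *\<^sub>R ((1 / norm x) *\<^sub>R Q x))
        + h (w x) *\<^sub>R ((cutoff' m T N x / norm x) *\<^sub>R sgn x))) - (cutoff m T N x * h (w x)) * b x" for x
    proof (cases "x = 0")
      case True
      then show ?thesis by (simp add: f1_def cutoff_def cutoff'_def)
    next
      case False
      then show ?thesis by (simp add: f1_def inner_add_right algebra_simps)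
    qed
    then have "f1 = (\<lambda>x. M x \<bullet> (norm x *\<^sub>R (cutoff m T N x *\<^sub>R (h' (w x) *\<^sub>R ((1 / norm x) *\<^sub>R Q x))
        + h (w x) *\<^sub>R ((cutoff' m T N x / norm x) *\<^sub>R sgn x))) - (cutoff m T N x * h (w x)) * b x)" by blast
    moreover have "0 < ?a" by simp
    ultimately show ?thesis
      using riccati_difference[OF C1_punctured_mult[OF cut hw] _ supp] by (simp only:)
  qed
  moreover have "integral\<^sup>L nu f2 = 0"
  proof -
    have "f2 x = x \<bullet> (cutoff m T N x *\<^sub>R (h (w x) *\<^sub>R ((1 / norm x) *\<^sub>R Q x))
        + H (w x) *\<^sub>R ((cutoff' m T N x / norm x) *\<^sub>R sgn x))" for x
    proof (cases "x = 0")
      case False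
      have "x \<bullet> sgn x = norm x" "x \<bullet> V = norm x * (V \<bullet> sgn x)" for V
        using False by (auto simp: sgn_div_norm dot_square_norm power2_eq_square inner_commute)
      then show ?thesis using False by (simp add: f2_def inner_add_right)
    qed (simp add: f2_def cutoff_def cutoff'_def)
    then have "f2 = (\<lambda>x. x \<bullet> (cutoff m T N x *\<^sub>R (h (w x) *\<^sub>R ((1 / norm x) *\<^sub>R Q x))
        + H (w x) *\<^sub>R ((cutoff' m T N x / norm x) *\<^sub>R sgn x)))" by blast
    moreover have "0 < ?a" by simp
    ultimately show ?thesis
      using integral_nu_radial_derivative[OF C1_punctured_mult[OF cut Hw] _ supp] by (simp only:)
  qed
  ultimately have "(LINT x|nu. f1 x + \<beta> * f2 x) = 0" using i1 i2 by simp
  moreover have "f1 x + \<beta> * f2 x = cutoff m T N x * (h' (w x) * (M x \<bullet> Q x) - h (w x) * (b x - \<beta> * (Q x \<bullet> sgn x)))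
      + cutoff' m T N x * (h (w x) * (M x \<bullet> sgn x) + \<beta> * H (w x))" for x
    by (simp add: f1_def f2_def algebra_simps)
  ultimately show ?thesis by simp
qed

end

section \<open>The case of a vanishing exponent\<close>

locale zero_exponent = positive_solution u p a \<mu> \<gamma> c1 c2
  for u :: "'a::euclidean_space \<Rightarrow> real" and p a \<mu> \<gamma> c1 c2 +
  assumes \<gamma>0: "\<gamma> = 0"
begin

section \<open>Energy and radial flux of the solution itself\<close>

definition q :: "'a \<Rightarrow> 'a" where "q x = norm x *\<^sub>R gradient u x"

definition E :: "'a \<Rightarrow> real" where "E x = norm (q x) powr p"

definition A :: "'a \<Rightarrow> real" where "A x = flux p (q x) \<bullet> sgn x"

definition Y :: "'a \<Rightarrow> real" where "Y x = A x * (q x \<bullet> sgn x)"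

lemma q_cont: "continuous_on (- {0}) q"
  unfolding q_def by (intro continuous_intros gu_cont)

lemma E_cont: "continuous_on (- {0}) E"
  unfolding E_def using p by (intro continuous_on_powr' continuous_intros q_cont) auto

lemma A_cont: "continuous_on (- {0}) A"
  unfolding A_def
  by (intro continuous_intros continuous_on_sgn_punctured
      continuous_on_compose2[OF flux_continuous[OF p, of UNIV] q_cont]) auto

lemma Y_cont: "continuous_on (- {0}) Y"
  unfolding Y_def by (intro continuous_intros A_cont q_cont continuous_on_sgn_punctured)

lemma E_nonneg: "0 \<le> E x"
  by (simp add: E_def)

lemma norm_sgn_le: "norm (sgn (x::'a)) \<le> 1"
  by (simp add: norm_sgn)

lemma A_le: "\<bar>A x\<bar> \<le> norm (q x) powr (p - 1)"
proof -
  have "\<bar>A x\<bar> \<le> norm (flux p (q x)) * norm (sgn x)" unfolding A_def by (rule Cauchy_Schwarz_ineq2)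
  also have "\<dots> \<le> norm (flux p (q x)) * 1" by (intro mult_left_mono norm_sgn_le) auto
  finally show ?thesis by (simp add: norm_flux)
qed

lemma A_eq: "A x = norm (q x) powr (p - 2) * (q x \<bullet> sgn x)"
  by (simp add: A_def flux_def)

lemma Y_nonneg: "0 \<le> Y x"
  by (simp add: Y_def A_eq mult.assoc)

lemma Y_le_E: "Y x \<le> E x"
proof -
  have "\<bar>q x \<bullet> sgn x\<bar> \<le> norm (q x) * norm (sgn x)" by (rule Cauchy_Schwarz_ineq2)
  also have "\<dots> \<le> norm (q x) * 1" by (intro mult_left_mono norm_sgn_le) auto
  finally have "\<bar>A x\<bar> * \<bar>q x \<bullet> sgn x\<bar> \<le> norm (q x) powr (p - 1) * norm (q x)"
    using A_le[of x] by (intro mult_mono) auto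
  then have "\<bar>Y x\<bar> \<le> E x"
    using powr_split[of "norm (q x)" p] by (simp add: Y_def E_def abs_mult mult.commute)
  then show ?thesis by simp
qed

lemma A_eq_0: "Y x = 0 \<Longrightarrow> A x = 0"
  by (auto simp: Y_def A_eq)

text \<open>The radial flux is small relative to \<open>1 + E\<close> unless the radial component of
  \<open>q\<close> is bounded below, and in that case \<open>Y\<close> dominates it. This is how an
  integral bound on \<open>Y\<close> improves the energy estimate.\<close>

lemma A_le_eps:
  assumes "0 < s"
  obtains C where "0 \<le> C" "\<And>x. \<bar>A x\<bar> \<le> s * (1 + E x) + C * Y x"
proof -
  \<comment> \<open>\<tau> makes the bound \<open>|q|^(p-1)\<close> at most \<open>s\<close> for
    \<open>|q| \<le> \<tau>\<close>; \<sigma> makes \<open>|q|^(p-2) \<sigma>\<close> at most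
    \<open>s |q|^p\<close> for \<open>|q| > \<tau>\<close>.\<close>
  define \<tau> where "\<tau> = s powr (1 / (p - 1))"
  define \<sigma> where "\<sigma> = s * \<tau>\<^sup>2"
  have \<tau>: "0 < \<tau>" "\<tau> powr (p - 1) = s" using assms p by (auto simp: \<tau>_def powr_powr)
  have \<sigma>: "0 < \<sigma>" using assms \<tau> by (simp add: \<sigma>_def)
  show ?thesis
  proof (rule that[of "1 / \<sigma>"])
    fix x
    let ?n = "norm (q x)"
    consider "\<bar>q x \<bullet> sgn x\<bar> \<ge> \<sigma>" | "?n \<le> \<tau>" | "\<bar>q x \<bullet> sgn x\<bar> < \<sigma>" "\<tau> < ?n" by linarith
    then show "\<bar>A x\<bar> \<le> s * (1 + E x) + 1 / \<sigma> * Y x"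
    proof cases
      case 1
      have "\<bar>A x\<bar> * \<sigma> \<le> \<bar>A x\<bar> * \<bar>q x \<bullet> sgn x\<bar>" using 1 by (intro mult_left_mono) auto
      also have "\<dots> = Y x" using Y_nonneg[of x] by (simp add: Y_def abs_mult[symmetric])
      finally have "\<bar>A x\<bar> \<le> 1 / \<sigma> * Y x" using \<sigma> by (simp add: field_simps)
      moreover have "0 \<le> s * (1 + E x)" using assms E_nonneg[of x] by simp
      ultimately show ?thesis by linarith
    next
      case 2
      then have "?n powr (p - 1) \<le> \<tau> powr (p - 1)" using p by (intro powr_mono2) auto
      then have "\<bar>A x\<bar> \<le> s" using A_le[of x] \<tau> by simp
      moreover have "0 \<le> s * E x" "0 \<le> 1 / \<sigma> * Y x" using assms E_nonneg[of x] \<sigma> Y_nonneg[of x] by auto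
      ultimately show ?thesis by (simp add: distrib_left)
    next
      case 3
      have n: "0 < ?n" using 3 \<tau> by linarith
      have "\<bar>A x\<bar> \<le> ?n powr (p - 2) * \<sigma>"
        unfolding A_eq abs_mult using 3 by (intro mult_mono) auto
      also have "\<dots> = s * (?n powr (p - 2) * \<tau>\<^sup>2)" by (simp add: \<sigma>_def)
      also have "\<dots> \<le> s * (?n powr (p - 2) * ?n\<^sup>2)"
        using 3 \<tau> assms by (intro mult_left_mono power_mono) auto
      also have "?n powr (p - 2) * ?n\<^sup>2 = E x"
        using n by (simp add: E_def powr_diff powr_numeral)
      finally have "\<bar>A x\<bar> \<le> s * E x" .
      moreover have "0 \<le> s" "0 \<le> 1 / \<sigma> * Y x" using assms \<sigma> Y_nonneg[of x] by auto
      ultimately show ?thesis by (simp add: distrib_left)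
    qed
  qed (use \<sigma> in auto)
qed

lemma u_le: "x \<noteq> 0 \<Longrightarrow> u x \<le> c2"
  using bounds[of x] \<gamma>0 by simp

lemma c2_pos: "0 < c2"
proof -
  obtain i :: 'a where "i \<in> Basis" using nonempty_Basis by blast
  then have "i \<noteq> 0" by auto
  then show ?thesis using u_pos[of i] u_le[of i] by linarith
qed

text \<open>The equation for \<open>u\<close> itself, recovered from \<open>riccati\<close> by
  testing with \<open>\<psi> * u powr (p - 1)\<close>: the gradient of the power of \<open>u\<close>
  cancels the term \<open>(p - 1) |P|^p\<close>, and \<gamma> = 0 forces \<mu> = 0.\<close>

lemma divergence_identity:
  assumes \<psi>: "C1_punctured \<psi> G" and c: "0 < c" and supp: "\<And>x. \<psi> x \<noteq> 0 \<Longrightarrow> x \<in> shell c d"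
  shows "(LINT x|nu. flux p (q x) \<bullet> (norm x *\<^sub>R G x) - \<kappa> * \<psi> x * A x) = 0"
proof -
  have 1: "C1_punctured (\<lambda>x. u x powr (p - 1)) (\<lambda>x. ((p - 1) * u x powr (p - 1 - 1)) *\<^sub>R gradient u x)"
    using u_pos by (intro C1_punctured_compose[OF u_C1, of "{0<..}"])
      (auto intro!: derivative_eq_intros continuous_intros)
  have \<mu>0: "\<mu> = 0" using root \<gamma>0 by simp
  have eq: "flux p (P x) \<bullet> (norm x *\<^sub>R (\<psi> x *\<^sub>R (((p - 1) * u x powr (p - 1 - 1)) *\<^sub>R gradient u x) + u x powr (p - 1) *\<^sub>R G x))
    - (\<psi> x * u x powr (p - 1)) * ((p - 1) * norm (P x) powr p + \<kappa> * (flux p (P x) \<bullet> sgn x) + \<mu>)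
    = flux p (q x) \<bullet> (norm x *\<^sub>R G x) - \<kappa> * \<psi> x * A x" for x
  proof (cases "x = 0")
    case True
    then show ?thesis using supp[of 0] c by (auto simp: shell_def)
  next
    case False
    have u: "0 < u x" using u_pos[OF False] .
    have Pq: "P x = (1 / u x) *\<^sub>R q x" by (simp add: P_def q_def)
    have f: "flux p (P x) = (1 / u x) powr (p - 1) *\<^sub>R flux p (q x)"
      unfolding Pq using u by (intro flux_scaleR) simp
    have k: "u x powr (p - 1) * (1 / u x) powr (p - 1) = 1" using u by (simp add: powr_divide)
    have k2: "u x powr (p - 1 - 1) = u x powr (p - 1) / u x" using u by (simp add: powr_diff power2_eq_square)
    have nP: "norm (P x) powr p = (1 / u x) powr (p - 1) * (E x / u x)"
    proof -
      have "norm (P x) powr p = (1 / u x) powr p * E x"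
        unfolding Pq E_def using u by (simp add: powr_divide)
      also have "(1 / u x) powr p = 1 / u x * (1 / u x) powr (p - 1)" using powr_split[of "1 / u x" p] u by simp
      finally show ?thesis by simp
    qed
    have fq: "flux p (q x) \<bullet> gradient u x * norm x = E x"
      using flux_inner_self[of p "q x"] by (simp add: q_def E_def mult.commute)
    have "flux p (P x) \<bullet> (norm x *\<^sub>R (\<psi> x *\<^sub>R (((p - 1) * u x powr (p - 1 - 1)) *\<^sub>R gradient u x) + u x powr (p - 1) *\<^sub>R G x))
      = (u x powr (p - 1) * (1 / u x) powr (p - 1)) * (\<psi> x * (p - 1) / u x * (flux p (q x) \<bullet> gradient u x * norm x)
        + flux p (q x) \<bullet> (norm x *\<^sub>R G x))"
      unfolding f k2 by (simp add: inner_add_right algebra_simps)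
    moreover have "(\<psi> x * u x powr (p - 1)) * ((p - 1) * norm (P x) powr p + \<kappa> * (flux p (P x) \<bullet> sgn x) + \<mu>)
      = (u x powr (p - 1) * (1 / u x) powr (p - 1)) * (\<psi> x * (p - 1) * (E x / u x) + \<kappa> * \<psi> x * A x)"
      unfolding f nP \<mu>0 A_def by (simp add: algebra_simps)
    ultimately show ?thesis unfolding k fq by simp
  qed
  have "\<And>x. \<psi> x * u x powr (p - 1) \<noteq> 0 \<Longrightarrow> x \<in> shell c d" using supp by auto
  from riccati[OF C1_punctured_mult[OF \<psi> 1] c this] show ?thesis unfolding eq .
qed

section \<open>Energy growth and the Pohozaev identity\<close>

context
  fixes m :: nat
  assumes m: "m \<ge> 2" "real m \<ge> p"
begin

text \<open>Plateau and collar have the same logarithmic width, so the slope is of order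
  \<open>1 / N\<close> on a set of measure of order \<open>N\<close>.\<close>

abbreviation "\<eta> N \<equiv> cutoff m N N :: 'a \<Rightarrow> real"
abbreviation "\<eta>' N \<equiv> cutoff' m N N :: 'a \<Rightarrow> real"

lemma integrable_\<eta>:
  assumes "0 < N" "continuous_on (- {0}) f"
  shows "integrable nu (\<lambda>x. \<eta> N x * f x)" "integrable nu (\<lambda>x. \<eta>' N x * f x)"
  using integrable_cutoff[OF assms(1) assms(1) m(1) assms(2)] by auto

text \<open>Tested with \<open>\<eta> N * u\<close>, which turns the flux into the energy
  density.\<close>

lemma caccioppoli_identity:
  assumes N: "0 < N"
  shows "(LINT x|nu. \<eta> N x * E x + \<eta>' N x * (u x * A x) - \<kappa> * (\<eta> N x * (u x * A x))) = 0"
proof -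
  have "\<eta> N x * u x \<noteq> 0 \<Longrightarrow> x \<in> shell (exp (- (N + N))) (exp (N + N))" for x
    using cutoff_supp[OF N, of m N x] m by auto
  from divergence_identity[OF C1_punctured_mult[OF cutoff_C1[OF m(1) N N] u_C1] _ this]
  have "(LINT x|nu. flux p (q x) \<bullet> (norm x *\<^sub>R (\<eta> N x *\<^sub>R gradient u x + u x *\<^sub>R ((\<eta>' N x / norm x) *\<^sub>R sgn x)))
      - \<kappa> * (\<eta> N x * u x) * A x) = 0" by simp
  moreover have "flux p (q x) \<bullet> (norm x *\<^sub>R (\<eta> N x *\<^sub>R gradient u x + u x *\<^sub>R ((\<eta>' N x / norm x) *\<^sub>R sgn x)))
      - \<kappa> * (\<eta> N x * u x) * A x
    = \<eta> N x * E x + \<eta>' N x * (u x * A x) - \<kappa> * (\<eta> N x * (u x * A x))" for x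
  proof (cases "x = 0")
    case False
    have "norm x * (flux p (q x) \<bullet> gradient u x) = E x"
      using flux_inner_self[of p "q x"] by (simp add: q_def E_def)
    then have "\<eta> N x * (norm x * (flux p (q x) \<bullet> gradient u x)) = \<eta> N x * E x" by simp
    then show ?thesis using False by (simp add: inner_add_right A_def algebra_simps)
  qed (simp add: cutoff_def cutoff'_def)
  ultimately show ?thesis by (simp only:)
qed

text \<open>The bound on \<open>\<bar>A\<bar>\<close> is a hypothesis because two are needed: Young's inequality yields linear growth
  of the energy, which \<open>A_le_eps\<close> then improves to sublinear growth.\<close>

lemma energy_le:
  assumes N: "0 < N" and k: "0 \<le> t" "continuous_on (- {0}) g" "\<And>x. 0 \<le> g x"
    and A: "\<And>x. \<bar>\<kappa>\<bar> * c2 * (\<eta> N x * \<bar>A x\<bar>) \<le> 1 / 4 * (\<eta> N x * E x) + t * indicator (shell (exp (- (N + N))) (exp (N + N))) x + \<eta> N x * g x"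
  shows "(LINT x|nu. \<eta> N x * E x)
    \<le> 2 * ((t + (2 * real m * c2 / N) powr p * (1 / 4) powr (1 - p)) * measure nu (shell (exp (- (N + N))) (exp (N + N)) :: 'a set)
      + (LINT x|nu. \<eta> N x * g x))"
proof -
  let ?S = "shell (exp (- (N + N))) (exp (N + N)) :: 'a set"
  let ?K = "(2 * real m * c2 / N) powr p * (1 / 4) powr (1 - p)"
  have Si: "integrable nu (indicator ?S :: 'a \<Rightarrow> real)" by (rule integrable_indicator_shell) simp
  have uA: "continuous_on (- {0}) (\<lambda>x. u x * A x)" by (intro continuous_intros u_cont A_cont)
  note i = integrable_\<eta>[OF N E_cont] integrable_\<eta>[OF N uA] integrable_\<eta>[OF N k(2)]
  have "(LINT x|nu. \<eta> N x * E x) = (LINT x|nu. \<kappa> * (\<eta> N x * (u x * A x)) - \<eta>' N x * (u x * A x))"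
    using caccioppoli_identity[OF N] i by simp
  also have "\<dots> \<le> (LINT x|nu. 1 / 2 * (\<eta> N x * E x) + (t + ?K) * indicator ?S x + \<eta> N x * g x)"
  proof (rule integral_mono)
    fix x :: 'a
    have \<eta>: "0 \<le> \<eta> N x" "\<eta> N x \<le> 1" by (rule cutoff_bounds)+
    have 1: "\<kappa> * (\<eta> N x * (u x * A x)) \<le> 1 / 4 * (\<eta> N x * E x) + t * indicator ?S x + \<eta> N x * g x"
    proof (cases "x = 0")
      case False
      have "\<kappa> * (\<eta> N x * (u x * A x)) \<le> \<bar>\<kappa>\<bar> * (\<eta> N x * (\<bar>u x\<bar> * \<bar>A x\<bar>))"
        using abs_ge_self[of "\<kappa> * (\<eta> N x * (u x * A x))"] \<eta> by (simp add: abs_mult)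
      also have "\<dots> \<le> \<bar>\<kappa>\<bar> * (\<eta> N x * (c2 * \<bar>A x\<bar>))"
        using \<eta> u_le[OF False] u_pos[OF False] by (intro mult_left_mono mult_right_mono) auto
      finally show ?thesis using A[of x] by (simp add: mult_ac)
    qed (use k E_nonneg in \<open>simp add: cutoff_def\<close>)
    have 2: "- (\<eta>' N x * (u x * A x)) \<le> 1 / 4 * (\<eta> N x * E x) + ?K * indicator ?S x"
    proof (cases "\<eta>' N x = 0")
      case True
      have "0 \<le> ?K * indicator ?S x" by simp
      then show ?thesis using True \<eta> E_nonneg[of x] by simp
    next
      case False
      then have x0: "x \<noteq> 0" and xS: "x \<in> ?S" using cutoff'_supp_shell[OF N N m(1), of x] by (auto simp: cutoff'_def)
      have "- (\<eta>' N x * (u x * A x)) \<le> \<bar>\<eta>' N x\<bar> * (\<bar>u x\<bar> * \<bar>A x\<bar>)"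
        using abs_ge_minus_self[of "\<eta>' N x * (u x * A x)"] by (simp add: abs_mult)
      also have "\<dots> \<le> (2 * real m / N * \<eta> N x powr ((p - 1) / p)) * (c2 * norm (q x) powr (p - 1))"
        using cutoff'_bound[OF N N m p, of x] u_le[OF x0] u_pos[OF x0] A_le[of x] N
        by (intro mult_mono) auto
      also have "\<dots> = 2 * real m * c2 / N * \<eta> N x powr ((p - 1) / p) * norm (q x) powr (p - 1)" by simp
      also have "\<dots> \<le> 1 / 4 * (\<eta> N x * norm (q x) powr p) + ?K"
        using \<eta> c2_pos N p by (intro powr_young) auto
      finally show ?thesis using xS by (simp add: E_def)
    qed
    show "\<kappa> * (\<eta> N x * (u x * A x)) - \<eta>' N x * (u x * A x)
        \<le> 1 / 2 * (\<eta> N x * E x) + (t + ?K) * indicator ?S x + \<eta> N x * g x"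
      using 1 2 by (simp add: algebra_simps)
  qed (use i Si in auto)
  also have "\<dots> = 1 / 2 * (LINT x|nu. \<eta> N x * E x) + (t + ?K) * measure nu ?S + (LINT x|nu. \<eta> N x * g x)"
    using i Si by simp
  finally show ?thesis by simp
qed

text \<open>\<open>energy_le\<close> with \<open>g = 0\<close>, the radial flux being absorbed by
  Young's inequality. As shells have measure of order \<open>N\<close>, the energy grows at most
  linearly.\<close>

lemma energy_growth:
  assumes N: "0 < N"
  shows "(LINT x|nu. \<eta> N x * E x)
    \<le> 2 * ((\<bar>\<kappa>\<bar> * c2) powr p * (1 / 4) powr (1 - p) + (2 * real m * c2 / N) powr p * (1 / 4) powr (1 - p))
      * measure nu (shell (exp (- (N + N))) (exp (N + N)) :: 'a set)"
proof -
  let ?t = "(\<bar>\<kappa>\<bar> * c2) powr p * (1 / 4) powr (1 - p)"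
  have "\<bar>\<kappa>\<bar> * c2 * (\<eta> N x * \<bar>A x\<bar>) \<le> 1 / 4 * (\<eta> N x * E x)
      + ?t * indicator (shell (exp (- (N + N))) (exp (N + N))) x + \<eta> N x * 0" for x
  proof (cases "\<eta> N x = 0")
    case False
    then have xS: "x \<in> shell (exp (- (N + N))) (exp (N + N))" using cutoff_supp[OF N, of m N x] m by auto
    have \<eta>: "0 \<le> \<eta> N x" "\<eta> N x \<le> 1" by (rule cutoff_bounds)+
    \<comment> \<open>The cutoff is at most 1, so it may be replaced by the smaller power for which
      \<open>powr_young\<close> is stated.\<close>
    have "\<eta> N x = \<eta> N x powr 1" using \<eta> by simp
    also have "\<dots> \<le> \<eta> N x powr ((p - 1) / p)" using \<eta> p by (intro powr_mono') auto
    finally have "\<bar>\<kappa>\<bar> * c2 * (\<eta> N x * \<bar>A x\<bar>) \<le> \<bar>\<kappa>\<bar> * c2 * (\<eta> N x powr ((p - 1) / p) * norm (q x) powr (p - 1))"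
      using c2_pos A_le[of x] \<eta> by (intro mult_left_mono mult_mono) auto
    also have "\<dots> = \<bar>\<kappa>\<bar> * c2 * \<eta> N x powr ((p - 1) / p) * norm (q x) powr (p - 1)" by simp
    also have "\<dots> \<le> 1 / 4 * (\<eta> N x * norm (q x) powr p) + ?t"
      using \<eta> c2_pos p by (intro powr_young) auto
    finally show ?thesis using xS by (simp add: E_def)
  qed simp
  from energy_le[OF N _ _ _ this] show ?thesis by (simp add: algebra_simps)
qed

text \<open>Compare \<open>u\<close> with its dilate by \<open>l\<close> in the test function
  \<open>\<eta> N\<close> times u(l x) - u(x). Convexity bounds the flux term by a difference of
  energies, dilation invariance moves the dilation from the energy to the cutoff, and dividing by
  \<open>l - 1\<close> gives an inequality as \<open>l\<close> tends to 1. The sign \<sigma> is the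
  side from which \<open>l\<close> approaches 1; both sides together give an equality.\<close>

lemma pohozaev:
  assumes N: "0 < N" and \<sigma>: "\<sigma> = 1 \<or> \<sigma> = -1"
  shows "0 \<le> \<sigma> * ((LINT x|nu. (\<eta>' N x - \<kappa> * \<eta> N x) * Y x) - (LINT x|nu. \<eta>' N x * (E x / p)))"
proof -
  let ?a = "exp (- (N + N))" and ?b = "exp (N + N)"
  \<comment> \<open>Both \<open>l\<close> and its inverse \<open>s\<close> stay in
    \<open>[1/2, 2]\<close>, the range covered by the dilation quotients.\<close>
  define l where "l i = 1 + \<sigma> / (real i + 2)" for i
  define s where "s i = 1 / l i" for i
  have lb: "1 / 2 \<le> l i" "l i \<le> 3 / 2" "l i \<noteq> 1" for i
    using \<sigma> by (auto simp: l_def field_simps)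
  have l_lim: "l \<longlonglongrightarrow> 1"
  proof -
    have "(\<lambda>i. 1 + \<sigma> / (real i + 2)) \<longlonglongrightarrow> 1" by real_asymp
    then show ?thesis by (simp add: l_def[abs_def])
  qed
  have l0: "0 < l i" for i using lb(1)[of i] by linarith
  have sb: "1 / 2 \<le> s i" "s i \<le> 2" "s i \<noteq> 1" "0 < s i" for i
    using lb[of i] l0[of i] by (auto simp: s_def field_simps)
  have s_lim: "s \<longlonglongrightarrow> 1"
    using tendsto_divide[OF tendsto_const l_lim, of 1] by (simp add: s_def[abs_def])
  \<comment> \<open>Everything that multiplies u(l x) - u(x) in
    \<open>divergence_identity\<close>.\<close>
  define h where "h x = (\<eta>' N x - \<kappa> * \<eta> N x) * A x" for x
  have cut: "C1_punctured (\<eta> N) (\<lambda>x. (\<eta>' N x / norm x) *\<^sub>R sgn x)" by (rule cutoff_C1[OF m(1) N N])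
  have \<eta>c: "continuous_on (- {0}) (\<eta> N)" by (rule C1_punctured_continuous[OF cut])
  have hc: "continuous_on (- {0}) h" unfolding h_def
    by (intro continuous_intros \<eta>c cutoff'_continuous N A_cont)
  have \<eta>supp: "x \<in> shell ?a ?b" if "\<eta> N x \<noteq> 0" for x using cutoff_supp[OF N _ that] m by simp
  have hsupp: "x \<in> shell ?a ?b" if "h x \<noteq> 0" for x
    using that \<eta>supp[of x] cutoff'_supp_shell[OF N N m(1), of x] by (cases "\<eta> N x = 0") (auto simp: h_def)
  have \<eta>supp': "x \<in> shell (?a / 2) (2 * ?b)" if "\<eta> N (t *\<^sub>R x) \<noteq> 0" "1 / 2 \<le> t" "t \<le> 2" for t x
  proof -
    have "?a \<le> t * norm x" "t * norm x \<le> ?b" using \<eta>supp[OF that(1)] that by (auto simp: shell_def)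
    moreover have "t * norm x \<le> 2 * norm x" "1 / 2 * norm x \<le> t * norm x"
      using mult_right_mono[of t 2 "norm x"] mult_right_mono[of "1 / 2" t "norm x"] that by auto
    ultimately have "?a / 2 \<le> norm x" "norm x \<le> 2 * ?b" by linarith+
    then show ?thesis by (simp add: shell_def)
  qed
  have iE: "integrable nu (\<lambda>x. \<eta> N (t *\<^sub>R x) * (E x / p))" if "1 / 2 \<le> t" "t \<le> 2" for t
    using that \<eta>supp'[of t] p
    by (intro integrable_nu_shell[of _ "?a / 2" "2 * ?b"] continuous_intros continuous_on_dilation[OF _ \<eta>c] E_cont) auto
  have iEl: "integrable nu (\<lambda>x. \<eta> N x * (E (t *\<^sub>R x) / p))" if "0 < t" for t
    using that \<eta>supp p
    by (intro integrable_nu_shell[of _ ?a ?b] continuous_intros continuous_on_dilation[OF _ E_cont] \<eta>c) auto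
  have ih: "integrable nu (\<lambda>x. (u (t *\<^sub>R x) - u x) * h x)" if "0 < t" for t
    using that hsupp by (intro integrable_nu_shell[of _ ?a ?b] continuous_intros continuous_on_dilation[OF _ u_cont] u_cont hc) auto
  have key: "0 \<le> (LINT x|nu. (\<eta> N (s i *\<^sub>R x) - \<eta> N x) * (E x / p))
      + (LINT x|nu. (u (l i *\<^sub>R x) - u x) * h x)" for i
  proof -
    let ?l = "l i"
    let ?f = "\<lambda>x. \<eta> N x * (flux p (q x) \<bullet> (q (?l *\<^sub>R x) - q x)) + (u (?l *\<^sub>R x) - u x) * h x"
    have du: "C1_punctured (\<lambda>x. u (?l *\<^sub>R x) - u x) (\<lambda>x. ?l *\<^sub>R gradient u (?l *\<^sub>R x) - gradient u x)"
      using l0[of i] by (intro C1_punctured_diff C1_punctured_dilation u_C1) auto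
    have eq: "flux p (q x) \<bullet> (norm x *\<^sub>R (\<eta> N x *\<^sub>R (?l *\<^sub>R gradient u (?l *\<^sub>R x) - gradient u x) +
        (u (?l *\<^sub>R x) - u x) *\<^sub>R ((\<eta>' N x / norm x) *\<^sub>R sgn x))) - \<kappa> * (\<eta> N x * (u (?l *\<^sub>R x) - u x)) * A x
        = ?f x" for x
    proof (cases "x = 0")
      case False
      have "q (?l *\<^sub>R x) = norm x *\<^sub>R (?l *\<^sub>R gradient u (?l *\<^sub>R x))" using l0[of i] by (simp add: q_def)
      then have qd: "q (?l *\<^sub>R x) - q x = norm x *\<^sub>R (?l *\<^sub>R gradient u (?l *\<^sub>R x) - gradient u x)"
        by (simp add: q_def[of x] scaleR_diff_right)
      define d v where "d = ?l *\<^sub>R gradient u (?l *\<^sub>R x) - gradient u x" and "v = u (?l *\<^sub>R x) - u x"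
      show ?thesis unfolding qd unfolding d_def[symmetric] v_def[symmetric]
        using False by (simp add: inner_add_right h_def A_def algebra_simps)
    qed (simp add: h_def cutoff_def cutoff'_def)
    have "x \<in> shell ?a ?b" if "\<eta> N x * (u (?l *\<^sub>R x) - u x) \<noteq> 0" for x using \<eta>supp that by auto
    from divergence_identity[OF C1_punctured_mult[OF cut du] _ this]
    have 0: "integral\<^sup>L nu ?f = 0" unfolding eq by simp
    have ql: "continuous_on (- {0}) (\<lambda>x. q (?l *\<^sub>R x))"
      using l0[of i] by (intro continuous_on_compose2[OF q_cont]) (auto intro!: continuous_intros)
    have if1: "integrable nu (\<lambda>x. \<eta> N x * (flux p (q x) \<bullet> (q (?l *\<^sub>R x) - q x)))"
      by (rule integrable_\<eta>(1)[OF N])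
        (intro continuous_intros ql q_cont continuous_on_compose2[OF flux_continuous[OF p, of UNIV] q_cont] subset_UNIV)
    have "0 \<le> (LINT x|nu. \<eta> N x * (E (?l *\<^sub>R x) / p) - \<eta> N x * (E x / p) + (u (?l *\<^sub>R x) - u x) * h x)"
      unfolding 0[symmetric]
    proof (rule integral_mono)
      fix x :: 'a
      \<comment> \<open>Convexity replaces a derivative of the energy density, which need not exist
        for \<open>u\<close> of class \<open>C^1\<close>.\<close>
      have "p * (flux p (q x) \<bullet> (q (?l *\<^sub>R x) - q x)) \<le> E (?l *\<^sub>R x) - E x"
        using bregman_nonneg[OF p, of "q (?l *\<^sub>R x)" "q x"] by (simp add: bregman_def E_def)
      then have "flux p (q x) \<bullet> (q (?l *\<^sub>R x) - q x) \<le> E (?l *\<^sub>R x) / p - E x / p"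
        using p by (simp add: field_simps)
      then have "\<eta> N x * (flux p (q x) \<bullet> (q (?l *\<^sub>R x) - q x)) \<le> \<eta> N x * (E (?l *\<^sub>R x) / p - E x / p)"
        by (intro mult_left_mono cutoff_bounds)
      then show "?f x \<le> \<eta> N x * (E (?l *\<^sub>R x) / p) - \<eta> N x * (E x / p) + (u (?l *\<^sub>R x) - u x) * h x"
        by (simp add: algebra_simps)
    qed (use if1 iEl[of ?l] iEl[of 1] ih[of ?l] l0[of i] in auto)
    also have "\<dots> = (LINT x|nu. \<eta> N x * (E (?l *\<^sub>R x) / p)) - (LINT x|nu. \<eta> N x * (E x / p))
        + (LINT x|nu. (u (?l *\<^sub>R x) - u x) * h x)"
      using iEl[of ?l] iEl[of 1] ih[of ?l] l0[of i] by simp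
    also have "(LINT x|nu. \<eta> N x * (E (?l *\<^sub>R x) / p)) = (LINT x|nu. \<eta> N (s i *\<^sub>R x) * (E x / p))"
    proof -
      have "(\<lambda>x. \<eta> N (s i *\<^sub>R x) * (E x / p)) \<in> borel_measurable borel"
        using p by (intro borel_measurable_punctured continuous_intros continuous_on_dilation[OF sb(4) \<eta>c] E_cont) auto
      from integral_nu_dilation[OF this l0[of i]] show ?thesis using l0[of i] by (simp add: s_def)
    qed
    also have "\<dots> - (LINT x|nu. \<eta> N x * (E x / p)) = (LINT x|nu. (\<eta> N (s i *\<^sub>R x) - \<eta> N x) * (E x / p))"
      unfolding left_diff_distrib using iE[OF sb(1,2)[of i]] iE[of 1]
      by (intro Bochner_Integration.integral_diff[symmetric]) auto
    finally show ?thesis .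
  qed
  define ea where "ea i = (LINT x|nu. (\<eta> N (s i *\<^sub>R x) - \<eta> N x) / (s i - 1) * (E x / p))" for i
  define ub where "ub i = (LINT x|nu. (u (l i *\<^sub>R x) - u x) / (l i - 1) * h x)" for i
  have xs: "x \<bullet> V = norm x * (V \<bullet> sgn x)" for x V :: 'a
    by (cases "x = 0") (auto simp: sgn_div_norm inner_commute)
  have ea_lim: "ea \<longlonglongrightarrow> (LINT x|nu. \<eta>' N x * (E x / p))"
  proof -
    have "(\<lambda>i. (LINT x|nu. (\<eta> N (s i *\<^sub>R x) - \<eta> N x) / (s i - 1) * (E x / p)))
        \<longlonglongrightarrow> (LINT x|nu. (x \<bullet> ((\<eta>' N x / norm x) *\<^sub>R sgn x)) * (E x / p))"
    proof (rule integral_nu_dilation_quotient[OF cut, of _ "?a / 2" "2 * ?b"])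
      show "continuous_on (- {0}) (\<lambda>x. E x / p)" using p by (intro continuous_intros E_cont) auto
      fix x :: 'a and t :: real
      assume "1 / 2 \<le> t" "t \<le> 2" "(\<eta> N (t *\<^sub>R x) - \<eta> N x) * (E x / p) \<noteq> 0"
      then show "x \<in> shell (?a / 2) (2 * ?b)"
        using \<eta>supp'[of t x] \<eta>supp'[of 1 x] by (cases "\<eta> N x = 0") auto
    qed (use s_lim sb in auto)
    moreover have "x \<bullet> ((\<eta>' N x / norm x) *\<^sub>R sgn x) = \<eta>' N x" for x :: 'a
    proof (cases "x = 0")
      case False
      then show ?thesis using xs[of x "(\<eta>' N x / norm x) *\<^sub>R sgn x"] sgn_inner_self[OF False] by simp
    qed (simp add: cutoff'_def)
    ultimately show ?thesis unfolding ea_def[abs_def] by (simp only:)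
  qed
  have ub_lim: "ub \<longlonglongrightarrow> (LINT x|nu. (\<eta>' N x - \<kappa> * \<eta> N x) * Y x)"
  proof -
    have "(\<lambda>i. (LINT x|nu. (u (l i *\<^sub>R x) - u x) / (l i - 1) * h x))
        \<longlonglongrightarrow> (LINT x|nu. (x \<bullet> gradient u x) * h x)"
    proof (rule integral_nu_dilation_quotient[OF u_C1 hc, of ?a ?b])
      show "l i \<le> 2" for i using lb(2)[of i] by linarith
      show "x \<in> shell ?a ?b" if "(u (t *\<^sub>R x) - u x) * h x \<noteq> 0" for t and x :: 'a
        using hsupp[of x] that by simp
      show "1 / 2 \<le> l i" "l i \<noteq> 1" for i by (rule lb)+
    qed (simp_all add: l_lim)
    moreover have "(x \<bullet> gradient u x) * h x = (\<eta>' N x - \<kappa> * \<eta> N x) * Y x" for x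
      unfolding xs[of x "gradient u x"] by (simp add: h_def Y_def q_def)
    ultimately show ?thesis unfolding ub_def[abs_def] by (simp only:)
  qed
  have "0 \<le> \<sigma> * (ub i - s i * ea i)" for i
  proof -
    have 1: "(LINT x|nu. (u (l i *\<^sub>R x) - u x) * h x) = (l i - 1) * ub i"
      unfolding ub_def using lb(3)[of i] by (subst integral_mult_right_zero[symmetric]) simp
    have "(LINT x|nu. (\<eta> N (s i *\<^sub>R x) - \<eta> N x) * (E x / p)) = (s i - 1) * ea i"
      unfolding ea_def using sb(3)[of i] by (subst integral_mult_right_zero[symmetric]) simp
    \<comment> \<open>Dilating the energy by \<open>l\<close> dilates the cutoff by
      \<open>1 / l\<close>; this is the origin of the minus sign before the energy term.\<close>
    also have "s i - 1 = - (l i - 1) * s i" using l0[of i] by (simp add: s_def field_simps)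
    finally have "0 \<le> (l i - 1) * (ub i - s i * ea i)" using key[of i] 1 by (simp add: algebra_simps)
    then have "0 \<le> \<sigma> / (real i + 2) * (ub i - s i * ea i)" by (simp add: l_def)
    then show ?thesis by (simp add: zero_le_divide_iff)
  qed
  moreover have "(\<lambda>i. \<sigma> * (ub i - s i * ea i)) \<longlonglongrightarrow>
    \<sigma> * ((LINT x|nu. (\<eta>' N x - \<kappa> * \<eta> N x) * Y x) - 1 * (LINT x|nu. \<eta>' N x * (E x / p)))"
    by (intro tendsto_intros ea_lim ub_lim s_lim)
  ultimately show ?thesis using LIMSEQ_le_const by fastforce
qed

text \<open>The side \<sigma> in \<open>pohozaev\<close> is the sign of \<kappa>. Because of the
  factor \<open>1 / N\<close>, linear growth of the energy bounds the integral of \<open>Y\<close>,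
  and sublinear growth makes it vanish.\<close>

lemma Y_integral_le:
  assumes N: "0 < N"
  shows "\<bar>\<kappa>\<bar> * (LINT x|nu. \<eta> N x * Y x) \<le> 4 * real m / N * (LINT x|nu. \<eta> (2 * N) x * E x)"
proof -
  define \<sigma> :: real where "\<sigma> = (if \<kappa> \<ge> 0 then 1 else -1)"
  have \<sigma>: "\<sigma> = 1 \<or> \<sigma> = -1" "\<sigma> * \<kappa> = \<bar>\<kappa>\<bar>" by (auto simp: \<sigma>_def)
  have Ep: "continuous_on (- {0}) (\<lambda>x. E x / p)" using p by (intro continuous_intros E_cont) auto
  note i = integrable_\<eta>[OF N Y_cont] integrable_\<eta>[OF N Ep]
  have i2: "integrable nu (\<lambda>x. \<eta> (2 * N) x * E x)" using N by (intro integrable_\<eta> E_cont) auto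
  have "0 \<le> \<sigma> * ((LINT x|nu. (\<eta>' N x - \<kappa> * \<eta> N x) * Y x) - (LINT x|nu. \<eta>' N x * (E x / p)))"
    by (rule pohozaev[OF N \<sigma>(1)])
  also have "(LINT x|nu. (\<eta>' N x - \<kappa> * \<eta> N x) * Y x)
    = (LINT x|nu. \<eta>' N x * Y x) - \<kappa> * (LINT x|nu. \<eta> N x * Y x)"
    using i by (simp add: left_diff_distrib mult.assoc)
  finally have "\<bar>\<kappa>\<bar> * (LINT x|nu. \<eta> N x * Y x)
      \<le> \<sigma> * ((LINT x|nu. \<eta>' N x * Y x) - (LINT x|nu. \<eta>' N x * (E x / p)))"
    unfolding \<sigma>(2)[symmetric] by (simp add: algebra_simps)
  also have "\<dots> = (LINT x|nu. \<sigma> * (\<eta>' N x * Y x - \<eta>' N x * (E x / p)))"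
    using i by simp
  also have "\<dots> \<le> (LINT x|nu. 4 * real m / N * (\<eta> (2 * N) x * E x))"
  proof (rule integral_mono)
    fix x :: 'a
    show "\<sigma> * (\<eta>' N x * Y x - \<eta>' N x * (E x / p)) \<le> 4 * real m / N * (\<eta> (2 * N) x * E x)"
    proof (cases "\<eta>' N x = 0")
      case True
      then show ?thesis using N E_nonneg[of x] cutoff_bounds[of m "2 * N" "2 * N" x] by simp
    next
      case False
      then have "x \<in> shell (exp (- (N + N))) (exp (N + N))" using cutoff'_supp_shell[OF N N m(1)] by blast
      \<comment> \<open>The collars of \<open>\<eta> N\<close> end where the plateau of
        \<open>\<eta> (2 * N)\<close> ends.\<close>
      then have 1: "\<eta> (2 * N) x = 1" using N cutoff_eq_1[of "2 * N" x "2 * N" m] by simp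
      have "E x / p \<le> E x / 1" using p E_nonneg[of x] by (intro divide_left_mono) auto
      moreover have "0 \<le> E x / p" using p E_nonneg[of x] by simp
      ultimately have "\<bar>Y x - E x / p\<bar> \<le> 2 * E x"
        using Y_nonneg[of x] Y_le_E[of x] unfolding abs_le_iff by linarith
      then have "\<bar>\<eta>' N x\<bar> * \<bar>Y x - E x / p\<bar> \<le> (2 * real m / N) * (2 * E x)"
        using cutoff'_le[OF N N m(1), of x] N by (intro mult_mono) auto
      moreover have "\<sigma> * (\<eta>' N x * Y x - \<eta>' N x * (E x / p)) \<le> \<bar>\<eta>' N x\<bar> * \<bar>Y x - E x / p\<bar>"
      proof -
        have "\<sigma> * (\<eta>' N x * Y x - \<eta>' N x * (E x / p)) = \<sigma> * (\<eta>' N x * (Y x - E x / p))"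
          by (simp only: right_diff_distrib)
        also have "\<dots> \<le> \<bar>\<eta>' N x * (Y x - E x / p)\<bar>" using \<sigma>(1) by auto
        finally show ?thesis unfolding abs_mult .
      qed
      ultimately show ?thesis using 1 by simp
    qed
  qed (use i i2 in auto)
  finally show ?thesis by simp
qed

section \<open>Vanishing of the energy\<close>

lemma shell_measure_linear:
  obtains D where "0 \<le> D"
    "\<And>k. 1 \<le> k \<Longrightarrow> measure nu (shell (exp (- (real k + real k))) (exp (real k + real k)) :: 'a set) \<le> D * real k"
proof (rule that)
  let ?D = "4 * measure nu (shell 1 (exp 1) :: 'a set) + measure nu (shell 1 1 :: 'a set)"
  show "0 \<le> ?D" by simp
  fix k :: nat assume k: "1 \<le> k"
  have "measure nu (shell (exp (- (real k + real k))) (exp (real k + real k)) :: 'a set)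
    \<le> 4 * real k * measure nu (shell 1 (exp 1) :: 'a set) + measure nu (shell 1 1 :: 'a set)"
    using measure_nu_shell_linear[of "2 * k", where 'a = 'a] by simp
  also have "\<dots> \<le> 4 * real k * measure nu (shell 1 (exp 1) :: 'a set) + real k * measure nu (shell 1 1 :: 'a set)"
    using k mult_right_mono[of 1 "real k" "measure nu (shell 1 1 :: 'a set)"] by simp
  finally show "measure nu (shell (exp (- (real k + real k))) (exp (real k + real k)) :: 'a set) \<le> ?D * real k"
    by (simp add: algebra_simps)
qed

lemma eventually_positive:
  assumes f: "continuous_on (- {0}) f" "\<And>x. 0 \<le> f x" and x0: "x0 \<noteq> 0" "f x0 \<noteq> 0"
  obtains c k0 where "0 < c" "\<And>k. k0 \<le> k \<Longrightarrow> 1 \<le> k \<Longrightarrow> c \<le> (LINT x|nu. \<eta> (real k) x * f x)"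
proof -
  have "0 < f x0" using f(2)[of x0] x0(2) by simp
  then obtain c S where c: "0 < c" "0 < S"
    "\<And>g. integrable nu g \<Longrightarrow> (\<And>x. 0 \<le> g x) \<Longrightarrow>
      (\<And>x. x \<in> shell (exp (- S)) (exp S) \<Longrightarrow> f x \<le> g x) \<Longrightarrow> c \<le> integral\<^sup>L nu g"
    using nu_integral_lower_bound[OF f(1) x0(1)] by metis
  show ?thesis
  proof (rule that[OF c(1)])
    fix k :: nat assume k: "nat \<lceil>S\<rceil> \<le> k" "1 \<le> k"
    show "c \<le> (LINT x|nu. \<eta> (real k) x * f x)"
    proof (rule c(3))
      show "integrable nu (\<lambda>x. \<eta> (real k) x * f x)" using k f by (intro integrable_\<eta>) auto
      show "0 \<le> \<eta> (real k) x * f x" for x by (intro mult_nonneg_nonneg cutoff_bounds f(2))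
      fix x :: 'a assume x: "x \<in> shell (exp (- S)) (exp S)"
      have "S \<le> real k" using k by linarith
      then have "exp (- real k) \<le> exp (- S)" "exp S \<le> exp (real k)" by auto
      then have "x \<in> shell (exp (- real k)) (exp (real k))"
        using x unfolding shell_def mem_Collect_eq by linarith
      then show "f x \<le> \<eta> (real k) x * f x" using k by (simp add: cutoff_eq_1)
    qed
  qed
qed

lemma inverse_powr_tendsto: "(\<lambda>k. B * real k powr (1 - p)) \<longlonglongrightarrow> 0"
proof -
  have "(\<lambda>k. real k powr (1 - p)) \<longlonglongrightarrow> 0"
    using p by (intro tendsto_neg_powr filterlim_real_sequentially) auto
  from tendsto_mult_right_zero[OF this] show ?thesis .
qed

text \<open>Without drift only the collar term remains in the Caccioppoli estimate; it is of order
  \<open>N powr (- p)\<close> times \<open>N\<close>, which tends to 0 because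
  \<open>p > 1\<close>.\<close>

lemma E_zero_if_\<kappa>_zero:
  assumes \<kappa>: "\<kappa> = 0" and "x \<noteq> 0"
  shows "E x = 0"
proof (rule ccontr)
  assume "E x \<noteq> 0"
  then obtain c k0 where c: "0 < c" "\<And>k. k0 \<le> k \<Longrightarrow> 1 \<le> k \<Longrightarrow> c \<le> (LINT x|nu. \<eta> (real k) x * E x)"
    using eventually_positive[OF E_cont E_nonneg \<open>x \<noteq> 0\<close>] by metis
  obtain D where D: "0 \<le> D"
    "\<And>k. 1 \<le> k \<Longrightarrow> measure nu (shell (exp (- (real k + real k))) (exp (real k + real k)) :: 'a set) \<le> D * real k"
    by (rule shell_measure_linear) auto
  define B where "B = 2 * ((2 * real m * c2) powr p * (1 / 4) powr (1 - p)) * D"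
  have "c \<le> B * real k powr (1 - p)" if k: "k0 \<le> k" "1 \<le> k" for k
  proof -
    have "c \<le> 2 * ((2 * real m * c2 / real k) powr p * (1 / 4) powr (1 - p)) * (D * real k)"
      using c(2)[OF k] energy_growth[of "real k"] k D(2)[OF k(2)] \<kappa> c2_pos
        mult_left_mono[OF D(2)[OF k(2)], of "2 * ((2 * real m * c2 / real k) powr p * (1 / 4) powr (1 - p))"]
      by simp
    also have "\<dots> = B * (real k * real k powr - p)"
      using k c2_pos by (simp add: B_def powr_divide powr_minus_divide field_simps)
    also have "real k * real k powr - p = real k powr (1 - p)"
      using k powr_add[of "real k" 1 "- p"] by simp
    finally show ?thesis .
  qed
  then have "c \<le> 0"
    by (intro tendsto_lowerbound[OF inverse_powr_tendsto[of B]])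
      (auto intro!: exI[of _ "max k0 1"] simp: eventually_sequentially)
  with c(1) show False by simp
qed

text \<open>Bootstrap: linear growth of the energy bounds the integral of \<open>Y\<close> through
  \<open>Y_integral_le\<close>; inserting \<open>A_le_eps\<close> into \<open>energy_le\<close> then
  leaves an arbitrarily small linear part, a decaying part and a constant.\<close>

lemma energy_sublinear:
  assumes \<kappa>: "\<kappa> \<noteq> 0" and "0 < \<epsilon>"
  obtains k0 where "\<And>k. k0 \<le> k \<Longrightarrow> 1 \<le> k \<Longrightarrow> (LINT x|nu. \<eta> (real k) x * E x) \<le> \<epsilon> * real k"
proof -
  define e where "e k = (LINT x|nu. \<eta> (real k) x * E x)" for k :: nat
  define y where "y k = (LINT x|nu. \<eta> (real k) x * Y x)" for k :: nat
  obtain D where D: "0 \<le> D"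
    "\<And>k. 1 \<le> k \<Longrightarrow> measure nu (shell (exp (- (real k + real k))) (exp (real k + real k)) :: 'a set) \<le> D * real k"
    by (rule shell_measure_linear) auto
  define K where "K = (2 * real m * c2) powr p * (1 / 4) powr (1 - p)"
  define C where "C = 2 * ((\<bar>\<kappa>\<bar> * c2) powr p * (1 / 4) powr (1 - p) + K) * D"
  have K: "0 \<le> K" by (simp add: K_def)
  have K': "(2 * real m * c2 / real k) powr p * (1 / 4) powr (1 - p) = K * real k powr - p" if "1 \<le> k" for k
    using that c2_pos by (simp add: K_def powr_divide powr_minus_divide)
  have C: "e k \<le> C * real k" if k: "1 \<le> k" for k
  proof -
    have "K * real k powr - p \<le> K * 1"
      using k p K powr_mono[of "- p" 0 "real k"] by (intro mult_left_mono) auto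
    then have "e k \<le> 2 * ((\<bar>\<kappa>\<bar> * c2) powr p * (1 / 4) powr (1 - p) + K) * (D * real k)"
      unfolding e_def using k D K
      by (intro order_trans[OF energy_growth]) (auto simp: K' K_def[symmetric] intro!: mult_mono)
    then show ?thesis by (simp add: C_def)
  qed
  have y: "y k \<le> 8 * real m * C / \<bar>\<kappa>\<bar>" if k: "1 \<le> k" for k
  proof -
    have "\<bar>\<kappa>\<bar> * y k \<le> 4 * real m / real k * e (2 * k)"
      unfolding y_def e_def using Y_integral_le[of "real k"] k by simp
    also have "\<dots> \<le> 4 * real m / real k * (C * real (2 * k))"
      using k C[of "2 * k"] by (intro mult_left_mono) auto
    also have "\<dots> = 8 * real m * C" using k by simp
    finally show ?thesis using \<kappa> by (simp add: field_simps)
  qed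
  have kc: "0 < \<bar>\<kappa>\<bar> * c2" using \<kappa> c2_pos by simp
  \<comment> \<open>The first entry meets the coefficient \<open>1 / 4\<close> demanded by
    \<open>energy_le\<close>; the second makes the linear part at most \<open>\<epsilon> / 4\<close>
    times \<open>k\<close>.\<close>
  define s where "s = min (1 / 4) (\<epsilon> / (8 * (D + 1))) / (\<bar>\<kappa>\<bar> * c2)"
  have "\<bar>\<kappa>\<bar> * c2 * s = min (1 / 4) (\<epsilon> / (8 * (D + 1)))"
    unfolding s_def times_divide_eq_right using kc by (intro nonzero_mult_div_cancel_left) linarith
  moreover have "0 < s" unfolding s_def using kc \<open>0 < \<epsilon>\<close> D(1) by (intro divide_pos_pos) auto
  ultimately have s: "0 < s" "\<bar>\<kappa>\<bar> * c2 * s \<le> 1 / 4" "\<bar>\<kappa>\<bar> * c2 * s \<le> \<epsilon> / (8 * (D + 1))"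
    using min.cobounded1[of "1 / 4" "\<epsilon> / (8 * (D + 1))"] min.cobounded2[of "1 / 4" "\<epsilon> / (8 * (D + 1))"]
    by linarith+
  have sD: "2 * (\<bar>\<kappa>\<bar> * c2 * s) * D \<le> \<epsilon> / 4"
  proof -
    have "2 * (\<bar>\<kappa>\<bar> * c2 * s) * D \<le> 2 * (\<epsilon> / (8 * (D + 1))) * D"
      using s(3) D(1) by (intro mult_right_mono mult_left_mono) auto
    also have "\<dots> \<le> \<epsilon> / 4" using D(1) \<open>0 < \<epsilon>\<close> by (simp add: field_simps)
    finally show ?thesis .
  qed
  obtain Cs where Cs: "0 \<le> Cs" "\<And>x. \<bar>A x\<bar> \<le> s * (1 + E x) + Cs * Y x"
    using A_le_eps[OF s(1)] by metis
  define L where "L = 2 * (\<bar>\<kappa>\<bar> * c2 * Cs) * (8 * real m * C / \<bar>\<kappa>\<bar>)"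
  have main: "e k \<le> \<epsilon> / 4 * real k + (2 * K * D) * real k powr (1 - p) + L" if k: "1 \<le> k" for k
  proof -
    let ?N = "real k"
    let ?S = "shell (exp (- (?N + ?N))) (exp (?N + ?N)) :: 'a set"
    have N: "0 < ?N" using k by simp
    have "e k \<le> 2 * ((\<bar>\<kappa>\<bar> * c2 * s + (2 * real m * c2 / ?N) powr p * (1 / 4) powr (1 - p)) * measure nu ?S
      + (LINT x|nu. \<eta> ?N x * (\<bar>\<kappa>\<bar> * c2 * Cs * Y x)))"
      unfolding e_def
    proof (rule energy_le[OF N])
      show "0 \<le> \<bar>\<kappa>\<bar> * c2 * s" using kc s by simp
      show "continuous_on (- {0}) (\<lambda>x. \<bar>\<kappa>\<bar> * c2 * Cs * Y x)" by (intro continuous_intros Y_cont)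
      show "0 \<le> \<bar>\<kappa>\<bar> * c2 * Cs * Y x" for x using kc Cs(1) Y_nonneg[of x] by simp
      fix x :: 'a
      show "\<bar>\<kappa>\<bar> * c2 * (\<eta> ?N x * \<bar>A x\<bar>) \<le> 1 / 4 * (\<eta> ?N x * E x) + \<bar>\<kappa>\<bar> * c2 * s * indicator ?S x
          + \<eta> ?N x * (\<bar>\<kappa>\<bar> * c2 * Cs * Y x)"
      proof (cases "\<eta> ?N x = 0")
        case False
        then have xS: "x \<in> ?S" using cutoff_supp[OF N, of m ?N x] m by auto
        have \<eta>: "0 \<le> \<eta> ?N x" "\<eta> ?N x \<le> 1" by (rule cutoff_bounds)+
        have 1: "\<bar>\<kappa>\<bar> * c2 * (\<eta> ?N x * \<bar>A x\<bar>) \<le> \<bar>\<kappa>\<bar> * c2 * (\<eta> ?N x * (s * (1 + E x) + Cs * Y x))"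
          using kc \<eta> Cs(2) by (intro mult_left_mono) auto
        have 2: "\<bar>\<kappa>\<bar> * c2 * s * (\<eta> ?N x * E x) \<le> 1 / 4 * (\<eta> ?N x * E x)"
          using s \<eta> E_nonneg[of x] by (intro mult_right_mono) auto
        have 3: "\<bar>\<kappa>\<bar> * c2 * s * \<eta> ?N x \<le> \<bar>\<kappa>\<bar> * c2 * s * 1"
          using s kc \<eta> by (intro mult_left_mono) auto
        have "\<bar>\<kappa>\<bar> * c2 * (\<eta> ?N x * (s * (1 + E x) + Cs * Y x))
          = \<bar>\<kappa>\<bar> * c2 * s * \<eta> ?N x + \<bar>\<kappa>\<bar> * c2 * s * (\<eta> ?N x * E x) + \<eta> ?N x * (\<bar>\<kappa>\<bar> * c2 * Cs * Y x)"
          by (simp add: algebra_simps)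
        then show ?thesis using 1 2 3 xS by simp
      qed (use kc s in simp)
    qed
    also have "(LINT x|nu. \<eta> ?N x * (\<bar>\<kappa>\<bar> * c2 * Cs * Y x)) = \<bar>\<kappa>\<bar> * c2 * Cs * y k"
    proof -
      have "(\<lambda>x. \<eta> ?N x * (\<bar>\<kappa>\<bar> * c2 * Cs * Y x)) = (\<lambda>x. (\<bar>\<kappa>\<bar> * c2 * Cs) * (\<eta> ?N x * Y x))" by (auto simp: mult_ac)
      then show ?thesis unfolding y_def by (simp only: integral_mult_right_zero)
    qed
    also have "2 * ((\<bar>\<kappa>\<bar> * c2 * s + (2 * real m * c2 / ?N) powr p * (1 / 4) powr (1 - p)) * measure nu ?S
        + \<bar>\<kappa>\<bar> * c2 * Cs * y k)
      \<le> 2 * ((\<bar>\<kappa>\<bar> * c2 * s + K * real k powr - p) * (D * real k) + \<bar>\<kappa>\<bar> * c2 * Cs * (8 * real m * C / \<bar>\<kappa>\<bar>))"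
      unfolding K'[OF k] using D(2)[OF k] y[OF k] kc s Cs K
      by (intro mult_left_mono add_mono) auto
    also have "\<dots> = 2 * (\<bar>\<kappa>\<bar> * c2 * s) * D * real k + 2 * K * D * (real k * real k powr - p) + L"
      by (simp add: L_def algebra_simps)
    also have "real k * real k powr - p = real k powr (1 - p)"
      using k powr_add[of "real k" 1 "- p"] by simp
    also have "2 * (\<bar>\<kappa>\<bar> * c2 * s) * D * real k + 2 * K * D * real k powr (1 - p) + L
        \<le> \<epsilon> / 4 * real k + 2 * K * D * real k powr (1 - p) + L"
      using sD by (intro add_right_mono mult_right_mono) auto
    finally show ?thesis .
  qed
  have "\<forall>\<^sub>F k in sequentially. (2 * K * D) * real k powr (1 - p) < 1"
    using inverse_powr_tendsto by (rule order_tendstoD) simp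
  then obtain k1 where k1: "\<And>k. k1 \<le> k \<Longrightarrow> (2 * K * D) * real k powr (1 - p) < 1"
    by (auto simp: eventually_sequentially)
  show ?thesis
  \<comment> \<open>From here on the decaying part is below 1, and \<open>1 + \<bar>L\<bar>\<close>
    fits into the remaining \<open>3 / 4 * \<epsilon> * k\<close>.\<close>
  proof (rule that[of "max k1 (nat \<lceil>4 * (1 + \<bar>L\<bar>) / (3 * \<epsilon>)\<rceil>)"])
    fix k assume k: "max k1 (nat \<lceil>4 * (1 + \<bar>L\<bar>) / (3 * \<epsilon>)\<rceil>) \<le> k" "1 \<le> k"
    then have "4 * (1 + \<bar>L\<bar>) / (3 * \<epsilon>) \<le> real k" by linarith
    then have "1 + \<bar>L\<bar> \<le> 3 * \<epsilon> / 4 * real k" using \<open>0 < \<epsilon>\<close> by (simp add: field_simps)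
    moreover have "(2 * K * D) * real k powr (1 - p) < 1" using k k1 by auto
    ultimately show "(LINT x|nu. \<eta> (real k) x * E x) \<le> \<epsilon> * real k"
      using main[OF k(2)] unfolding e_def by linarith
  qed
qed

lemma Y_zero:
  assumes \<kappa>: "\<kappa> \<noteq> 0" and "x \<noteq> 0"
  shows "Y x = 0"
proof (rule ccontr)
  assume "Y x \<noteq> 0"
  then obtain c k0 where c: "0 < c" "\<And>k. k0 \<le> k \<Longrightarrow> 1 \<le> k \<Longrightarrow> c \<le> (LINT x|nu. \<eta> (real k) x * Y x)"
    using eventually_positive[OF Y_cont Y_nonneg \<open>x \<noteq> 0\<close>] by metis
  \<comment> \<open>Chosen so that the bound \<open>8 * m * \<epsilon>\<close> for |\<kappa>| times
    the integral of \<open>Y\<close> is half of its lower bound.\<close>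
  define \<epsilon> where "\<epsilon> = \<bar>\<kappa>\<bar> * c / (16 * real m)"
  have "0 < \<epsilon>" using \<kappa> c m by (auto simp: \<epsilon>_def intro!: divide_pos_pos mult_pos_pos)
  then obtain k1 where k1: "\<And>k. k1 \<le> k \<Longrightarrow> 1 \<le> k \<Longrightarrow> (LINT x|nu. \<eta> (real k) x * E x) \<le> \<epsilon> * real k"
    using energy_sublinear[OF \<kappa>] by metis
  define k where "k = max k0 (max k1 1)"
  have k: "k0 \<le> k" "k1 \<le> 2 * k" "1 \<le> k" by (auto simp: k_def)
  have "\<bar>\<kappa>\<bar> * c \<le> \<bar>\<kappa>\<bar> * (LINT x|nu. \<eta> (real k) x * Y x)"
    using c(2)[OF k(1,3)] by (intro mult_left_mono) auto
  also have "\<dots> \<le> 4 * real m / real k * (LINT x|nu. \<eta> (2 * real k) x * E x)"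
    using k by (intro Y_integral_le) auto
  also have "\<dots> \<le> 4 * real m / real k * (\<epsilon> * real (2 * k))"
    using k1[of "2 * k"] k by (intro mult_left_mono) auto
  also have "\<dots> = 8 * real m * \<epsilon>" using k by simp
  also have "\<dots> = \<bar>\<kappa>\<bar> * c / 2" using m by (simp add: \<epsilon>_def)
  finally show False using \<kappa> c by simp
qed

lemma E_zero:
  assumes "x \<noteq> 0"
  shows "E x = 0"
proof (cases "\<kappa> = 0")
  case False
  show ?thesis
  proof (rule ccontr)
    assume "E x \<noteq> 0"
    then obtain c k0 where c: "0 < c" "\<And>k. k0 \<le> k \<Longrightarrow> 1 \<le> k \<Longrightarrow> c \<le> (LINT x|nu. \<eta> (real k) x * E x)"
      using eventually_positive[OF E_cont E_nonneg assms] by metis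
    define k where "k = max k0 1"
    have N: "0 < real k" by (simp add: k_def)
    \<comment> \<open>With vanishing radial flux, both other terms of the Caccioppoli identity
      disappear.\<close>
    have A0: "A x = 0" if "x \<noteq> 0" for x using A_eq_0 Y_zero[OF False that] by blast
    have "\<eta> (real k) x * E x + \<eta>' (real k) x * (u x * A x) - \<kappa> * (\<eta> (real k) x * (u x * A x)) = \<eta> (real k) x * E x" for x
      using A0[of x] by (cases "x = 0") (auto simp: cutoff_def cutoff'_def)
    then have "(LINT x|nu. \<eta> (real k) x * E x) = 0"
      using caccioppoli_identity[OF N] by (simp only:)
    with c(1) c(2)[of k] show False by (simp add: k_def)
  qed
qed (use E_zero_if_\<kappa>_zero assms in auto)

end

lemma gradient_u_zero:
  assumes "x \<noteq> 0"
  shows "gradient u x = 0"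
proof -
  \<comment> \<open>The cutoff power must be at least 2 for differentiability and at least
    \<open>p\<close> for absorption.\<close>
  obtain m :: nat where "p \<le> real m" using real_arch_simple by blast
  then have "max m 2 \<ge> 2" "real (max m 2) \<ge> p" by auto
  then have "E x = 0" using E_zero assms by blast
  then show ?thesis using assms by (simp add: E_def q_def)
qed

end

section \<open>A Poincare inequality on cubical shells\<close>

text \<open>A double integral rather than a distance to the mean: it is monotone in both sets and
  inherits the triangle inequality, on which chaining rests. Values in \<open>ennreal\<close> avoid
  integrability conditions.\<close>

definition osc :: "('a::euclidean_space \<Rightarrow> real) \<Rightarrow> 'a set \<Rightarrow> 'a set \<Rightarrow> ennreal" where
  "osc w X Y = (\<integral>\<^sup>+x. indicator X x * (\<integral>\<^sup>+y. indicator Y y * ennreal \<bar>w x - w y\<bar> \<partial>lborel) \<partial>lborel)"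

lemma nn_integral_lborel_affine:
  fixes f :: "'a::euclidean_space \<Rightarrow> ennreal"
  assumes [measurable]: "f \<in> borel_measurable borel" and c: "c \<noteq> 0"
  shows "(\<integral>\<^sup>+x. f x \<partial>lborel) = ennreal (\<bar>c\<bar> ^ DIM('a)) * (\<integral>\<^sup>+x. f (t + c *\<^sub>R x) \<partial>lborel)"
  by (subst lborel_affine[OF c, of t])
    (simp add: nn_integral_density nn_integral_distr nn_integral_cmult ennreal_power)

lemma difference_le_segment_integral:
  fixes w :: "'a::euclidean_space \<Rightarrow> real"
  assumes w: "C1_punctured w G" and seg: "\<And>s. s \<in> {0..1} \<Longrightarrow> x + s *\<^sub>R (y - x) \<noteq> 0"
  shows "ennreal \<bar>w y - w x\<bar> \<le> (\<integral>\<^sup>+s. indicator {0..1} s * ennreal (norm (G (x + s *\<^sub>R (y - x))) * norm (y - x)) \<partial>lborel)"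
proof -
  let ?f = "\<lambda>s. (y - x) \<bullet> G (x + s *\<^sub>R (y - x))"
  have fc: "continuous_on {0..1} ?f"
    using seg by (intro continuous_intros continuous_on_compose2[OF C1_punctured_continuous_gradient[OF w]]) auto
  have d: "((\<lambda>s. w (x + s *\<^sub>R (y - x))) has_vector_derivative ?f s) (at s within {0..1})" if "0 \<le> s" "s \<le> 1" for s
  proof -
    have 1: "((\<lambda>s. x + s *\<^sub>R (y - x)) has_derivative (\<lambda>h. h *\<^sub>R (y - x))) (at s)"
      by (auto intro!: derivative_eq_intros)
    have "GDERIV w (x + s *\<^sub>R (y - x)) :> G (x + s *\<^sub>R (y - x))"
      using seg[of s] that by (intro C1_punctured_gderiv[OF w]) auto
    from has_derivative_compose[OF 1 this[unfolded gderiv_def]]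
    have "((\<lambda>s. w (x + s *\<^sub>R (y - x))) has_vector_derivative ?f s) (at s)"
      by (simp add: has_vector_derivative_def)
    then show ?thesis by (rule has_vector_derivative_at_within)
  qed
  have int: "integrable lborel (\<lambda>s. indicator {0..1} s *\<^sub>R ?f s)"
    by (intro borel_integrable_compact fc) auto
  have "w y - w x = (LINT s|lborel. indicator {0..1} s *\<^sub>R ?f s)"
    using integral_FTC_atLeastAtMost[of 0 1, OF _ d fc] by simp
  then have "ennreal \<bar>w y - w x\<bar> \<le> (\<integral>\<^sup>+s. ennreal (norm (indicator {0..1} s *\<^sub>R ?f s)) \<partial>lborel)"
    using integral_norm_bound_ennreal[OF int] by simp
  also have "\<dots> \<le> (\<integral>\<^sup>+s. indicator {0..1} s * ennreal (norm (G (x + s *\<^sub>R (y - x))) * norm (y - x)) \<partial>lborel)"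
  proof (rule nn_integral_mono)
    fix s :: real
    have "\<bar>?f s\<bar> \<le> norm (y - x) * norm (G (x + s *\<^sub>R (y - x)))" by (rule Cauchy_Schwarz_ineq2)
    then show "ennreal (norm (indicator {0..1} s *\<^sub>R ?f s)) \<le> indicator {0..1} s * ennreal (norm (G (x + s *\<^sub>R (y - x))) * norm (y - x))"
      by (auto simp: indicator_def mult.commute intro!: ennreal_leI)
  qed
  finally show ?thesis .
qed

lemma nn_integral_segment_point_le:
  fixes g :: "'a::euclidean_space \<Rightarrow> ennreal"
  assumes [measurable]: "g \<in> borel_measurable borel" and s: "1 / 2 \<le> s"
  shows "(\<integral>\<^sup>+y. g (t + s *\<^sub>R y) \<partial>lborel) \<le> ennreal (2 ^ DIM('a)) * (\<integral>\<^sup>+z. g z \<partial>lborel)"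
proof -
  have s0: "s \<noteq> 0" using s by auto
  have "1 ^ DIM('a) \<le> (2 * s) ^ DIM('a)" using s by (intro power_mono) auto
  then have "1 \<le> ennreal (2 ^ DIM('a)) * ennreal (\<bar>s\<bar> ^ DIM('a))"
    using s by (simp add: power_mult_distrib ennreal_mult'[symmetric] ennreal_leI[of 1, simplified])
  then have "1 * (\<integral>\<^sup>+y. g (t + s *\<^sub>R y) \<partial>lborel)
      \<le> ennreal (2 ^ DIM('a)) * ennreal (\<bar>s\<bar> ^ DIM('a)) * (\<integral>\<^sup>+y. g (t + s *\<^sub>R y) \<partial>lborel)"
    by (intro mult_right_mono) auto
  then show ?thesis
    unfolding nn_integral_lborel_affine[OF assms(1) s0, of t] by (simp add: mult.assoc)
qed

text \<open>Only the endpoint farther from the point \<open>x + s (y - x)\<close> is fixed in the change of variables, so that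
  its Jacobian is at least \<open>2\<^sup>-\<^sup>n\<close>.\<close>

lemma osc_convex_le:
  fixes w :: "'a::euclidean_space \<Rightarrow> real"
  assumes K: "compact K" "convex K" "0 \<notin> K" and w: "C1_punctured w G"
    and d: "0 \<le> d" "\<And>x y. x \<in> K \<Longrightarrow> y \<in> K \<Longrightarrow> norm (y - x) \<le> d"
  shows "osc w K K \<le> ennreal (d * 2 ^ DIM('a) * measure lborel K) * (\<integral>\<^sup>+z. indicator K z * ennreal (norm (G z)) \<partial>lborel)"
proof -
  define g where "g z = indicator K z * ennreal (norm (G z))" for z
  have Km [measurable]: "K \<in> sets borel" using K(1) by (rule borel_compact)
  have "(\<lambda>z. norm (G z)) \<in> borel_measurable borel"
    by (intro borel_measurable_punctured continuous_intros C1_punctured_continuous_gradient[OF w])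
  then have gm [measurable]: "g \<in> borel_measurable borel" unfolding g_def by measurable
  have wm [measurable]: "w \<in> borel_measurable borel"
    by (rule borel_measurable_punctured[OF C1_punctured_continuous[OF w]])
  define f :: "'a \<Rightarrow> 'a \<Rightarrow> real \<Rightarrow> ennreal"
    where "f x y s = indicator K x * indicator K y * indicator {0..1} s * g (x + s *\<^sub>R (y - x))" for x y s
  have emK: "emeasure lborel K = ennreal (measure lborel K)"
    using emeasure_compact_finite[OF K(1)] by (intro emeasure_eq_ennreal_measure) auto
  let ?J = "\<integral>\<^sup>+z. g z \<partial>lborel"
  let ?c = "ennreal (2 ^ DIM('a))"
  have "osc w K K = (\<integral>\<^sup>+x. \<integral>\<^sup>+y. indicator K x * indicator K y * ennreal \<bar>w x - w y\<bar> \<partial>lborel \<partial>lborel)"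
    unfolding osc_def by (simp add: nn_integral_cmult[symmetric] mult.assoc)
  also have "\<dots> \<le> (\<integral>\<^sup>+x. \<integral>\<^sup>+y. ennreal d * (\<integral>\<^sup>+s. f x y s \<partial>lborel) \<partial>lborel \<partial>lborel)"
  proof (intro nn_integral_mono)
    fix x y :: 'a
    show "indicator K x * indicator K y * ennreal \<bar>w x - w y\<bar> \<le> ennreal d * (\<integral>\<^sup>+s. f x y s \<partial>lborel)"
    proof (cases "x \<in> K \<and> y \<in> K")
      case True
      have seg: "x + s *\<^sub>R (y - x) \<in> K" if "s \<in> {0..1}" for s
      proof -
        have "(1 - s) *\<^sub>R x + s *\<^sub>R y \<in> K" using True that K(2) by (auto intro: convexD)
        then show ?thesis by (simp add: algebra_simps)
      qed
      have "ennreal \<bar>w x - w y\<bar> = ennreal \<bar>w y - w x\<bar>" by (simp add: abs_minus_commute)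
      also have "\<dots> \<le> (\<integral>\<^sup>+s. indicator {0..1} s * ennreal (norm (G (x + s *\<^sub>R (y - x))) * norm (y - x)) \<partial>lborel)"
        using seg K(3) by (intro difference_le_segment_integral[OF w]) metis
      also have "\<dots> \<le> (\<integral>\<^sup>+s. ennreal d * f x y s \<partial>lborel)"
      proof (rule nn_integral_mono)
        fix s :: real
        show "indicator {0..1} s * ennreal (norm (G (x + s *\<^sub>R (y - x))) * norm (y - x)) \<le> ennreal d * f x y s"
        proof (cases "s \<in> {0..1}")
          case s: True
          have "norm (G (x + s *\<^sub>R (y - x))) * norm (y - x) \<le> norm (G (x + s *\<^sub>R (y - x))) * d"
            using True d by (intro mult_left_mono) auto
          then show ?thesis using s True seg[OF s] d(1)
            by (simp add: f_def g_def ennreal_mult'[symmetric] mult.commute ennreal_leI)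
        qed simp
      qed
      also have "\<dots> = ennreal d * (\<integral>\<^sup>+s. f x y s \<partial>lborel)"
        unfolding f_def by (rule nn_integral_cmult) measurable
      finally show ?thesis using True by simp
    qed auto
  qed
  also have "\<dots> = ennreal d * (\<integral>\<^sup>+x. \<integral>\<^sup>+y. \<integral>\<^sup>+s. f x y s \<partial>lborel \<partial>lborel \<partial>lborel)"
    unfolding f_def by (simp add: nn_integral_cmult)
  also have "(\<integral>\<^sup>+x. \<integral>\<^sup>+y. \<integral>\<^sup>+s. f x y s \<partial>lborel \<partial>lborel \<partial>lborel) = (\<integral>\<^sup>+x. \<integral>\<^sup>+s. \<integral>\<^sup>+y. f x y s \<partial>lborel \<partial>lborel \<partial>lborel)"
    unfolding f_def by (intro nn_integral_cong lborel_pair.Fubini') measurable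
  also have "\<dots> = (\<integral>\<^sup>+s. \<integral>\<^sup>+x. \<integral>\<^sup>+y. f x y s \<partial>lborel \<partial>lborel \<partial>lborel)"
    unfolding f_def by (rule lborel_pair.Fubini') measurable
  also have "\<dots> \<le> (\<integral>\<^sup>+s. indicator {0..1} s * (?c * ?J * emeasure lborel K) \<partial>(lborel::real measure))"
  proof (rule nn_integral_mono)
    fix s :: real
    consider "s \<notin> {0..1}" | "s \<in> {0..1}" "1 / 2 \<le> s" | "s \<in> {0..1}" "1 / 2 \<le> 1 - s" by fastforce
    then show "(\<integral>\<^sup>+x. \<integral>\<^sup>+y. f x y s \<partial>lborel \<partial>lborel) \<le> indicator {0..1} s * (?c * ?J * emeasure lborel K)"
    proof cases
      case 1
      then show ?thesis by (simp add: f_def)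
    next
      case 2
      have "(\<integral>\<^sup>+x. \<integral>\<^sup>+y. f x y s \<partial>lborel \<partial>lborel) \<le> (\<integral>\<^sup>+x. (?c * ?J) * indicator K x \<partial>lborel)"
      proof (rule nn_integral_mono)
        fix x :: 'a
        have "(\<integral>\<^sup>+y. f x y s \<partial>lborel) \<le> (\<integral>\<^sup>+y. indicator K x * g ((1 - s) *\<^sub>R x + s *\<^sub>R y) \<partial>lborel)"
          using 2 by (intro nn_integral_mono) (auto simp: f_def indicator_def algebra_simps)
        also have "\<dots> = indicator K x * (\<integral>\<^sup>+y. g ((1 - s) *\<^sub>R x + s *\<^sub>R y) \<partial>lborel)"
          by (rule nn_integral_cmult) measurable
        also have "\<dots> \<le> indicator K x * (?c * ?J)"
          using 2 by (intro mult_left_mono nn_integral_segment_point_le) auto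
        finally show "(\<integral>\<^sup>+y. f x y s \<partial>lborel) \<le> (?c * ?J) * indicator K x" by (simp add: mult.commute)
      qed
      also have "\<dots> = ?c * ?J * emeasure lborel K" by (rule nn_integral_cmult_indicator) simp
      finally show ?thesis using 2 by simp
    next
      case 3
      have "(\<integral>\<^sup>+x. \<integral>\<^sup>+y. f x y s \<partial>lborel \<partial>lborel) = (\<integral>\<^sup>+y. \<integral>\<^sup>+x. f x y s \<partial>lborel \<partial>lborel)"
        unfolding f_def by (rule lborel_pair.Fubini'[symmetric]) measurable
      also have "\<dots> \<le> (\<integral>\<^sup>+y. (?c * ?J) * indicator K y \<partial>lborel)"
      proof (rule nn_integral_mono)
        fix y :: 'a
        have "(\<integral>\<^sup>+x. f x y s \<partial>lborel) \<le> (\<integral>\<^sup>+x. indicator K y * g (s *\<^sub>R y + (1 - s) *\<^sub>R x) \<partial>lborel)"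
          using 3 by (intro nn_integral_mono) (auto simp: f_def indicator_def algebra_simps)
        also have "\<dots> = indicator K y * (\<integral>\<^sup>+x. g (s *\<^sub>R y + (1 - s) *\<^sub>R x) \<partial>lborel)"
          by (rule nn_integral_cmult) measurable
        also have "\<dots> \<le> indicator K y * (?c * ?J)"
          using 3 by (intro mult_left_mono nn_integral_segment_point_le) auto
        finally show "(\<integral>\<^sup>+x. f x y s \<partial>lborel) \<le> (?c * ?J) * indicator K y" by (simp add: mult.commute)
      qed
      also have "\<dots> = ?c * ?J * emeasure lborel K" by (rule nn_integral_cmult_indicator) simp
      finally show ?thesis using 3 by simp
    qed
  qed
  also have "(\<integral>\<^sup>+s. indicator {0..1} s * (?c * ?J * emeasure lborel K) \<partial>(lborel::real measure)) = ?c * ?J * emeasure lborel K"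
    by (simp add: nn_integral_multc)
  finally have "osc w K K \<le> ennreal d * (?c * ?J * emeasure lborel K)" by (simp add: mult_left_mono)
  also have "\<dots> = ennreal (d * 2 ^ DIM('a) * measure lborel K) * ?J"
    unfolding emK using d(1) by (simp add: ennreal_mult mult_ac)
  finally show ?thesis by (simp add: g_def)
qed

text \<open>The gradient is integrated over one fixed set \<open>E\<close> while \<open>X\<close>
  and \<open>Y\<close> vary, so inequalities for different pairs combine by adding
  constants.\<close>

definition poincare :: "'a::euclidean_space set \<Rightarrow> 'a set \<Rightarrow> 'a set \<Rightarrow> bool" where
  "poincare E X Y \<longleftrightarrow> (\<exists>C\<ge>0. \<forall>w G. C1_punctured w G \<longrightarrow>
     osc w X Y \<le> ennreal C * (\<integral>\<^sup>+z. indicator E z * ennreal (norm (G z)) \<partial>lborel))"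

lemma poincareI:
  assumes "0 \<le> C" "\<And>w G. C1_punctured w G \<Longrightarrow>
     osc w X Y \<le> ennreal C * (\<integral>\<^sup>+z. indicator E z * ennreal (norm (G z)) \<partial>lborel)"
  shows "poincare E X Y"
  using assms unfolding poincare_def by blast

lemma osc_mono: "X' \<subseteq> X \<Longrightarrow> Y' \<subseteq> Y \<Longrightarrow> osc w X' Y' \<le> osc w X Y"
  unfolding osc_def by (intro nn_integral_mono mult_mono) (auto simp: indicator_def)

lemma poincare_mono:
  assumes "poincare E X Y" "X' \<subseteq> X" "Y' \<subseteq> Y"
  shows "poincare E X' Y'"
  using assms osc_mono[OF assms(2,3)] unfolding poincare_def by (meson order_trans)

lemma poincare_convex:
  fixes K :: "'a::euclidean_space set"
  assumes K: "compact K" "convex K" "0 \<notin> K" "K \<subseteq> E"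
  shows "poincare E K K"
proof -
  obtain B where B: "\<And>x. x \<in> K \<Longrightarrow> norm x \<le> B"
    using compact_imp_bounded[OF K(1)] unfolding bounded_iff by blast
  have d: "norm (y - x) \<le> 2 * \<bar>B\<bar>" if "x \<in> K" "y \<in> K" for x y
    using B[OF that(1)] B[OF that(2)] norm_triangle_ineq4[of y x] by linarith
  show ?thesis
  proof (rule poincareI)
    fix w and G :: "'a \<Rightarrow> 'a" assume w: "C1_punctured w G"
    show "osc w K K \<le> ennreal (2 * \<bar>B\<bar> * 2 ^ DIM('a) * measure lborel K)
        * (\<integral>\<^sup>+z. indicator E z * ennreal (norm (G z)) \<partial>lborel)"
      by (rule order_trans[OF osc_convex_le[OF K(1-3) w _ d]])
        (use K(4) in \<open>auto intro!: mult_left_mono nn_integral_mono simp: indicator_def\<close>)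
  qed simp
qed

text \<open>Insert a third point of \<open>Z\<close> by the triangle inequality and average over it;
  positive measure of \<open>Z\<close> permits the division.\<close>

lemma poincare_chain:
  fixes X Y Z :: "'a::euclidean_space set"
  assumes XZ: "poincare E X Z" and YZ: "poincare E Y Z"
    and [measurable]: "X \<in> sets borel" "Y \<in> sets borel" "Z \<in> sets borel"
    and fin: "emeasure lborel X < \<infinity>" "emeasure lborel Y < \<infinity>" "emeasure lborel Z < \<infinity>"
    and pos: "0 < emeasure lborel Z"
  shows "poincare E X Y"
proof -
  obtain C1 where C1: "0 \<le> C1" "\<And>w G. C1_punctured w G \<Longrightarrow>
     osc w X Z \<le> ennreal C1 * (\<integral>\<^sup>+z. indicator E z * ennreal (norm (G z)) \<partial>lborel)"
    using XZ unfolding poincare_def by blast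
  obtain C2 where C2: "0 \<le> C2" "\<And>w G. C1_punctured w G \<Longrightarrow>
     osc w Y Z \<le> ennreal C2 * (\<integral>\<^sup>+z. indicator E z * ennreal (norm (G z)) \<partial>lborel)"
    using YZ unfolding poincare_def by blast
  define x y z where "x = measure lborel X" and "y = measure lborel Y" and "z = measure lborel Z"
  have em: "emeasure lborel X = ennreal x" "emeasure lborel Y = ennreal y" "emeasure lborel Z = ennreal z"
    unfolding x_def y_def z_def using fin by (auto intro!: emeasure_eq_ennreal_measure)
  have nn: "0 \<le> x" "0 \<le> y" "0 < z" using pos em(3) by (auto simp: x_def y_def z_def)
  show ?thesis
  proof (rule poincareI)
    show "0 \<le> (y * C1 + x * C2) / z" using nn C1 C2 by simp
    fix w :: "'a \<Rightarrow> real" and G assume w: "C1_punctured w G"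
    have wm [measurable]: "w \<in> borel_measurable borel"
      by (rule borel_measurable_punctured[OF C1_punctured_continuous[OF w]])
    let ?I = "\<integral>\<^sup>+z. indicator E z * ennreal (norm (G z)) \<partial>lborel"
    have "ennreal z * osc w X Y
      = (\<integral>\<^sup>+s. \<integral>\<^sup>+t. \<integral>\<^sup>+r. indicator X s * indicator Y t * indicator Z r * ennreal \<bar>w s - w t\<bar> \<partial>lborel \<partial>lborel \<partial>lborel)"
    proof -
      have "(\<integral>\<^sup>+r. indicator X s * indicator Y t * indicator Z r * ennreal \<bar>w s - w t\<bar> \<partial>lborel)
          = ennreal z * (indicator X s * (indicator Y t * ennreal \<bar>w s - w t\<bar>))" for s t
      proof -
        have "(\<integral>\<^sup>+r. indicator X s * indicator Y t * indicator Z r * ennreal \<bar>w s - w t\<bar> \<partial>lborel)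
          = (\<integral>\<^sup>+r. (indicator X s * (indicator Y t * ennreal \<bar>w s - w t\<bar>)) * indicator Z r \<partial>lborel)"
          by (simp add: mult_ac)
        also have "\<dots> = (indicator X s * (indicator Y t * ennreal \<bar>w s - w t\<bar>)) * emeasure lborel Z"
          by (rule nn_integral_cmult_indicator) simp
        finally show ?thesis by (simp add: em mult.commute)
      qed
      then show ?thesis unfolding osc_def by (simp add: nn_integral_cmult)
    qed
    also have "\<dots> \<le> (\<integral>\<^sup>+s. \<integral>\<^sup>+t. \<integral>\<^sup>+r. indicator Y t * (indicator X s * (indicator Z r * ennreal \<bar>w s - w r\<bar>))
        + indicator X s * (indicator Y t * (indicator Z r * ennreal \<bar>w t - w r\<bar>)) \<partial>lborel \<partial>lborel \<partial>lborel)"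
      by (intro nn_integral_mono) (auto simp: indicator_def ennreal_plus[symmetric] simp del: ennreal_plus intro!: ennreal_leI)
    also have "\<dots> = (\<integral>\<^sup>+s. \<integral>\<^sup>+t. \<integral>\<^sup>+r. indicator Y t * (indicator X s * (indicator Z r * ennreal \<bar>w s - w r\<bar>)) \<partial>lborel \<partial>lborel \<partial>lborel)
        + (\<integral>\<^sup>+s. \<integral>\<^sup>+t. \<integral>\<^sup>+r. indicator X s * (indicator Y t * (indicator Z r * ennreal \<bar>w t - w r\<bar>)) \<partial>lborel \<partial>lborel \<partial>lborel)"
      by (simp add: nn_integral_add)
    also have "(\<integral>\<^sup>+s. \<integral>\<^sup>+t. \<integral>\<^sup>+r. indicator Y t * (indicator X s * (indicator Z r * ennreal \<bar>w s - w r\<bar>)) \<partial>lborel \<partial>lborel \<partial>lborel)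
        = ennreal y * osc w X Z"
    proof -
      have "(\<integral>\<^sup>+t. \<integral>\<^sup>+r. indicator Y t * (indicator X s * (indicator Z r * ennreal \<bar>w s - w r\<bar>)) \<partial>lborel \<partial>lborel)
          = ennreal y * (indicator X s * (\<integral>\<^sup>+r. indicator Z r * ennreal \<bar>w s - w r\<bar> \<partial>lborel))" for s
        unfolding em(2)[symmetric] by (simp add: nn_integral_cmult nn_integral_multc)
      then show ?thesis unfolding osc_def by (simp add: nn_integral_cmult)
    qed
    also have "(\<integral>\<^sup>+s. \<integral>\<^sup>+t. \<integral>\<^sup>+r. indicator X s * (indicator Y t * (indicator Z r * ennreal \<bar>w t - w r\<bar>)) \<partial>lborel \<partial>lborel \<partial>lborel)
        = ennreal x * osc w Y Z"
      unfolding osc_def em(1)[symmetric] by (simp add: nn_integral_cmult nn_integral_multc mult_ac)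
    also have "ennreal y * osc w X Z + ennreal x * osc w Y Z \<le> ennreal y * (ennreal C1 * ?I) + ennreal x * (ennreal C2 * ?I)"
      using C1(2)[OF w] C2(2)[OF w] by (intro add_mono mult_left_mono) auto
    also have "\<dots> = ennreal (y * C1 + x * C2) * ?I"
      using nn C1 C2 by (simp add: ennreal_mult ennreal_plus distrib_right mult.assoc)
    finally have "ennreal (1 / z) * (ennreal z * osc w X Y) \<le> ennreal (1 / z) * (ennreal (y * C1 + x * C2) * ?I)"
      by (rule mult_left_mono) simp
    moreover have "ennreal (1 / z) * (ennreal z * osc w X Y) = osc w X Y"
      using nn by (simp add: mult.assoc[symmetric] ennreal_mult[symmetric])
    moreover have "ennreal (1 / z) * (ennreal (y * C1 + x * C2) * ?I) = ennreal ((y * C1 + x * C2) / z) * ?I"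
      using nn C1 C2 by (simp add: mult.assoc[symmetric] ennreal_mult[symmetric] del: ennreal_plus)
    ultimately show "osc w X Y \<le> ennreal ((y * C1 + x * C2) / z) * ?I" by simp
  qed
qed

lemma poincare_Un:
  fixes X1 X2 Y :: "'a::euclidean_space set"
  assumes 1: "poincare E X1 Y" and 2: "poincare E X2 Y"
    and [measurable]: "X1 \<in> sets borel" "X2 \<in> sets borel" "Y \<in> sets borel"
  shows "poincare E (X1 \<union> X2) Y"
proof -
  obtain C1 where C1: "0 \<le> C1" "\<And>w G. C1_punctured w G \<Longrightarrow>
     osc w X1 Y \<le> ennreal C1 * (\<integral>\<^sup>+z. indicator E z * ennreal (norm (G z)) \<partial>lborel)"
    using 1 unfolding poincare_def by blast
  obtain C2 where C2: "0 \<le> C2" "\<And>w G. C1_punctured w G \<Longrightarrow>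
     osc w X2 Y \<le> ennreal C2 * (\<integral>\<^sup>+z. indicator E z * ennreal (norm (G z)) \<partial>lborel)"
    using 2 unfolding poincare_def by blast
  show ?thesis
  proof (rule poincareI)
    show "0 \<le> C1 + C2" using C1 C2 by simp
    fix w :: "'a \<Rightarrow> real" and G assume w: "C1_punctured w G"
    have wm [measurable]: "w \<in> borel_measurable borel"
      by (rule borel_measurable_punctured[OF C1_punctured_continuous[OF w]])
    let ?I = "\<integral>\<^sup>+z. indicator E z * ennreal (norm (G z)) \<partial>lborel"
    have "osc w (X1 \<union> X2) Y \<le> (\<integral>\<^sup>+x. indicator X1 x * (\<integral>\<^sup>+y. indicator Y y * ennreal \<bar>w x - w y\<bar> \<partial>lborel)
        + indicator X2 x * (\<integral>\<^sup>+y. indicator Y y * ennreal \<bar>w x - w y\<bar> \<partial>lborel) \<partial>lborel)"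
      unfolding osc_def by (intro nn_integral_mono) (auto simp: indicator_def)
    also have "\<dots> = osc w X1 Y + osc w X2 Y"
      unfolding osc_def by (rule nn_integral_add) measurable
    also have "\<dots> \<le> ennreal C1 * ?I + ennreal C2 * ?I" using C1(2)[OF w] C2(2)[OF w] by (rule add_mono)
    also have "\<dots> = ennreal (C1 + C2) * ?I" using C1 C2 by (simp add: ennreal_plus distrib_right)
    finally show "osc w (X1 \<union> X2) Y \<le> ennreal (C1 + C2) * ?I" .
  qed
qed

lemma poincare_sym:
  fixes X Y :: "'a::euclidean_space set"
  assumes "poincare E X Y" and [measurable]: "X \<in> sets borel" "Y \<in> sets borel"
  shows "poincare E Y X"
proof -
  have "osc w Y X = osc w X Y" if w: "C1_punctured w G" for w :: "'a \<Rightarrow> real" and G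
  proof -
    have wm [measurable]: "w \<in> borel_measurable borel"
      by (rule borel_measurable_punctured[OF C1_punctured_continuous[OF w]])
    have "osc w Y X = (\<integral>\<^sup>+y. \<integral>\<^sup>+x. indicator X x * indicator Y y * ennreal \<bar>w x - w y\<bar> \<partial>lborel \<partial>lborel)"
      unfolding osc_def by (simp add: nn_integral_cmult[symmetric] mult_ac abs_minus_commute)
    also have "\<dots> = (\<integral>\<^sup>+x. \<integral>\<^sup>+y. indicator X x * indicator Y y * ennreal \<bar>w x - w y\<bar> \<partial>lborel \<partial>lborel)"
      by (rule lborel_pair.Fubini') measurable
    also have "\<dots> = osc w X Y" unfolding osc_def by (simp add: nn_integral_cmult[symmetric] mult_ac)
    finally show ?thesis .
  qed
  then show ?thesis using assms(1) unfolding poincare_def by metis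
qed

lemma poincare_UN:
  fixes X :: "'i \<Rightarrow> 'a::euclidean_space set"
  assumes "finite I" "\<And>i. i \<in> I \<Longrightarrow> poincare E (X i) Y" "\<And>i. i \<in> I \<Longrightarrow> X i \<in> sets borel" "Y \<in> sets borel"
  shows "poincare E (\<Union>i\<in>I. X i) Y"
  using assms
proof (induction I)
  case empty
  show ?case by (rule poincareI[of 0]) (auto simp: osc_def)
next
  case (insert i I)
  then show ?case by (auto intro!: poincare_Un sets.finite_UN)
qed

text \<open>A compact convex piece off the origin if \<open>\<rho> > 0\<close>. Over all faces the
  pieces cover the region where the maximum norm lies between \<rho> and \<open>L\<close>; in
  dimension at least two a round shell is not a finite union of convex sets.\<close>

definition face_box :: "real \<Rightarrow> real \<Rightarrow> 'a::euclidean_space \<Rightarrow> 'a set" where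
  "face_box \<rho> L b = {x. (\<forall>i\<in>Basis. \<bar>x \<bullet> i\<bar> \<le> L) \<and> \<rho> \<le> x \<bullet> b}"

definition faces :: "'a::euclidean_space set" where
  "faces = Basis \<union> uminus ` Basis"

definition cube_shell :: "real \<Rightarrow> real \<Rightarrow> 'a::euclidean_space set" where
  "cube_shell \<rho> L = (\<Union>b\<in>faces. face_box \<rho> L b)"

lemma face_box_compact: "compact (face_box \<rho> L b)"
proof -
  have "face_box \<rho> L b = (\<Inter>i\<in>Basis. {x. \<bar>x \<bullet> i\<bar> \<le> L}) \<inter> {x. \<rho> \<le> x \<bullet> b}"
    by (auto simp: face_box_def)
  then have "closed (face_box \<rho> L b)"
    by (auto intro!: closed_Collect_le continuous_intros)
  moreover have "bounded (face_box \<rho> L b)"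
  proof -
    have "norm x \<le> DIM('a) * L" if "x \<in> face_box \<rho> L b" for x :: 'a
      using norm_le_l1[of x] sum_bounded_above[of Basis "\<lambda>i. \<bar>x \<bullet> i\<bar>" L] that by (simp add: face_box_def)
    then show ?thesis unfolding bounded_iff by blast
  qed
  ultimately show ?thesis by (simp add: compact_eq_bounded_closed)
qed

lemma face_box_convex: "convex (face_box \<rho> L b)"
proof -
  have 1: "face_box \<rho> L b = (\<Inter>i\<in>Basis. {x. i \<bullet> x \<le> L} \<inter> {x. (- i) \<bullet> x \<le> L}) \<inter> {x. b \<bullet> x \<ge> \<rho>}"
    by (auto simp: face_box_def abs_le_iff inner_commute)
  show ?thesis unfolding 1
    by (intro convex_Int convex_INT convex_halfspace_le convex_halfspace_ge)
qed

lemma face_box_Int_pos: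
  fixes b c :: "'a::euclidean_space"
  assumes b: "b \<in> faces" and c: "c \<in> faces" and bc: "c \<noteq> - b" and \<rho>: "0 < \<rho>" "\<rho> < L"
  shows "0 < emeasure lborel (face_box \<rho> L b \<inter> face_box \<rho> L c)"
proof -
  define t where "t = (\<rho> + L) / 2"
  have t: "\<rho> < t" "t < L" "0 < t" using \<rho> by (auto simp: t_def)
  \<comment> \<open>As \<open>c \<noteq> - b\<close>, the two faces coincide or belong to different
    axes, so this point satisfies all constraints strictly.\<close>
  define x0 where "x0 = (if b = c then t *\<^sub>R b else t *\<^sub>R (b + c))"
  define U where "U = {x::'a. \<rho> < x \<bullet> b \<and> \<rho> < x \<bullet> c \<and> (\<forall>i\<in>Basis. \<bar>x \<bullet> i\<bar> < L)}"
  obtain i s where i: "i \<in> Basis" "s = 1 \<or> s = -1" "b = s *\<^sub>R i" using b by (force simp: faces_def)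
  obtain j r where j: "j \<in> Basis" "r = 1 \<or> r = -1" "c = r *\<^sub>R j" using c by (force simp: faces_def)
  have ij: "i \<noteq> j" if "b \<noteq> c" using that bc i j by auto
  have "x0 \<in> U"
  proof (cases "b = c")
    case True
    then show ?thesis using i t by (auto simp: U_def x0_def inner_Basis)
  next
    case False
    then show ?thesis using i j t ij[OF False]
      by (auto simp: U_def x0_def inner_Basis inner_add_left inner_add_right)
  qed
  moreover have "open U"
  proof -
    have "U = {x. \<rho> < x \<bullet> b} \<inter> {x. \<rho> < x \<bullet> c} \<inter> (\<Inter>i\<in>Basis. {x. \<bar>x \<bullet> i\<bar> < L})" by (auto simp: U_def)
    then show ?thesis by (auto intro!: open_Int open_INT open_Collect_less continuous_intros)
  qed
  ultimately obtain e where e: "0 < e" "ball x0 e \<subseteq> U" using open_contains_ball by blast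
  have "0 < measure lborel (ball x0 e)" using content_ball_pos[OF e(1), of x0] by simp
  then have "0 < emeasure lborel (ball x0 e)"
    by (metis measure_zero_top less_irrefl measure_def enn2real_0 gr_zeroI)
  also have "\<dots> \<le> emeasure lborel (face_box \<rho> L b \<inter> face_box \<rho> L c)"
    using e(2) by (intro emeasure_mono)
      (auto simp: U_def face_box_def subset_iff less_imp_le borel_compact compact_Int face_box_compact[unfolded face_box_def])
  finally show ?thesis .
qed

lemma zero_notin_face_box: "0 < \<rho> \<Longrightarrow> 0 \<notin> face_box \<rho> L b"
  by (simp add: face_box_def)

lemma face_box_finite: "emeasure lborel (face_box \<rho> L b) < \<infinity>"
  using emeasure_compact_finite[OF face_box_compact] by auto

lemma face_box_sets [measurable]: "face_box \<rho> L b \<in> sets borel"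
  by (rule borel_compact[OF face_box_compact])

lemma cube_shell_compact: "compact (cube_shell \<rho> L)"
  unfolding cube_shell_def by (intro compact_UN face_box_compact) (simp add: faces_def)

text \<open>Adjacent face boxes overlap in a set of positive measure; opposite ones are linked through a third,
  which exists because the dimension is at least two.\<close>

lemma poincare_cube_shell:
  assumes dim: "2 \<le> DIM('a::euclidean_space)" and \<rho>: "0 < \<rho>" "\<rho> < L"
  shows "poincare (cube_shell \<rho> L) (cube_shell \<rho> L) (cube_shell \<rho> L :: 'a set)"
proof -
  let ?E = "cube_shell \<rho> L :: 'a set" and ?K = "face_box \<rho> L :: 'a \<Rightarrow> 'a set"
  have self: "poincare ?E (?K b) (?K b)" if "b \<in> faces" for b
    using that \<rho> by (intro poincare_convex face_box_compact face_box_convex zero_notin_face_box)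
      (auto simp: cube_shell_def)
  have adj: "poincare ?E (?K b) (?K c)" if "b \<in> faces" "c \<in> faces" "c \<noteq> - b" for b c
  proof (rule poincare_chain[where Z = "?K b \<inter> ?K c"])
    show "poincare ?E (?K b) (?K b \<inter> ?K c)" by (rule poincare_mono[OF self[OF that(1)]]) auto
    show "poincare ?E (?K c) (?K b \<inter> ?K c)" by (rule poincare_mono[OF self[OF that(2)]]) auto
    show "0 < emeasure lborel (?K b \<inter> ?K c)" using face_box_Int_pos that \<rho> by blast
    have "emeasure lborel (?K b \<inter> ?K c) \<le> emeasure lborel (?K b)" by (intro emeasure_mono) auto
    then show "emeasure lborel (?K b \<inter> ?K c) < \<infinity>" using face_box_finite le_less_trans by blast
  qed (use face_box_finite in auto)
  have opp: "poincare ?E (?K b) (?K (- b))" if b: "b \<in> faces" for b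
  proof -
    have "b \<in> Basis \<or> - b \<in> Basis" using b by (auto simp: faces_def)
    then obtain i where i: "i \<in> Basis" "b = i \<or> b = - i" by fastforce
    have "\<not> Basis \<subseteq> {i}"
    proof
      assume "Basis \<subseteq> {i}"
      then have "DIM('a) \<le> card {i}" by (intro card_mono) auto
      then show False using dim by simp
    qed
    then obtain j where j: "j \<in> Basis" "j \<noteq> i" by auto
    have ne: "j \<noteq> - i"
    proof
      assume "j = - i"
      then have "j \<bullet> i = - 1" using i by simp
      then show False using inner_Basis[OF j(1) i(1)] by (simp split: if_splits)
    qed
    have jf: "j \<in> faces" "- b \<in> faces" using j b by (auto simp: faces_def)
    show ?thesis
    proof (rule poincare_chain[where Z = "?K j"])
      show "poincare ?E (?K b) (?K j)" using b jf ne j i by (intro adj) auto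
      show "poincare ?E (?K (- b)) (?K j)" using b jf ne j i by (intro adj) auto
      show "0 < emeasure lborel (?K j)"
        using face_box_Int_pos[OF jf(1) jf(1) _ \<rho>] j(1) nonzero_Basis[OF j(1)]
        by (simp add: eq_neg_iff_add_eq_0 flip: scaleR_2)
    qed (use face_box_finite in auto)
  qed
  have all: "poincare ?E (?K b) (?K c)" if "b \<in> faces" "c \<in> faces" for b c
    using adj[OF that] opp[OF that(1)] by (cases "c = - b") auto
  have fin: "finite (faces :: 'a set)" by (simp add: faces_def)
  have Em: "?E \<in> sets borel" by (rule borel_compact[OF cube_shell_compact])
  have "poincare ?E (\<Union>b\<in>faces. ?K b) (?K c)" if "c \<in> faces" for c
    using that by (intro poincare_UN fin all) auto
  then have 1: "poincare ?E ?E (?K c)" if "c \<in> faces" for c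
    unfolding cube_shell_def[of \<rho> L, symmetric] using that by blast
  have 2: "poincare ?E (?K c) ?E" if "c \<in> faces" for c
    by (rule poincare_sym[OF 1[OF that] Em face_box_sets])
  have "poincare ?E (\<Union>c\<in>faces. ?K c) ?E"
    by (rule poincare_UN[OF fin 2 face_box_sets Em])
  then show ?thesis unfolding cube_shell_def[of \<rho> L, symmetric] .
qed

text \<open>Some \<open>y\<close> does no worse than the average over \<open>y\<close>, and that
  average is the oscillation divided by the volume.\<close>

lemma cube_shell_concentration:
  assumes dim: "2 \<le> DIM('a::euclidean_space)" and \<rho>: "0 < \<rho>" "\<rho> < L"
  obtains C where "0 < C"
    "\<And>w G \<epsilon>. C1_punctured w G \<Longrightarrow> 0 < \<epsilon> \<Longrightarrow>
      (\<integral>\<^sup>+z. indicator (cube_shell \<rho> L :: 'a set) z * ennreal (norm (G z)) \<partial>lborel) \<le> ennreal \<epsilon> \<Longrightarrow>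
      \<exists>y\<in>cube_shell \<rho> L. (\<integral>\<^sup>+x. indicator (cube_shell \<rho> L) x * ennreal \<bar>w y - w x\<bar> \<partial>lborel) \<le> ennreal (C * \<epsilon>)"
proof -
  let ?E = "cube_shell \<rho> L :: 'a set"
  obtain C where C: "0 \<le> C" "\<And>w G. C1_punctured w G \<Longrightarrow>
     osc w ?E ?E \<le> ennreal C * (\<integral>\<^sup>+z. indicator ?E z * ennreal (norm (G z)) \<partial>lborel)"
    using poincare_cube_shell[OF dim \<rho>] unfolding poincare_def by blast
  have Em [measurable]: "?E \<in> sets borel" by (rule borel_compact[OF cube_shell_compact])
  define v where "v = measure lborel ?E"
  have v: "emeasure lborel ?E = ennreal v"
  proof -
    have "emeasure lborel ?E < \<infinity>" by (rule emeasure_compact_finite[OF cube_shell_compact])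
    then show ?thesis unfolding v_def by (intro emeasure_eq_ennreal_measure) auto
  qed
  obtain b :: 'a where b: "b \<in> Basis" using nonempty_Basis by blast
  then have bf: "b \<in> faces" by (simp add: faces_def)
  have "0 < emeasure lborel (face_box \<rho> L b \<inter> face_box \<rho> L b)"
    using nonzero_Basis[OF b] by (intro face_box_Int_pos bf \<rho>) (simp add: eq_neg_iff_add_eq_0 flip: scaleR_2)
  also have "\<dots> \<le> emeasure lborel ?E"
  proof (rule emeasure_mono)
    show "face_box \<rho> L b \<inter> face_box \<rho> L b \<subseteq> ?E" using bf by (auto simp: cube_shell_def)
  qed (use Em in simp)
  finally have v0: "0 < v" unfolding v by simp
  show ?thesis
  \<comment> \<open>A positive value above \<open>C / v\<close>: integrating the negated claim over
    \<open>y\<close> then contradicts the Poincare bound.\<close>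
  proof (rule that[of "2 * (C + 1) / v"])
    show "0 < 2 * (C + 1) / v" using C v0 by simp
    fix w :: "'a \<Rightarrow> real" and G \<epsilon>
    assume w: "C1_punctured w G" and \<epsilon>: "0 < \<epsilon>"
      and le: "(\<integral>\<^sup>+z. indicator ?E z * ennreal (norm (G z)) \<partial>lborel) \<le> ennreal \<epsilon>"
    show "\<exists>y\<in>?E. (\<integral>\<^sup>+x. indicator ?E x * ennreal \<bar>w y - w x\<bar> \<partial>lborel) \<le> ennreal (2 * (C + 1) / v * \<epsilon>)"
    proof (rule ccontr)
      assume "\<not> ?thesis"
      then have gt: "ennreal (2 * (C + 1) / v * \<epsilon>) \<le> (\<integral>\<^sup>+x. indicator ?E x * ennreal \<bar>w y - w x\<bar> \<partial>lborel)"
        if "y \<in> ?E" for y using that by (auto simp: not_le intro: less_imp_le)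
      have "ennreal (2 * (C + 1) / v * \<epsilon>) * emeasure lborel ?E = (\<integral>\<^sup>+y. ennreal (2 * (C + 1) / v * \<epsilon>) * indicator ?E y \<partial>lborel)"
        by (rule nn_integral_cmult_indicator[symmetric]) simp
      also have "\<dots> \<le> osc w ?E ?E"
        unfolding osc_def using gt by (intro nn_integral_mono) (auto simp: indicator_def)
      also have "\<dots> \<le> ennreal C * ennreal \<epsilon>"
        using C(2)[OF w] le by (meson mult_left_mono order_trans zero_le)
      finally have "ennreal (2 * (C + 1) * \<epsilon>) \<le> ennreal (C * \<epsilon>)"
        using v v0 C(1) \<epsilon> by (simp add: ennreal_mult[symmetric])
      then have "2 * (C + 1) * \<epsilon> \<le> C * \<epsilon>" using C(1) \<epsilon> by (simp add: ennreal_le_iff)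
      then show False using C(1) \<epsilon> by (simp add: mult_le_cancel_right)
    qed
  qed
qed

section \<open>The case of a nonzero exponent\<close>

text \<open>The norm is at most the sum of the absolute coordinates, so one of these is at least the
  norm divided by the dimension.\<close>

lemma shell_subset_cube_shell:
  "shell (exp (- 1)) (exp 1) \<subseteq> (cube_shell (exp (- 1) / DIM('a)) (exp 1) :: 'a::euclidean_space set)"
proof
  fix x :: 'a assume x: "x \<in> shell (exp (- 1)) (exp 1)"
  have "\<exists>i\<in>Basis. exp (- 1) / DIM('a) \<le> \<bar>x \<bullet> i\<bar>"
  proof (rule ccontr)
    assume "\<not> ?thesis"
    then have "(\<Sum>i\<in>Basis. \<bar>x \<bullet> i\<bar>) < of_nat (card (Basis :: 'a set)) * (exp (- 1) / DIM('a))"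
      by (intro sum_bounded_above_strict) (auto simp: not_le DIM_positive)
    then have "norm x < exp (- 1)" using norm_le_l1[of x] by simp
    then show False using x by (simp add: shell_def)
  qed
  then obtain i where i: "i \<in> Basis" "exp (- 1) / DIM('a) \<le> \<bar>x \<bullet> i\<bar>" by blast
  have bd: "\<bar>x \<bullet> j\<bar> \<le> exp 1" if "j \<in> Basis" for j
    using Basis_le_norm[OF that, of x] x by (simp add: shell_def)
  show "x \<in> cube_shell (exp (- 1) / DIM('a)) (exp 1)"
  proof (cases "0 \<le> x \<bullet> i")
    case True
    then have "x \<in> face_box (exp (- 1) / DIM('a)) (exp 1) i" using i bd by (simp add: face_box_def)
    then show ?thesis using i by (auto simp: cube_shell_def faces_def)
  next
    case False
    then have "x \<in> face_box (exp (- 1) / DIM('a)) (exp 1) (- i)" using i bd by (simp add: face_box_def)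
    then show ?thesis using i by (auto simp: cube_shell_def faces_def)
  qed
qed

lemma cube_shell_subset_shell:
  fixes L :: real
  assumes "0 < \<rho>"
  shows "(cube_shell \<rho> L :: 'a::euclidean_space set) \<subseteq> shell \<rho> (DIM('a) * L)"
proof
  fix x :: 'a assume "x \<in> cube_shell \<rho> L"
  then obtain b where b: "b \<in> faces" "\<rho> \<le> x \<bullet> b" "\<forall>i\<in>Basis. \<bar>x \<bullet> i\<bar> \<le> L" by (auto simp: cube_shell_def face_box_def)
  have "norm b = 1" using b(1) by (auto simp: faces_def)
  then have "x \<bullet> b \<le> norm x" using norm_cauchy_schwarz[of x b] by simp
  moreover have "norm x \<le> DIM('a) * L"
    using norm_le_l1[of x] sum_bounded_above[of Basis "\<lambda>i. \<bar>x \<bullet> i\<bar>" L] b(3) by simp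
  ultimately show "x \<in> shell \<rho> (DIM('a) * L)" using b(2) by (simp add: shell_def)
qed

locale nonzero_exponent = positive_solution u p a \<mu> \<gamma> c1 c2
  for u :: "'a::euclidean_space \<Rightarrow> real" and p a \<mu> \<gamma> c1 c2 +
  assumes \<gamma>: "\<gamma> \<noteq> 0" and dim: "2 \<le> DIM('a)"
begin

section \<open>Pointwise bounds by the gap\<close>

definition gap :: "'a \<Rightarrow> real" where "gap x = M x \<bullet> Q x"

definition K where "K = p * (p - 1) + \<bar>\<kappa>\<bar> * p / \<bar>\<gamma>\<bar>"

text \<open>Radial slope of the lower order term at \<open>P = R\<close>; it vanishes exactly when
  \<kappa> = p \<gamma>.\<close>

definition \<beta> where "\<beta> = (p - 1) * \<bar>\<gamma>\<bar> powr (p - 2) * (\<kappa> - p * \<gamma>)"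

definition W where "W = max \<bar>ln c1\<bar> \<bar>ln c2\<bar>"

lemma gap_eq: "gap x = mono_gap p (P x) (R x)"
  by (simp add: gap_def mono_gap_def M_def Q_def)

lemma gap_nonneg: "0 \<le> gap x"
  unfolding gap_eq by (rule mono_gap_nonneg[OF p])

lemma gap_cont: "continuous_on (- {0}) gap"
  unfolding gap_def by (intro continuous_intros M_cont Q_cont)

lemma K_nonneg: "0 \<le> K"
  using p by (simp add: K_def)

lemma w_le: "x \<noteq> 0 \<Longrightarrow> \<bar>w x\<bar> \<le> W"
  using w_bounds[of x] by (auto simp: W_def abs_le_iff le_max_iff_disj)

lemma drift_le: "x \<noteq> 0 \<Longrightarrow> \<bar>b x - \<beta> * (Q x \<bullet> sgn x)\<bar> \<le> K * gap x"
  using drift_remainder_le[of "sgn x" \<gamma> p "P x" \<kappa>] \<gamma> p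
  by (simp add: norm_sgn b_def \<beta>_def M_def Q_def R_def K_def gap_eq)

text \<open>Linear in \<open>|Q|\<close> and the gap, hence small on shells where both have small
  integrals; the plain bound by \<open>|P|^(p-1) + |R|^(p-1)\<close> is not.\<close>

lemma M_sgn_le: "x \<noteq> 0 \<Longrightarrow> \<bar>M x \<bullet> sgn x\<bar> \<le> (p - 1) * \<bar>\<gamma>\<bar> powr (p - 2) * norm (Q x) + p / \<bar>\<gamma>\<bar> * gap x"
proof -
  assume x: "x \<noteq> 0"
  let ?c = "(p - 1) * \<bar>\<gamma>\<bar> powr (p - 2)"
  have c: "0 \<le> ?c" using p by simp
  have 1: "\<bar>M x \<bullet> sgn x - ?c * (Q x \<bullet> sgn x)\<bar> \<le> p / \<bar>\<gamma>\<bar> * gap x"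
    using flux_inner_direction_le[of "sgn x" \<gamma> p "P x"] \<gamma> p x
    by (simp add: norm_sgn M_def Q_def R_def gap_eq)
  have "\<bar>Q x \<bullet> sgn x\<bar> \<le> norm (Q x)" using Cauchy_Schwarz_ineq2[of "Q x" "sgn x"] x by (simp add: norm_sgn)
  then have "\<bar>?c * (Q x \<bullet> sgn x)\<bar> \<le> ?c * norm (Q x)"
    unfolding abs_mult[of ?c "Q x \<bullet> sgn x"] abs_of_nonneg[OF c] using c by (rule mult_left_mono)
  then show ?thesis using 1 by linarith
qed

lemma norm_R: "x \<noteq> 0 \<Longrightarrow> norm (R x) = \<bar>\<gamma>\<bar>"
  by (simp add: R_def norm_sgn)

lemma P_growth:
  obtains K1 where "0 \<le> K1" "\<And>x. x \<noteq> 0 \<Longrightarrow> norm (P x) powr p \<le> 2 * gap x + K1"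
proof -
  obtain K1 where "0 \<le> K1" "\<And>P R::'a. norm R = \<bar>\<gamma>\<bar> \<Longrightarrow> norm P powr p \<le> 2 * mono_gap p P R + K1"
    using mono_gap_growth[OF p, of "\<bar>\<gamma>\<bar>"] by auto
  then show ?thesis using that norm_R unfolding gap_eq by metis
qed

lemma Q_le:
  assumes "0 < d"
  obtains C where "0 \<le> C" "\<And>x. x \<noteq> 0 \<Longrightarrow> norm (Q x) \<le> d + C * gap x"
proof -
  obtain C where C: "0 \<le> C" "\<And>R Q::'a. norm R = \<bar>\<gamma>\<bar> \<Longrightarrow> norm Q \<le> d + C * mono_gap p (R + Q) R"
    using norm_le_mono_gap[OF p assms, of "\<bar>\<gamma>\<bar>"] by metis
  have "norm (Q x) \<le> d + C * gap x" if "x \<noteq> 0" for x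
    using C(2)[OF norm_R[OF that], of "Q x"] by (simp add: gap_eq Q_def)
  then show ?thesis using that C(1) by blast
qed

text \<open>The exponent \<open>K + 1\<close> makes \<open>\<bar>H''\<bar>\<close> exceed \<open>K \<bar>H'\<bar>\<close>, which absorbs the remainder in \<open>drift_le\<close>.\<close>

definition H :: "real \<Rightarrow> real \<Rightarrow> real" where "H \<sigma> s = exp (\<sigma> * (K + 1) * s) / (K + 1)"

lemma H_bounds:
  assumes "\<sigma> = 1 \<or> \<sigma> = -1" "\<bar>s\<bar> \<le> W"
  shows "exp (- ((K + 1) * W)) \<le> exp (\<sigma> * (K + 1) * s)" "exp (\<sigma> * (K + 1) * s) \<le> exp ((K + 1) * W)"
    "0 \<le> H \<sigma> s" "H \<sigma> s \<le> exp ((K + 1) * W)"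
proof -
  have "\<bar>\<sigma> * (K + 1) * s\<bar> = (K + 1) * \<bar>s\<bar>" using assms(1) K_nonneg by (auto simp: abs_mult)
  also have "\<dots> \<le> (K + 1) * W" using assms(2) K_nonneg by (intro mult_left_mono) auto
  finally have 1: "\<bar>\<sigma> * (K + 1) * s\<bar> \<le> (K + 1) * W" .
  then show "exp (- ((K + 1) * W)) \<le> exp (\<sigma> * (K + 1) * s)" "exp (\<sigma> * (K + 1) * s) \<le> exp ((K + 1) * W)"
    unfolding exp_le_cancel_iff abs_le_iff by linarith+
  then have "exp (\<sigma> * (K + 1) * s) / (K + 1) \<le> exp ((K + 1) * W) / 1"
    using K_nonneg by (intro frac_le) auto
  then show "H \<sigma> s \<le> exp ((K + 1) * W)" by (simp add: H_def)
  show "0 \<le> H \<sigma> s" using K_nonneg by (simp add: H_def)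
qed

lemma H_deriv: "(H \<sigma> has_real_derivative \<sigma> * exp (\<sigma> * (K + 1) * s)) (at s)"
  unfolding H_def using K_nonneg by (auto intro!: derivative_eq_intros)

lemma H_lipschitz:
  assumes \<sigma>: "\<sigma> = 1 \<or> \<sigma> = -1" and s: "\<bar>s\<bar> \<le> W" "\<bar>t\<bar> \<le> W"
  shows "\<bar>H \<sigma> s - H \<sigma> t\<bar> \<le> exp ((K + 1) * W) * \<bar>s - t\<bar>"
proof -
  have "norm (H \<sigma> s - H \<sigma> t) \<le> exp ((K + 1) * W) * norm (s - t)"
  proof (rule field_differentiable_bound[of "{-W..W}"])
    fix r assume r: "r \<in> {-W..W}"
    show "(H \<sigma> has_field_derivative \<sigma> * exp (\<sigma> * (K + 1) * r)) (at r within {-W..W})"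
      using H_deriv by (rule has_field_derivative_at_within)
    show "norm (\<sigma> * exp (\<sigma> * (K + 1) * r)) \<le> exp ((K + 1) * W)"
      using H_bounds(2)[OF \<sigma>, of r] r \<sigma> by (auto simp: abs_mult)
  qed (use s in auto)
  then show ?thesis by simp
qed

lemma H_cont: "continuous_on S (H \<sigma>)"
  unfolding H_def[abs_def] by (intro continuous_intros) (use K_nonneg in auto)

section \<open>Energy estimates with collars of fixed width\<close>

context
  fixes m :: nat
  assumes m: "m \<ge> 2" "real m \<ge> p"
begin

text \<open>Width 1 makes every collar a dilate of a fixed shell, so collar measures do not depend
  on \<open>T\<close>.\<close>

abbreviation "\<eta> T \<equiv> cutoff m T 1 :: 'a \<Rightarrow> real"
abbreviation "\<eta>' T \<equiv> cutoff' m T 1 :: 'a \<Rightarrow> real"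

lemma integrable_\<eta>:
  assumes "0 < T" "continuous_on (- {0}) f"
  shows "integrable nu (\<lambda>x. \<eta> T x * f x)" "integrable nu (\<lambda>x. \<eta>' T x * f x)"
  using integrable_cutoff[OF assms(1) _ m(1) assms(2), of 1] by auto

lemma Hw_cont: "continuous_on (- {0}) (\<lambda>x. H \<sigma> (w x))"
  by (rule continuous_on_compose2[OF H_cont w_cont]) auto

text \<open>\<open>energy_identity\<close> with \<open>h\<close> the derivative of
  \<open>H \<sigma>\<close>. For either sign h' = (K + 1) |h|, so after absorbing the remainder at
  least |h| times the gap survives. Only the primitive in the boundary term feels the sign.\<close>

lemma energy_inequality:
  assumes T: "0 < T" and \<sigma>: "\<sigma> = 1 \<or> \<sigma> = -1"
  shows "exp (- ((K + 1) * W)) * (LINT x|nu. \<eta> T x * gap x)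
    \<le> exp ((K + 1) * W) * (LINT x|nu. \<bar>\<eta>' T x\<bar> * \<bar>M x \<bullet> sgn x\<bar>)
      - \<beta> * (LINT x|nu. \<eta>' T x * H \<sigma> (w x))"
proof -
  let ?A = "exp (- ((K + 1) * W))" and ?B = "exp ((K + 1) * W)"
  let ?h = "\<lambda>s. \<sigma> * exp (\<sigma> * (K + 1) * s)" and ?h' = "\<lambda>s. (K + 1) * exp (\<sigma> * (K + 1) * s)"
  have hd: "(?h has_real_derivative ?h' s) (at s)" for s
    using \<sigma> by (auto intro!: derivative_eq_intros simp: algebra_simps)
  have hc: "continuous_on UNIV ?h'" by (intro continuous_intros)
  have id: "(LINT x|nu. \<eta> T x * (?h' (w x) * (M x \<bullet> Q x) - ?h (w x) * (b x - \<beta> * (Q x \<bullet> sgn x)))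
      + \<eta>' T x * (?h (w x) * (M x \<bullet> sgn x) + \<beta> * H \<sigma> (w x))) = 0"
    using energy_identity[OF H_deriv hd hc m(1) T, of 1 \<beta>] by simp
  have Me: "continuous_on (- {0}) (\<lambda>x. M x \<bullet> sgn x)"
    by (intro continuous_intros M_cont continuous_on_sgn_punctured)
  have i1: "integrable nu (\<lambda>x. \<eta> T x * gap x)" by (rule integrable_\<eta>(1)[OF T gap_cont])
  have i2: "integrable nu (\<lambda>x. \<bar>\<eta>' T x\<bar> * \<bar>M x \<bullet> sgn x\<bar>)"
    using integrable_\<eta>(2)[OF T Me] by (simp add: abs_mult[symmetric])
  have i3: "integrable nu (\<lambda>x. \<eta>' T x * H \<sigma> (w x))" by (rule integrable_\<eta>(2)[OF T Hw_cont])
  have hw: "continuous_on (- {0}) (\<lambda>x. ?h' (w x) * (M x \<bullet> Q x) - ?h (w x) * (b x - \<beta> * (Q x \<bullet> sgn x)))"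
    "continuous_on (- {0}) (\<lambda>x. ?h (w x) * (M x \<bullet> sgn x) + \<beta> * H \<sigma> (w x))"
    by (intro continuous_intros w_cont M_cont Q_cont b_cont continuous_on_sgn_punctured Hw_cont)+
  have i4: "integrable nu (\<lambda>x. \<eta> T x * (?h' (w x) * (M x \<bullet> Q x) - ?h (w x) * (b x - \<beta> * (Q x \<bullet> sgn x)))
      + \<eta>' T x * (?h (w x) * (M x \<bullet> sgn x) + \<beta> * H \<sigma> (w x)))"
    by (intro Bochner_Integration.integrable_add integrable_\<eta> T hw)
  have "(LINT x|nu. ?A * (\<eta> T x * gap x) - ?B * (\<bar>\<eta>' T x\<bar> * \<bar>M x \<bullet> sgn x\<bar>) + \<beta> * (\<eta>' T x * H \<sigma> (w x))) \<le> 0"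
    unfolding id[symmetric]
  proof (rule integral_mono)
    fix x :: 'a
    show "?A * (\<eta> T x * gap x) - ?B * (\<bar>\<eta>' T x\<bar> * \<bar>M x \<bullet> sgn x\<bar>) + \<beta> * (\<eta>' T x * H \<sigma> (w x))
      \<le> \<eta> T x * (?h' (w x) * (M x \<bullet> Q x) - ?h (w x) * (b x - \<beta> * (Q x \<bullet> sgn x)))
      + \<eta>' T x * (?h (w x) * (M x \<bullet> sgn x) + \<beta> * H \<sigma> (w x))"
    proof (cases "x = 0")
      case True
      then show ?thesis by (simp add: cutoff_def cutoff'_def)
    next
      case False
      define E where "E = exp (\<sigma> * (K + 1) * w x)"
      have E: "?A \<le> E" "E \<le> ?B" "0 < E"
        unfolding E_def using H_bounds(1,2)[OF \<sigma> w_le[OF False]] by auto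
      have "\<bar>?h (w x) * (b x - \<beta> * (Q x \<bullet> sgn x))\<bar> \<le> E * (K * gap x)"
        using drift_le[OF False] \<sigma> E by (auto simp: abs_mult E_def)
      moreover have "?A * gap x \<le> E * gap x" using E gap_nonneg by (intro mult_right_mono) auto
      \<comment> \<open>The first summand pays for the drift remainder, the second is what
        remains.\<close>
      moreover have "?h' (w x) * (M x \<bullet> Q x) = E * (K * gap x) + E * gap x"
        by (simp add: E_def gap_def algebra_simps)
      ultimately have "?A * gap x \<le> ?h' (w x) * (M x \<bullet> Q x) - ?h (w x) * (b x - \<beta> * (Q x \<bullet> sgn x))"
        unfolding abs_le_iff by linarith
      then have 1: "\<eta> T x * (?A * gap x) \<le> \<eta> T x * (?h' (w x) * (M x \<bullet> Q x) - ?h (w x) * (b x - \<beta> * (Q x \<bullet> sgn x)))"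
        by (intro mult_left_mono cutoff_bounds)
      have "\<bar>\<eta>' T x * (?h (w x) * (M x \<bullet> sgn x))\<bar> = E * (\<bar>\<eta>' T x\<bar> * \<bar>M x \<bullet> sgn x\<bar>)"
        using \<sigma> by (auto simp: abs_mult E_def)
      also have "\<dots> \<le> ?B * (\<bar>\<eta>' T x\<bar> * \<bar>M x \<bullet> sgn x\<bar>)" using E by (intro mult_right_mono) auto
      finally have 2: "- (?B * (\<bar>\<eta>' T x\<bar> * \<bar>M x \<bullet> sgn x\<bar>)) \<le> \<eta>' T x * (?h (w x) * (M x \<bullet> sgn x))"
        by linarith
      have 3: "\<eta>' T x * (?h (w x) * (M x \<bullet> sgn x) + \<beta> * H \<sigma> (w x))
        = \<eta>' T x * (?h (w x) * (M x \<bullet> sgn x)) + \<beta> * (\<eta>' T x * H \<sigma> (w x))"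
        by (simp add: distrib_left mult.left_commute)
      have 4: "\<eta> T x * (?A * gap x) = ?A * (\<eta> T x * gap x)" by simp
      show ?thesis using 1 2 unfolding 3 4 by linarith
    qed
  qed (use i1 i2 i3 i4 in auto)
  then show ?thesis using i1 i2 i3 by simp
qed

abbreviation "collar T \<equiv> shell (exp T) (exp (T + 1)) \<union> shell (exp (- (T + 1))) (exp (- T)) :: 'a set"

lemma collar_measure: "measure nu (collar T) \<le> 2 * measure nu (shell 1 (exp 1) :: 'a set)"
  and collar_integrable: "integrable nu (indicator (collar T) :: 'a \<Rightarrow> real)"
proof -
  have "measure nu (shell (exp T) (exp (T + 1)) :: 'a set) = measure nu (shell 1 (exp 1) :: 'a set)"
    using measure_nu_shell_dilation[of "exp T" 1 "exp 1"] by (simp add: exp_add)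
  moreover have "measure nu (shell (exp (- (T + 1))) (exp (- T)) :: 'a set) = measure nu (shell 1 (exp 1) :: 'a set)"
    using measure_nu_shell_dilation[of "exp (- (T + 1))" 1 "exp 1"] by (simp add: exp_add[symmetric])
  moreover have "measure nu (collar T) \<le> measure nu (shell (exp T) (exp (T + 1)) :: 'a set)
      + measure nu (shell (exp (- (T + 1))) (exp (- T)) :: 'a set)"
    by (intro measure_Un_le) auto
  ultimately show "measure nu (collar T) \<le> 2 * measure nu (shell 1 (exp 1) :: 'a set)" by linarith
  have "collar T \<in> fmeasurable nu"
    by (intro fmeasurable.Un) (auto simp: fmeasurable_def emeasure_nu_shell_finite[unfolded infinity_ennreal_def])
  then show "integrable nu (indicator (collar T) :: 'a \<Rightarrow> real)"
    by (simp add: integrable_indicator_iff fmeasurable_def)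
qed

text \<open>The collar term is estimated by Young's inequality and the growth bound for
  \<open>P\<close>, so that part of it is absorbed by the left side; the rest is bounded by the
  measure of the collars. A single sign, here \<open>\<sigma> = 1\<close>, suffices.\<close>

lemma energy_bounded:
  obtains C where "0 \<le> C" "\<And>T. 0 < T \<Longrightarrow> (LINT x|nu. \<eta> T x * gap x) \<le> C"
proof -
  let ?A = "exp (- ((K + 1) * W))" and ?B = "exp ((K + 1) * W)"
  obtain K1 where K1: "0 \<le> K1" "\<And>x. x \<noteq> 0 \<Longrightarrow> norm (P x) powr p \<le> 2 * gap x + K1"
    using P_growth by blast
  \<comment> \<open>Makes the collar contribution \<open>?B * (2 * e)\<close> exactly half of the
    coefficient \<open>?A\<close> on the left.\<close>
  define e where "e = ?A / (4 * ?B)"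
  have e: "0 < e" by (simp add: e_def)
  define D where "D = e * K1 + (2 * real m) powr p * e powr (1 - p) + 2 * real m * \<bar>\<gamma>\<bar> powr (p - 1)"
  define V where "V = measure nu (shell 1 (exp 1) :: 'a set)"
  have D0: "0 \<le> D" using e K1 m by (simp add: D_def)
  have est: "\<bar>\<eta>' T x\<bar> * \<bar>M x \<bullet> sgn x\<bar> \<le> 2 * e * (\<eta> T x * gap x) + D * indicator (collar T) x"
    if T: "0 < T" for T and x :: 'a
  proof (cases "\<eta>' T x = 0")
    case True
    then show ?thesis using e D0 gap_nonneg[of x] cutoff_bounds[of m T 1 x] by simp
  next
    case False
    then have x0: "x \<noteq> 0" and xt: "x \<in> collar T"
      using cutoff'_supp[OF T _ m(1) False] by (auto simp: cutoff'_def)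
    have \<eta>: "0 \<le> \<eta> T x" "\<eta> T x \<le> 1" by (rule cutoff_bounds)+
    have "\<bar>M x \<bullet> sgn x\<bar> \<le> norm (M x)" using Cauchy_Schwarz_ineq2[of "M x" "sgn x"] x0 by (simp add: norm_sgn)
    also have "\<dots> \<le> norm (P x) powr (p - 1) + \<bar>\<gamma>\<bar> powr (p - 1)"
      unfolding M_def using norm_triangle_ineq4[of "flux p (P x)" "flux p (R x)"] norm_R[OF x0]
      by (simp add: norm_flux)
    finally have "\<bar>\<eta>' T x\<bar> * \<bar>M x \<bullet> sgn x\<bar> \<le> \<bar>\<eta>' T x\<bar> * (norm (P x) powr (p - 1) + \<bar>\<gamma>\<bar> powr (p - 1))"
      by (intro mult_left_mono) auto
    also have "\<dots> = \<bar>\<eta>' T x\<bar> * norm (P x) powr (p - 1) + \<bar>\<eta>' T x\<bar> * \<bar>\<gamma>\<bar> powr (p - 1)"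
      by (simp add: distrib_left)
    also have "\<dots> \<le> 2 * real m * \<eta> T x powr ((p - 1) / p) * norm (P x) powr (p - 1) + 2 * real m * \<bar>\<gamma>\<bar> powr (p - 1)"
      using cutoff'_bound[OF T zero_less_one m p, of x] cutoff'_le[OF T zero_less_one m(1), of x]
      by (intro add_mono mult_right_mono) auto
    also have "2 * real m * \<eta> T x powr ((p - 1) / p) * norm (P x) powr (p - 1)
        \<le> e * (\<eta> T x * norm (P x) powr p) + (2 * real m) powr p * e powr (1 - p)"
      using \<eta> e p by (intro powr_young) auto
    also have "e * (\<eta> T x * norm (P x) powr p) \<le> e * (\<eta> T x * (2 * gap x + K1))"
      using K1(2)[OF x0] \<eta> e by (intro mult_left_mono) auto
    also have "\<dots> = 2 * e * (\<eta> T x * gap x) + e * (\<eta> T x * K1)" by (simp add: algebra_simps)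
    also have "e * (\<eta> T x * K1) \<le> e * (1 * K1)"
      using \<eta> e K1 by (intro mult_left_mono mult_right_mono) auto
    finally show ?thesis using xt by (simp add: D_def)
  qed
  let ?C = "(?B * (D * (2 * V)) + \<bar>\<beta>\<bar> * (2 * real m * ?B * (2 * V))) / (?A / 2)"
  have "(LINT x|nu. \<eta> T x * gap x) \<le> ?C" if T: "0 < T" for T
  proof -
    have Me: "continuous_on (- {0}) (\<lambda>x. M x \<bullet> sgn x)"
      by (intro continuous_intros M_cont continuous_on_sgn_punctured)
    have i1: "integrable nu (\<lambda>x. \<eta> T x * gap x)" by (rule integrable_\<eta>(1)[OF T gap_cont])
    have i2: "integrable nu (\<lambda>x. \<bar>\<eta>' T x\<bar> * \<bar>M x \<bullet> sgn x\<bar>)"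
      using integrable_\<eta>(2)[OF T Me] by (simp add: abs_mult[symmetric])
    have i3: "integrable nu (\<lambda>x. \<eta>' T x * H 1 (w x))" by (rule integrable_\<eta>(2)[OF T Hw_cont])
    have mt: "measure nu (collar T) \<le> 2 * V" using collar_measure by (simp add: V_def)
    have "(LINT x|nu. \<bar>\<eta>' T x\<bar> * \<bar>M x \<bullet> sgn x\<bar>)
        \<le> (LINT x|nu. 2 * e * (\<eta> T x * gap x) + D * indicator (collar T) x)"
      using i1 i2 collar_integrable[of T] est[OF T] by (intro integral_mono) auto
    also have "\<dots> = 2 * e * (LINT x|nu. \<eta> T x * gap x) + D * measure nu (collar T)"
      using i1 collar_integrable[of T] by simp
    also have "\<dots> \<le> 2 * e * (LINT x|nu. \<eta> T x * gap x) + D * (2 * V)"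
      using mt D0 by (intro add_left_mono mult_left_mono) auto
    finally have 1: "(LINT x|nu. \<bar>\<eta>' T x\<bar> * \<bar>M x \<bullet> sgn x\<bar>)
      \<le> 2 * e * (LINT x|nu. \<eta> T x * gap x) + D * (2 * V)" .
    have "\<bar>(LINT x|nu. \<eta>' T x * H 1 (w x))\<bar> \<le> (LINT x|nu. 2 * real m * ?B * indicator (collar T) x)"
    proof (rule integral_abs_bound[THEN order_trans], rule integral_mono)
      fix x :: 'a
      show "\<bar>\<eta>' T x * H 1 (w x)\<bar> \<le> 2 * real m * ?B * indicator (collar T) x"
      proof (cases "\<eta>' T x = 0")
        case False
        then have x0: "x \<noteq> 0" and xt: "x \<in> collar T"
          using cutoff'_supp[OF T _ m(1) False] by (auto simp: cutoff'_def)
        have "\<bar>\<eta>' T x\<bar> * \<bar>H 1 (w x)\<bar> \<le> 2 * real m * ?B"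
          using cutoff'_le[OF T zero_less_one m(1), of x] H_bounds(3,4)[OF _ w_le[OF x0], of 1]
          by (intro mult_mono) auto
        then show ?thesis using xt by (simp add: abs_mult)
      qed simp
    qed (use i3 collar_integrable[of T] in auto)
    also have "\<dots> = 2 * real m * ?B * measure nu (collar T)" using collar_integrable[of T] by simp
    also have "\<dots> \<le> 2 * real m * ?B * (2 * V)" using mt by (intro mult_left_mono) auto
    finally have "\<bar>\<beta>\<bar> * \<bar>(LINT x|nu. \<eta>' T x * H 1 (w x))\<bar> \<le> \<bar>\<beta>\<bar> * (2 * real m * ?B * (2 * V))"
      by (intro mult_left_mono) auto
    then have 2: "- (\<beta> * (LINT x|nu. \<eta>' T x * H 1 (w x))) \<le> \<bar>\<beta>\<bar> * (2 * real m * ?B * (2 * V))"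
      unfolding abs_mult[symmetric] by linarith
    have "?A * (LINT x|nu. \<eta> T x * gap x)
        \<le> ?B * (2 * e * (LINT x|nu. \<eta> T x * gap x) + D * (2 * V)) + \<bar>\<beta>\<bar> * (2 * real m * ?B * (2 * V))"
    proof -
      have "?B * (LINT x|nu. \<bar>\<eta>' T x\<bar> * \<bar>M x \<bullet> sgn x\<bar>)
          \<le> ?B * (2 * e * (LINT x|nu. \<eta> T x * gap x) + D * (2 * V))"
        by (rule mult_left_mono[OF 1]) simp
      then show ?thesis using energy_inequality[OF T disjI1[OF refl]] 2 by linarith
    qed
    also have "?B * (2 * e * (LINT x|nu. \<eta> T x * gap x) + D * (2 * V))
        = ?A / 2 * (LINT x|nu. \<eta> T x * gap x) + ?B * (D * (2 * V))"
      by (simp add: e_def distrib_left)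
    finally have "?A / 2 * (LINT x|nu. \<eta> T x * gap x) \<le> ?B * (D * (2 * V)) + \<bar>\<beta>\<bar> * (2 * real m * ?B * (2 * V))"
      by (simp add: algebra_simps)
    then show ?thesis by (subst pos_le_divide_eq) (auto simp: mult.commute)
  qed
  moreover have "0 \<le> ?C" using D0 by (simp add: V_def)
  ultimately show ?thesis using that by blast
qed

section \<open>Behaviour towards the origin and infinity\<close>

lemma gap_tail:
  fixes c :: nat
  assumes "0 < \<epsilon>"
  obtains k0 where "\<And>k. k0 \<le> k \<Longrightarrow>
      (LINT x|nu. indicator (shell (exp (real k - real c)) (exp (real k + real c))) x * gap x) \<le> \<epsilon>"
    "\<And>k. k0 \<le> k \<Longrightarrow>
      (LINT x|nu. indicator (shell (exp (- real k - real c)) (exp (- real k + real c))) x * gap x) \<le> \<epsilon>"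
proof -
  define S :: "nat \<Rightarrow> 'a set" where "S k = shell (exp (- real k)) (exp (real k))" for k
  define t where "t k = (LINT x|nu. indicator (S k) x * gap x)" for k
  have i: "integrable nu (\<lambda>x. indicator (S k) x * gap x)" for k
    unfolding S_def by (rule integrable_nu_indicator_shell[OF gap_cont]) simp
  obtain C where C: "\<And>T. 0 < T \<Longrightarrow> (LINT x|nu. \<eta> T x * gap x) \<le> C"
    using energy_bounded by blast
  have Smono: "S j \<subseteq> S k" if "j \<le> k" for j k
  proof
    fix x assume "x \<in> S j"
    moreover have "exp (- real k) \<le> exp (- real j)" "exp (real j) \<le> exp (real k)" using that by auto
    ultimately show "x \<in> S k" unfolding S_def shell_def mem_Collect_eq by linarith
  qed
  have inc: "incseq t"
  proof (rule incseq_SucI)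
    fix k
    show "t k \<le> t (Suc k)" unfolding t_def
      using i gap_nonneg Smono[of k "Suc k"] by (intro integral_mono) (auto simp: indicator_def)
  qed
  have bd: "t k \<le> C" for k
  proof -
    have "t k \<le> (LINT x|nu. \<eta> (real k + 1) x * gap x)"
      unfolding t_def
    proof (rule integral_mono)
      show "integrable nu (\<lambda>x. \<eta> (real k + 1) x * gap x)" by (intro integrable_\<eta> gap_cont) auto
      fix x :: 'a
      have "x \<in> shell (exp (- (real k + 1))) (exp (real k + 1))" if "x \<in> S k"
        using Smono[of k "Suc k"] that by (auto simp: S_def add.commute)
      then show "indicator (S k) x * gap x \<le> \<eta> (real k + 1) x * gap x"
        using gap_nonneg[of x] cutoff_bounds[of m "real k + 1" 1 x] cutoff_eq_1[of 1 x "real k + 1" m]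
        by (cases "x \<in> S k") auto
    qed (rule i)
    then show ?thesis using C[of "real k + 1"] by simp
  qed
  obtain l where l: "t \<longlonglongrightarrow> l" "\<And>k. t k \<le> l"
    using incseq_convergent[OF inc] bd by blast
  have "\<forall>\<^sub>F k in sequentially. l - \<epsilon> < t k" using l(1) \<open>0 < \<epsilon>\<close> by (intro order_tendstoD) auto
  then obtain k1 where k1: "\<And>k. k1 \<le> k \<Longrightarrow> l - \<epsilon> < t k" by (auto simp: eventually_sequentially)
  \<comment> \<open>The extra 1 in \<open>k - c - 1\<close> separates closed sets:
    \<open>S (k - c)\<close> would share a boundary sphere with the shell. The condition on
    \<open>k\<close> also keeps the subtraction of naturals exact.\<close>
  have main: "(LINT x|nu. indicator Z x * gap x) \<le> \<epsilon>"
    if k: "k1 + c + 1 \<le> k" and Z: "Z \<subseteq> S (k + c)" "Z \<inter> S (k - c - 1) = {}"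
      and Zi: "integrable nu (\<lambda>x. indicator Z x * gap x)" for k Z
  proof -
    have "(LINT x|nu. indicator Z x * gap x) + t (k - c - 1)
      = (LINT x|nu. indicator Z x * gap x + indicator (S (k - c - 1)) x * gap x)"
      unfolding t_def using Zi i by simp
    also have "\<dots> \<le> t (k + c)" unfolding t_def
    proof (rule integral_mono)
      fix x :: 'a
      show "indicator Z x * gap x + indicator (S (k - c - 1)) x * gap x \<le> indicator (S (k + c)) x * gap x"
      proof -
        have "S (k - c - 1) \<subseteq> S (k + c)" by (rule Smono) simp
        then show ?thesis using Z gap_nonneg[of x] by (auto simp: indicator_def)
      qed
    qed (use Zi i in auto)
    also have "\<dots> \<le> l" by (rule l)
    finally have "(LINT x|nu. indicator Z x * gap x) + t (k - c - 1) \<le> l" .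
    moreover have "k1 \<le> k - c - 1" using k by linarith
    ultimately show ?thesis using k1[of "k - c - 1"] by simp
  qed
  show ?thesis
  proof (rule that[of "k1 + c + 1"])
    fix k assume k: "k1 + c + 1 \<le> k"
    have e: "exp (- (real k + real c)) \<le> exp (real k - real c)" "exp (- real k + real c) \<le> exp (real k + real c)"
      "exp (real k - real c - 1) < exp (real k - real c)" "exp (- real k + real c) < exp (- (real k - real c - 1))"
      using k by auto
    have rk: "real (k - c - 1) = real k - real c - 1" "real (k + c) = real k + real c" using k by auto
    show "(LINT x|nu. indicator (shell (exp (real k - real c)) (exp (real k + real c))) x * gap x) \<le> \<epsilon>"
    proof (rule main[OF k])
      show "shell (exp (real k - real c)) (exp (real k + real c)) \<subseteq> S (k + c)"
        unfolding S_def rk shell_def using e by (smt (verit) Collect_mono)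
      show "shell (exp (real k - real c)) (exp (real k + real c)) \<inter> S (k - c - 1) = {}"
        unfolding S_def rk shell_def using e by (smt (verit) Collect_empty_eq Int_Collect mem_Collect_eq disjoint_iff)
    qed (simp add: integrable_nu_indicator_shell[OF gap_cont])
    show "(LINT x|nu. indicator (shell (exp (- real k - real c)) (exp (- real k + real c))) x * gap x) \<le> \<epsilon>"
    proof (rule main[OF k])
      have *: "- real k - real c = - (real k + real c)" by simp
      show "shell (exp (- real k - real c)) (exp (- real k + real c)) \<subseteq> S (k + c)"
        unfolding S_def rk shell_def * using e by (smt (verit) Collect_mono)
      show "shell (exp (- real k - real c)) (exp (- real k + real c)) \<inter> S (k - c - 1) = {}"
        unfolding S_def rk shell_def using e by (smt (verit) Collect_empty_eq Int_Collect mem_Collect_eq disjoint_iff)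
    qed (simp add: integrable_nu_indicator_shell[OF gap_cont])
  qed
qed

text \<open>\<open>Q_le\<close> trades \<open>|Q|\<close> for the gap at the price of a small
  \<open>d\<close>, which is multiplied by the shell measure; by dilation invariance that measure
  does not depend on \<open>k\<close>. The gap itself is handled by \<open>gap_tail\<close>.
  \<theta> = 1 is the end at infinity, \<theta> = -1 the end at the origin.\<close>

lemma small_shells:
  fixes c :: nat
  assumes "0 < \<epsilon>"
  obtains k0 where "\<And>k \<theta>. k0 \<le> k \<Longrightarrow> \<theta> = 1 \<or> \<theta> = -1 \<Longrightarrow>
      (LINT x|nu. indicator (shell (exp (\<theta> * real k - real c)) (exp (\<theta> * real k + real c))) x * (norm (Q x) + gap x)) \<le> \<epsilon>"
proof -
  define V where "V = measure nu (shell (exp (- real c)) (exp (real c)) :: 'a set)"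
  have V: "0 \<le> V" by (simp add: V_def)
  define d where "d = \<epsilon> / (2 * (V + 1))"
  have d: "0 < d" "d * V \<le> \<epsilon> / 2"
    using assms V by (auto simp: d_def field_simps)
  obtain C where C: "0 \<le> C" "\<And>x. x \<noteq> 0 \<Longrightarrow> norm (Q x) \<le> d + C * gap x" using Q_le[OF d(1)] by blast
  define e where "e = (\<epsilon> / 2) / (C + 1)"
  have e: "0 < e" "(C + 1) * e = \<epsilon> / 2"
  proof -
    show "0 < e" using assms C(1) by (auto simp: e_def)
    have "(C + 1) * (y / (C + 1)) = y" for y using C(1) by simp
    then show "(C + 1) * e = \<epsilon> / 2" unfolding e_def .
  qed
  obtain k0 where k0: "\<And>k. k0 \<le> k \<Longrightarrow>
      (LINT x|nu. indicator (shell (exp (real k - real c)) (exp (real k + real c))) x * gap x) \<le> e"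
    "\<And>k. k0 \<le> k \<Longrightarrow>
      (LINT x|nu. indicator (shell (exp (- real k - real c)) (exp (- real k + real c))) x * gap x) \<le> e"
    using gap_tail[OF e(1), of c] by blast
  show ?thesis
  proof (rule that)
    fix k :: nat and \<theta> :: real assume k: "k0 \<le> k" and \<theta>: "\<theta> = 1 \<or> \<theta> = -1"
    let ?S = "shell (exp (\<theta> * real k - real c)) (exp (\<theta> * real k + real c)) :: 'a set"
    have S0: "0 \<notin> ?S" by (simp add: shell_def)
    have 1: "(LINT x|nu. indicator ?S x * gap x) \<le> e" using \<theta> k0[OF k] by auto
    have 2: "measure nu ?S = V"
      using measure_nu_shell_dilation[of "exp (\<theta> * real k)" "exp (- real c)" "exp (real c)", where 'a = 'a]
      by (simp add: V_def exp_add[symmetric] exp_diff exp_minus field_simps)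
    have i: "integrable nu (\<lambda>x. indicator ?S x * gap x)" by (rule integrable_nu_indicator_shell[OF gap_cont]) simp
    have iS: "integrable nu (indicator ?S :: 'a \<Rightarrow> real)" by (rule integrable_indicator_shell) simp
    have "(LINT x|nu. indicator ?S x * (norm (Q x) + gap x))
        \<le> (LINT x|nu. d * indicator ?S x + (C + 1) * (indicator ?S x * gap x))"
    proof (rule integral_mono)
      show "integrable nu (\<lambda>x. indicator ?S x * (norm (Q x) + gap x))"
        by (intro integrable_nu_indicator_shell continuous_intros Q_cont gap_cont) auto
      fix x :: 'a
      show "indicator ?S x * (norm (Q x) + gap x) \<le> d * indicator ?S x + (C + 1) * (indicator ?S x * gap x)"
        using C(2)[of x] S0 by (cases "x \<in> ?S") (auto simp: algebra_simps)
    qed (use i iS in auto)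
    also have "\<dots> = d * V + (C + 1) * (LINT x|nu. indicator ?S x * gap x)"
      using i iS 2 by simp
    also have "\<dots> \<le> \<epsilon> / 2 + (C + 1) * e"
      using 1 d C by (intro add_mono mult_left_mono) auto
    finally show "(LINT x|nu. indicator ?S x * (norm (Q x) + gap x)) \<le> \<epsilon>" using e by simp
  qed
qed

text \<open>The two collars lie in the shells of \<open>small_shells\<close> with
  \<open>c = 1\<close>, and there \<open>M_sgn_le\<close> bounds the integrand by a multiple of
  \<open>|Q| + gap\<close>.\<close>

lemma collar_error:
  assumes "0 < \<epsilon>"
  obtains k0 where "\<And>k. k0 \<le> k \<Longrightarrow> 1 \<le> k \<Longrightarrow> (LINT x|nu. \<bar>\<eta>' (real k) x\<bar> * \<bar>M x \<bullet> sgn x\<bar>) \<le> \<epsilon>"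
proof -
  define D where "D = 2 * real m * ((p - 1) * \<bar>\<gamma>\<bar> powr (p - 2) + p / \<bar>\<gamma>\<bar>)"
  have D: "0 < D" using m p \<gamma> by (auto simp: D_def intro!: mult_pos_pos add_pos_pos divide_pos_pos)
  have D1: "2 * real m * \<bar>M x \<bullet> sgn x\<bar> \<le> D * (norm (Q x) + gap x)" if "x \<noteq> 0" for x
  proof -
    let ?a = "(p - 1) * \<bar>\<gamma>\<bar> powr (p - 2)" and ?b = "p / \<bar>\<gamma>\<bar>"
    have ab: "0 \<le> ?a" "0 \<le> ?b" using p by auto
    have "?a * norm (Q x) + ?b * gap x \<le> (?a + ?b) * norm (Q x) + (?a + ?b) * gap x"
      using ab gap_nonneg[of x] by (intro add_mono mult_right_mono) auto
    then have "\<bar>M x \<bullet> sgn x\<bar> \<le> (?a + ?b) * (norm (Q x) + gap x)"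
      using M_sgn_le[OF that] by (simp add: distrib_left)
    then have "2 * real m * \<bar>M x \<bullet> sgn x\<bar> \<le> 2 * real m * ((?a + ?b) * (norm (Q x) + gap x))"
      by (intro mult_left_mono) auto
    then show ?thesis by (simp add: D_def mult.assoc)
  qed
  obtain k0 where k0: "\<And>k \<theta>. k0 \<le> k \<Longrightarrow> \<theta> = 1 \<or> \<theta> = -1 \<Longrightarrow>
      (LINT x|nu. indicator (shell (exp (\<theta> * real k - real 1)) (exp (\<theta> * real k + real 1))) x * (norm (Q x) + gap x)) \<le> \<epsilon> / (2 * D)"
    using small_shells[of "\<epsilon> / (2 * D)" 1] assms D by auto
  show ?thesis
  proof (rule that)
    fix k :: nat assume k: "k0 \<le> k" "1 \<le> k"
    let ?k = "real k"
    let ?S = "\<lambda>\<theta>. shell (exp (\<theta> * ?k - real 1)) (exp (\<theta> * ?k + real 1)) :: 'a set"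
    let ?q = "\<lambda>x. norm (Q x) + gap x"
    have T: "0 < ?k" using k by simp
    have Me: "continuous_on (- {0}) (\<lambda>x. M x \<bullet> sgn x)"
      by (intro continuous_intros M_cont continuous_on_sgn_punctured)
    have i2: "integrable nu (\<lambda>x. \<bar>\<eta>' ?k x\<bar> * \<bar>M x \<bullet> sgn x\<bar>)"
      using integrable_\<eta>(2)[OF T Me] by (simp add: abs_mult[symmetric])
    have i: "integrable nu (\<lambda>x. indicator (?S \<theta>) x * ?q x)" for \<theta>
      by (intro integrable_nu_indicator_shell continuous_intros Q_cont gap_cont) auto
    have "(LINT x|nu. \<bar>\<eta>' ?k x\<bar> * \<bar>M x \<bullet> sgn x\<bar>)
      \<le> (LINT x|nu. D * (indicator (?S 1) x * ?q x) + D * (indicator (?S (-1)) x * ?q x))"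
    proof (rule integral_mono)
      fix x :: 'a
      have q: "0 \<le> ?q x" using gap_nonneg by simp
      show "\<bar>\<eta>' ?k x\<bar> * \<bar>M x \<bullet> sgn x\<bar> \<le> D * (indicator (?S 1) x * ?q x) + D * (indicator (?S (-1)) x * ?q x)"
      proof (cases "\<eta>' ?k x = 0")
        case True
        then show ?thesis using D q by simp
      next
        case False
        then have x0: "x \<noteq> 0" and xt: "x \<in> collar ?k"
          using cutoff'_supp[OF T _ m(1) False] by (auto simp: cutoff'_def)
        have "\<bar>\<eta>' ?k x\<bar> * \<bar>M x \<bullet> sgn x\<bar> \<le> 2 * real m * \<bar>M x \<bullet> sgn x\<bar>"
          using cutoff'_le[OF T zero_less_one m(1), of x] by (intro mult_right_mono) auto
        also have "\<dots> \<le> D * ?q x" by (rule D1[OF x0])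
        finally have le: "\<bar>\<eta>' ?k x\<bar> * \<bar>M x \<bullet> sgn x\<bar> \<le> D * ?q x" .
        have "exp (?k - 1) \<le> exp ?k" "exp (- ?k) \<le> exp (- ?k + 1)" by auto
        moreover have "- (?k + 1) = - ?k - 1" by simp
        ultimately have "x \<in> ?S 1 \<or> x \<in> ?S (-1)"
          using xt unfolding Un_iff shell_def mem_Collect_eq by (smt (verit) of_nat_1 mult_1 mult_minus1)
        then show ?thesis using le D q by (auto simp: add_increasing add_increasing2)
      qed
    qed (intro Bochner_Integration.integrable_add integrable_mult_right i i2)+
    also have "\<dots> = D * (LINT x|nu. indicator (?S 1) x * ?q x) + D * (LINT x|nu. indicator (?S (-1)) x * ?q x)"
      using i[of 1] i[of "-1"] by simp
    also have "\<dots> \<le> D * (\<epsilon> / (2 * D)) + D * (\<epsilon> / (2 * D))"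
      using k0[OF k(1), of 1] k0[OF k(1), of "-1"] D by (intro add_mono mult_left_mono) auto
    also have "\<dots> = \<epsilon>" using D by simp
    finally show "(LINT x|nu. \<bar>\<eta>' ?k x\<bar> * \<bar>M x \<bullet> sgn x\<bar>) \<le> \<epsilon>" .
  qed
qed

text \<open>Dilating the shell around \<open>|x| = exp (\<theta> k)\<close> to unit size lets a
  single Poincare constant serve all \<open>k\<close>. The constant found is a value of
  \<open>w\<close>, hence bounded by \<open>W\<close>; it may depend on \<open>k\<close>.\<close>

lemma end_concentration:
  assumes "0 < \<epsilon>"
  obtains k0 where "\<And>k \<theta>. k0 \<le> k \<Longrightarrow> \<theta> = 1 \<or> \<theta> = -1 \<Longrightarrow> \<exists>c. \<bar>c\<bar> \<le> W \<and>
    (LINT x|nu. indicator (shell (exp (-1)) (exp 1)) x * \<bar>w (exp (\<theta> * real k) *\<^sub>R x) - c\<bar>) \<le> \<epsilon>"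
proof -
  let ?n = "real DIM('a)"
  define \<rho> where "\<rho> = exp (- 1) / ?n"
  define r where "r = ?n * exp 1"
  have n: "1 \<le> ?n" by (simp add: Suc_leI)
  have \<rho>: "0 < \<rho>" "\<rho> < exp 1"
  proof -
    show "0 < \<rho>" using n by (simp add: \<rho>_def)
    have "\<rho> \<le> exp (- 1) / 1" unfolding \<rho>_def using n by (intro divide_left_mono) auto
    also have "\<dots> < exp 1" by simp
    finally show "\<rho> < exp 1" .
  qed
  have r: "0 < r" using n by (simp add: r_def)
  let ?E = "cube_shell \<rho> (exp 1) :: 'a set"
  have E1: "shell (exp (- 1)) (exp 1) \<subseteq> ?E" unfolding \<rho>_def by (rule shell_subset_cube_shell)
  have Em: "?E \<in> sets borel" by (rule borel_compact[OF cube_shell_compact])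
  have E2: "?E \<subseteq> shell \<rho> r" using cube_shell_subset_shell[OF \<rho>(1), of "exp 1"] by (simp add: r_def)
  obtain C where C: "0 < C"
    "\<And>w G \<epsilon>. C1_punctured w G \<Longrightarrow> 0 < \<epsilon> \<Longrightarrow>
      (\<integral>\<^sup>+z. indicator ?E z * ennreal (norm (G z)) \<partial>lborel) \<le> ennreal \<epsilon> \<Longrightarrow>
      \<exists>y\<in>?E. (\<integral>\<^sup>+x. indicator ?E x * ennreal \<bar>w y - w x\<bar> \<partial>lborel) \<le> ennreal (C * \<epsilon>)"
    using cube_shell_concentration[OF dim \<rho>] by blast
  \<comment> \<open>Converts the \<open>nu\<close>-integral of \<open>|Q|\<close> into a Lebesgue
    integral of the gradient on \<open>shell \<rho> r\<close>: the density is at least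
    \<open>r powr (- n)\<close>, and the gradient is \<open>|Q| / |x|\<close>.\<close>
  define F where "F = r powr ?n / \<rho>"
  have F: "0 < F" using r \<rho> by (simp add: F_def)
  \<comment> \<open>Largest value of the density of \<open>nu\<close> on
    \<open>shell (exp (- 1)) (exp 1)\<close>.\<close>
  define B where "B = exp 1 powr ?n"
  have B: "0 < B" by (simp add: B_def)
  define e where "e = \<epsilon> / (B * C)"
  have e: "0 < e" using assms B C by (simp add: e_def)
  \<comment> \<open>Large enough that \<open>shell \<rho> r\<close> lies between the radii
    \<open>exp (- c)\<close> and \<open>exp c\<close>.\<close>
  obtain c :: nat where c: "max (- ln \<rho>) (ln r) \<le> real c" using real_arch_simple by blast
  have c1: "exp (- real c) \<le> \<rho>"
  proof -
    have "exp (- real c) \<le> exp (ln \<rho>)" unfolding exp_le_cancel_iff using c by linarith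
    then show ?thesis using \<rho> by simp
  qed
  have c2: "r \<le> exp (real c)"
  proof -
    have "exp (ln r) \<le> exp (real c)" unfolding exp_le_cancel_iff using c by linarith
    then show ?thesis using r by simp
  qed
  obtain k0 where k0: "\<And>k \<theta>. k0 \<le> k \<Longrightarrow> \<theta> = 1 \<or> \<theta> = -1 \<Longrightarrow>
      (LINT x|nu. indicator (shell (exp (\<theta> * real k - real c)) (exp (\<theta> * real k + real c))) x * (norm (Q x) + gap x)) \<le> e / F"
    using small_shells[OF divide_pos_pos[OF e F], of c] by blast
  show ?thesis
  proof (rule that)
    fix k :: nat and \<theta> :: real assume k: "k0 \<le> k" and \<theta>: "\<theta> = 1 \<or> \<theta> = -1"
    define t where "t = exp (\<theta> * real k)"
    have t: "0 < t" by (simp add: t_def)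
    define wt where "wt x = w (t *\<^sub>R x)" for x
    define G where "G x = t *\<^sub>R ((1 / norm (t *\<^sub>R x)) *\<^sub>R Q (t *\<^sub>R x))" for x
    have wt: "C1_punctured wt G" unfolding wt_def G_def using t by (intro C1_punctured_dilation w_C1) auto
    have nG: "norm (G x) = norm (Q (t *\<^sub>R x)) / norm x" for x using t by (simp add: G_def)
    have Qt: "continuous_on (- {0}) (\<lambda>x. norm (Q (t *\<^sub>R x)))"
      by (intro continuous_intros continuous_on_dilation[OF t Q_cont])
    have iQ: "integrable nu (\<lambda>x. indicator (shell \<rho> r) x * norm (Q (t *\<^sub>R x)))"
      by (rule integrable_nu_indicator_shell[OF Qt \<rho>(1)])
    have mQ: "(\<lambda>x. indicator (shell \<rho> r) x * norm (Q (t *\<^sub>R x))) \<in> borel_measurable borel"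
      using iQ by (simp add: measurable_cong_sets[OF sets_nu refl] integrable_iff_bounded)
    have int1: "(LINT x|nu. indicator (shell \<rho> r) x * norm (Q (t *\<^sub>R x))) \<le> e / F"
    proof -
      let ?S = "shell (exp (\<theta> * real k - real c)) (exp (\<theta> * real k + real c)) :: 'a set"
      have sub: "t *\<^sub>R x \<in> ?S" if "x \<in> shell \<rho> r" for x
      proof -
        have "t * exp (- real c) \<le> t * norm x" "t * norm x \<le> t * exp (real c)"
          using that c1 c2 t by (auto simp: shell_def intro!: mult_left_mono)
        then show ?thesis using t by (simp add: shell_def t_def exp_add exp_diff exp_minus field_simps)
      qed
      have i: "integrable nu (\<lambda>x. indicator ?S x * (norm (Q x) + gap x))"
        by (intro integrable_nu_indicator_shell continuous_intros Q_cont gap_cont) auto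
      have m: "(\<lambda>x. indicator ?S x * (norm (Q x) + gap x)) \<in> borel_measurable borel"
        using i by (simp add: measurable_cong_sets[OF sets_nu refl] integrable_iff_bounded)
      have q: "continuous_on (- {0}) (\<lambda>x. norm (Q x) + gap x)" by (intro continuous_intros Q_cont gap_cont)
      have eq: "indicator ?S (t *\<^sub>R x) = (indicator (shell (exp (- real c)) (exp (real c))) x :: real)" for x :: 'a
      proof -
        have "t *\<^sub>R x \<in> ?S \<longleftrightarrow> t * exp (- real c) \<le> t * norm x \<and> t * norm x \<le> t * exp (real c)"
          using t by (simp add: shell_def t_def exp_add exp_diff exp_minus field_simps)
        also have "\<dots> \<longleftrightarrow> x \<in> shell (exp (- real c)) (exp (real c))" using t by (simp add: shell_def)
        finally show ?thesis by (simp add: indicator_def)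
      qed
      have "(LINT x|nu. indicator (shell \<rho> r) x * norm (Q (t *\<^sub>R x)))
        \<le> (LINT x|nu. indicator ?S (t *\<^sub>R x) * (norm (Q (t *\<^sub>R x)) + gap (t *\<^sub>R x)))"
      proof (rule integral_mono[OF iQ])
        show "integrable nu (\<lambda>x. indicator ?S (t *\<^sub>R x) * (norm (Q (t *\<^sub>R x)) + gap (t *\<^sub>R x)))"
          unfolding eq by (intro integrable_nu_indicator_shell continuous_on_dilation[OF t q]) auto
        fix x :: 'a
        show "indicator (shell \<rho> r) x * norm (Q (t *\<^sub>R x)) \<le> indicator ?S (t *\<^sub>R x) * (norm (Q (t *\<^sub>R x)) + gap (t *\<^sub>R x))"
          using sub[of x] gap_nonneg[of "t *\<^sub>R x"] by (cases "x \<in> shell \<rho> r") auto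
      qed
      also have "\<dots> = (LINT x|nu. indicator ?S x * (norm (Q x) + gap x))"
        by (rule integral_nu_dilation[OF m t])
      also have "\<dots> \<le> e / F" by (rule k0[OF k \<theta>])
      finally show ?thesis .
    qed
    let ?f = "\<lambda>x. norm x powr (- ?n) * (F * (indicator (shell \<rho> r) x * norm (Q (t *\<^sub>R x))))"
    have fint: "integrable lborel ?f"
      using iQ mQ by (subst integrable_nu[symmetric]) auto
    have "(\<integral>\<^sup>+z. indicator ?E z * ennreal (norm (G z)) \<partial>lborel) \<le> (\<integral>\<^sup>+z. ennreal (?f z) \<partial>lborel)"
    proof (rule nn_integral_mono)
      fix z :: 'a
      show "indicator ?E z * ennreal (norm (G z)) \<le> ennreal (?f z)"
      proof (cases "z \<in> ?E")
        case True
        then have z: "z \<in> shell \<rho> r" using E2 by blast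
        then have zn: "\<rho> \<le> norm z" "norm z \<le> r" "0 < norm z" using \<rho> by (auto simp: shell_def)
        have "1 = norm z powr (- ?n) * norm z powr ?n" using zn by (simp add: powr_add[symmetric])
        also have "\<dots> \<le> norm z powr (- ?n) * r powr ?n"
          using zn by (intro mult_left_mono powr_mono2) auto
        finally have 1: "1 \<le> norm z powr (- ?n) * r powr ?n" .
        have "norm (G z) \<le> norm (Q (t *\<^sub>R z)) / \<rho>" unfolding nG using zn \<rho> by (intro divide_left_mono) auto
        also have "\<dots> = 1 * (norm (Q (t *\<^sub>R z)) / \<rho>)" by simp
        also have "\<dots> \<le> norm z powr (- ?n) * r powr ?n * (norm (Q (t *\<^sub>R z)) / \<rho>)"
          using 1 \<rho> by (intro mult_right_mono) auto
        finally have "norm (G z) \<le> ?f z" using z by (simp add: F_def)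
        then show ?thesis using True by (simp add: ennreal_leI)
      qed simp
    qed
    also have "\<dots> = ennreal (LINT z|lborel. ?f z)"
      using fint F by (intro nn_integral_eq_integral) auto
    also have "(LINT z|lborel. ?f z) = (LINT x|nu. F * (indicator (shell \<rho> r) x * norm (Q (t *\<^sub>R x))))"
      using mQ by (intro integral_nu[symmetric]) auto
    also have "\<dots> \<le> F * (e / F)"
      unfolding integral_mult_right_zero using int1 F by (intro mult_left_mono) auto
    finally have "(\<integral>\<^sup>+z. indicator ?E z * ennreal (norm (G z)) \<partial>lborel) \<le> ennreal e" using F by (simp add: ennreal_leI)
    from C(2)[OF wt e this] obtain y where y: "y \<in> ?E"
      "(\<integral>\<^sup>+x. indicator ?E x * ennreal \<bar>wt y - wt x\<bar> \<partial>lborel) \<le> ennreal (C * e)" by blast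
    have y0: "y \<noteq> 0" using y(1) E2 \<rho> by (auto simp: shell_def)
    have wtm: "wt \<in> borel_measurable borel" by (rule borel_measurable_punctured[OF C1_punctured_continuous[OF wt]])
    let ?g = "\<lambda>x. indicator (shell (exp (-1)) (exp 1)) x * \<bar>wt x - wt y\<bar>"
    have gm: "?g \<in> borel_measurable borel" using wtm by measurable
    have "integral\<^sup>L nu ?g = (LINT x|lborel. norm x powr (- ?n) * ?g x)" by (rule integral_nu[OF gm])
    also have "\<dots> \<le> B * (C * e)"
    proof (rule integral_real_bounded)
      show "0 \<le> B * (C * e)" using B C e by simp
      have "(\<integral>\<^sup>+x. ennreal (norm x powr (- ?n) * ?g x) \<partial>lborel)
        \<le> (\<integral>\<^sup>+x. ennreal B * (indicator ?E x * ennreal \<bar>wt y - wt x\<bar>) \<partial>lborel)"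
      proof (rule nn_integral_mono)
        fix x :: 'a
        show "ennreal (norm x powr (- ?n) * ?g x) \<le> ennreal B * (indicator ?E x * ennreal \<bar>wt y - wt x\<bar>)"
        proof (cases "x \<in> shell (exp (- 1)) (exp 1)")
          case True
          then have "norm x powr (- ?n) \<le> exp (- 1) powr (- ?n)" by (intro powr_mono2') (auto simp: shell_def)
          also have "\<dots> = B" by (simp add: B_def powr_def)
          finally have "norm x powr (- ?n) * \<bar>wt y - wt x\<bar> \<le> B * \<bar>wt y - wt x\<bar>" by (intro mult_right_mono) auto
          moreover have "x \<in> ?E" using E1 True by blast
          ultimately show ?thesis using True B
            by (simp add: ennreal_mult'[symmetric] abs_minus_commute ennreal_leI)
        qed simp
      qed
      also have "\<dots> = ennreal B * (\<integral>\<^sup>+x. indicator ?E x * ennreal \<bar>wt y - wt x\<bar> \<partial>lborel)"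
        using wtm Em by (intro nn_integral_cmult) auto
      also have "\<dots> \<le> ennreal B * ennreal (C * e)" using y(2) by (rule mult_left_mono) simp
      also have "\<dots> = ennreal (B * (C * e))" using B C e by (simp add: ennreal_mult)
      finally show "(\<integral>\<^sup>+x. ennreal (norm x powr (- ?n) * ?g x) \<partial>lborel) \<le> ennreal (B * (C * e))" .
    qed
    also have "\<dots> = \<epsilon>" using B C by (simp add: e_def)
    finally have "integral\<^sup>L nu ?g \<le> \<epsilon>" .
    moreover have "\<bar>wt y\<bar> \<le> W" unfolding wt_def using y0 t by (intro w_le) auto
    ultimately show "\<exists>c. \<bar>c\<bar> \<le> W \<and>
      (LINT x|nu. indicator (shell (exp (-1)) (exp 1)) x * \<bar>w (exp (\<theta> * real k) *\<^sub>R x) - c\<bar>) \<le> \<epsilon>"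
      unfolding wt_def t_def by blast
  qed
qed

section \<open>Collar profiles at unit scale\<close>

definition kernel :: "real \<Rightarrow> 'a \<Rightarrow> real" where
  "kernel \<theta> x = - step' m (\<theta> * ln (norm x))"

lemma kernel_nonneg: "0 \<le> kernel \<theta> x"
  using step'_nonpos[of m] by (simp add: kernel_def)

lemma kernel_cont: "continuous_on (- {0}) (kernel \<theta>)"
  unfolding kernel_def by (intro continuous_intros continuous_on_compose2[OF step'_continuous[of UNIV]]) auto

lemma kernel_supp:
  assumes "\<theta> = 1 \<or> \<theta> = -1" "kernel \<theta> x \<noteq> 0"
  shows "x \<in> shell (exp (-1)) (exp 1)"
proof -
  have "x \<noteq> 0" using assms(2) step'_eq_0(1)[of 0 m] by (auto simp: kernel_def)
  moreover define l where "l = ln (norm x)"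
  have "0 < \<theta> * ln (norm x)" "\<theta> * ln (norm x) < 1"
    using assms(2) step'_eq_0(1)[of "\<theta> * ln (norm x)" m] step'_eq_0(2)[OF m(1), of "\<theta> * ln (norm x)"] by (auto simp: kernel_def not_le[symmetric])
  then have "- 1 \<le> l" "l \<le> 1" unfolding l_def[symmetric] using assms(1) by auto
  ultimately show ?thesis by (simp add: exp_bounds_norm l_def)
qed

lemma kernel_le: "kernel \<theta> x \<le> 2 * real m"
proof -
  have "\<bar>step' m (\<theta> * ln (norm x))\<bar> \<le> 2 * real m * step m (\<theta> * ln (norm x)) powr ((real m - 1) / real m)"
    using m by (intro step'_bound) auto
  also have "\<dots> \<le> 2 * real m * 1"
    using step_bounds[of m] m by (intro mult_left_mono powr_le1) auto
  finally show ?thesis by (simp add: kernel_def)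
qed

lemma cutoff'_kernel: "\<eta>' T x = kernel (-1) (exp T *\<^sub>R x) - kernel 1 (exp (- T) *\<^sub>R x)"
proof (cases "x = 0")
  case False
  have 1: "-1 * ln (norm (exp T *\<^sub>R x)) = - ln (norm x) - T" "1 * ln (norm (exp (- T) *\<^sub>R x)) = ln (norm x) - T"
    using False by (simp_all add: ln_mult)
  show ?thesis unfolding kernel_def 1 using False by (simp add: cutoff'_def)
qed (simp add: cutoff'_def kernel_def)

lemma kernel_integrable:
  assumes "\<theta> = 1 \<or> \<theta> = -1" "continuous_on (- {0}) f"
  shows "integrable nu (\<lambda>x. kernel \<theta> x * f x)"
  using kernel_supp[OF assms(1)] assms(2)
  by (intro integrable_nu_shell[of _ "exp (-1)" "exp 1"] continuous_intros kernel_cont) auto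

text \<open>Dilation invariance carries each collar to unit scale and shifts the dependence on
  \<open>T\<close> into \<open>f\<close>, where \<open>end_concentration\<close> applies.\<close>

lemma cutoff'_integral_kernel:
  assumes f: "continuous_on (- {0}) f"
  shows "(LINT x|nu. \<eta>' T x * f x)
    = (LINT x|nu. kernel (-1) x * f (exp (- T) *\<^sub>R x)) - (LINT x|nu. kernel 1 x * f (exp T *\<^sub>R x))"
proof -
  have 1: "integrable nu (\<lambda>x. kernel \<theta> (exp (- s) *\<^sub>R x) * f x) \<and>
      (LINT x|nu. kernel \<theta> (exp (- s) *\<^sub>R x) * f x) = (LINT x|nu. kernel \<theta> x * f (exp s *\<^sub>R x))"
    if \<theta>: "\<theta> = 1 \<or> \<theta> = -1" for \<theta> s
  proof -
    have kc: "continuous_on (- {0}) (\<lambda>x. kernel \<theta> (exp (- s) *\<^sub>R x) * f x)"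
      by (intro continuous_intros continuous_on_dilation kernel_cont f) auto
    have "x \<in> shell (exp (s - 1)) (exp (s + 1))" if "kernel \<theta> (exp (- s) *\<^sub>R x) * f x \<noteq> 0" for x
    proof -
      have "exp (- s) *\<^sub>R x \<in> shell (exp (-1)) (exp 1)" using kernel_supp[OF \<theta>] that by auto
      then have "exp s * exp (- 1) \<le> exp s * (exp (- s) * norm x)" "exp s * (exp (- s) * norm x) \<le> exp s * exp 1"
        by (auto simp: shell_def)
      moreover have "exp s * (exp (- s) * norm x) = norm x" by (simp add: mult.assoc[symmetric] exp_add[symmetric])
      ultimately show ?thesis by (simp add: shell_def exp_add[symmetric])
    qed
    then have "integrable nu (\<lambda>x. kernel \<theta> (exp (- s) *\<^sub>R x) * f x)"
      by (intro integrable_nu_shell[OF kc, of "exp (s - 1)" "exp (s + 1)"]) auto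
    moreover have "(LINT x|nu. kernel \<theta> (exp (- s) *\<^sub>R x) * f x) = (LINT x|nu. kernel \<theta> x * f (exp s *\<^sub>R x))"
      using integral_nu_dilation[OF borel_measurable_punctured[OF kc], of "exp s"]
      by (simp add: exp_add[symmetric])
    ultimately show ?thesis by blast
  qed
  show ?thesis
    using 1[of "-1" "- T"] 1[of 1 T] unfolding cutoff'_kernel left_diff_distrib by simp
qed

definition \<alpha> where "\<alpha> = integral\<^sup>L nu (kernel 1)"

text \<open>The two profiles have equal mass because the integral of the cutoff derivative is
  zero.\<close>

lemma kernel_integral: "\<theta> = 1 \<or> \<theta> = -1 \<Longrightarrow> integral\<^sup>L nu (kernel \<theta>) = \<alpha>"
proof -
  have "(LINT x|nu. \<eta>' 1 x * 1) = (LINT x|nu. kernel (-1) x * 1) - (LINT x|nu. kernel 1 x * 1)"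
    by (rule cutoff'_integral_kernel) (rule continuous_on_const)
  then show "\<theta> = 1 \<or> \<theta> = -1 \<Longrightarrow> integral\<^sup>L nu (kernel \<theta>) = \<alpha>"
    using cutoff_integral_zero[OF m(1), of 1 1, where 'a = 'a] by (auto simp: \<alpha>_def)
qed

text \<open>\<open>H \<sigma>\<close> is Lipschitz on the range of \<open>w\<close>, so closeness of
  \<open>w\<close> to a constant in the mean passes to the boundary integrals.\<close>

lemma kernel_approx:
  assumes \<theta>: "\<theta> = 1 \<or> \<theta> = -1" and \<sigma>: "\<sigma> = 1 \<or> \<sigma> = -1" and t: "0 < t" and c: "\<bar>c\<bar> \<le> W"
    and le: "(LINT x|nu. indicator (shell (exp (-1)) (exp 1)) x * \<bar>w (t *\<^sub>R x) - c\<bar>) \<le> \<epsilon>"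
  shows "\<bar>(LINT x|nu. kernel \<theta> x * H \<sigma> (w (t *\<^sub>R x))) - \<alpha> * H \<sigma> c\<bar> \<le> 2 * real m * exp ((K + 1) * W) * \<epsilon>"
proof -
  have Ht: "continuous_on (- {0}) (\<lambda>x. H \<sigma> (w (t *\<^sub>R x)))" by (rule continuous_on_dilation[OF t Hw_cont])
  have i1: "integrable nu (\<lambda>x. kernel \<theta> x * H \<sigma> (w (t *\<^sub>R x)))" by (rule kernel_integrable[OF \<theta> Ht])
  have i2: "integrable nu (\<lambda>x. kernel \<theta> x * H \<sigma> c)" by (rule kernel_integrable[OF \<theta> continuous_on_const])
  have i3: "integrable nu (\<lambda>x. indicator (shell (exp (-1)) (exp 1)) x * \<bar>w (t *\<^sub>R x) - c\<bar>)"
    by (intro integrable_nu_indicator_shell continuous_intros continuous_on_dilation[OF t w_cont]) auto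
  have aeq: "\<alpha> * H \<sigma> c = (LINT x|nu. kernel \<theta> x * H \<sigma> c)" using kernel_integral[OF \<theta>] by simp
  have "\<bar>(LINT x|nu. kernel \<theta> x * H \<sigma> (w (t *\<^sub>R x))) - \<alpha> * H \<sigma> c\<bar>
      = \<bar>(LINT x|nu. kernel \<theta> x * H \<sigma> (w (t *\<^sub>R x)) - kernel \<theta> x * H \<sigma> c)\<bar>"
    unfolding aeq Bochner_Integration.integral_diff[OF i1 i2] ..
  also have "\<dots> \<le> (LINT x|nu. 2 * real m * exp ((K + 1) * W) * (indicator (shell (exp (-1)) (exp 1)) x * \<bar>w (t *\<^sub>R x) - c\<bar>))"
  proof (rule integral_abs_bound[THEN order_trans], rule integral_mono)
    fix x :: 'a
    show "\<bar>kernel \<theta> x * H \<sigma> (w (t *\<^sub>R x)) - kernel \<theta> x * H \<sigma> c\<bar>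
      \<le> 2 * real m * exp ((K + 1) * W) * (indicator (shell (exp (-1)) (exp 1)) x * \<bar>w (t *\<^sub>R x) - c\<bar>)"
    proof (cases "kernel \<theta> x = 0")
      case False
      then have xs: "x \<in> shell (exp (-1)) (exp 1)" by (rule kernel_supp[OF \<theta>])
      then have "t *\<^sub>R x \<noteq> 0" using t by (auto simp: shell_def)
      then have "\<bar>kernel \<theta> x\<bar> * \<bar>H \<sigma> (w (t *\<^sub>R x)) - H \<sigma> c\<bar> \<le> 2 * real m * (exp ((K + 1) * W) * \<bar>w (t *\<^sub>R x) - c\<bar>)"
        using kernel_nonneg[of \<theta> x] kernel_le[of \<theta> x] by (intro mult_mono H_lipschitz \<sigma> w_le c) auto
      then show ?thesis using xs by (simp add: abs_mult[symmetric] right_diff_distrib mult.assoc)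
    qed simp
  qed (use i1 i2 i3 in auto)
  also have "\<dots> \<le> 2 * real m * exp ((K + 1) * W) * \<epsilon>"
    using mult_left_mono[OF le, of "2 * real m * exp ((K + 1) * W)"] by simp
  finally show ?thesis .
qed

section \<open>Comparison of the two signs\<close>

lemma H_strict_mono:
  "\<sigma> = 1 \<or> \<sigma> = -1 \<Longrightarrow> s < t \<Longrightarrow> 0 < \<sigma> * (H \<sigma> t - H \<sigma> s)"
  using K_nonneg by (auto simp: H_def divide_strict_right_mono)

text \<open>A positive gap somewhere keeps the left side of \<open>energy_inequality\<close> above a
  fixed amount for both signs, while the right side tends to \<beta> \<alpha> times the difference
  of \<open>H \<sigma>\<close> at the two end constants. These differences have opposite signs for
  \<sigma> = 1 and \<sigma> = -1.\<close>

lemma gap_zero: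
  assumes "x \<noteq> 0"
  shows "gap x = 0"
proof (rule ccontr)
  assume "gap x \<noteq> 0"
  then have "0 < gap x" using gap_nonneg[of x] by simp
  then obtain \<delta> S where \<delta>: "0 < \<delta>" "0 < S"
    "\<And>g. integrable nu g \<Longrightarrow> (\<And>x. 0 \<le> g x) \<Longrightarrow>
      (\<And>x. x \<in> shell (exp (- S)) (exp S) \<Longrightarrow> gap x \<le> g x) \<Longrightarrow> \<delta> \<le> integral\<^sup>L nu g"
    using nu_integral_lower_bound[OF gap_cont assms] by metis
  let ?A = "exp (- ((K + 1) * W))" and ?B = "exp ((K + 1) * W)"
  have mB: "0 < 2 * real m * ?B" using m(1) by simp
  \<comment> \<open>Of the lower bound \<open>?A * \<delta>\<close>, the collar error takes a
    quarter and the two end approximations together another quarter; half remains. The summand 1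
    covers \<beta> = 0.\<close>
  define \<epsilon>1 where "\<epsilon>1 = ?A * \<delta> / (4 * ?B)"
  define \<epsilon>2 where "\<epsilon>2 = (?A * \<delta> / 8) / ((\<bar>\<beta>\<bar> + 1) * (2 * real m * ?B))"
  have \<epsilon>: "0 < \<epsilon>1" "0 < \<epsilon>2"
    unfolding \<epsilon>1_def \<epsilon>2_def using \<delta> mB by (auto intro!: divide_pos_pos mult_pos_pos)
  obtain k1 where k1: "\<And>k. k1 \<le> k \<Longrightarrow> 1 \<le> k \<Longrightarrow> (LINT x|nu. \<bar>\<eta>' (real k) x\<bar> * \<bar>M x \<bullet> sgn x\<bar>) \<le> \<epsilon>1"
    using collar_error[OF \<epsilon>(1)] by blast
  obtain k2 where k2: "\<And>k \<theta>. k2 \<le> k \<Longrightarrow> \<theta> = 1 \<or> \<theta> = -1 \<Longrightarrow> \<exists>c. \<bar>c\<bar> \<le> W \<and>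
    (LINT x|nu. indicator (shell (exp (-1)) (exp 1)) x * \<bar>w (exp (\<theta> * real k) *\<^sub>R x) - c\<bar>) \<le> \<epsilon>2"
    using end_concentration[OF \<epsilon>(2)] by blast
  define k where "k = max (max k1 k2) (max 1 (nat \<lceil>S\<rceil>))"
  have k: "k1 \<le> k" "k2 \<le> k" "1 \<le> k" "S \<le> real k" unfolding k_def by linarith+
  \<comment> \<open>These constants are fixed before \<sigma>, so both inequalities concern the same
    pair.\<close>
  obtain cp where cp: "\<bar>cp\<bar> \<le> W"
    "(LINT x|nu. indicator (shell (exp (-1)) (exp 1)) x * \<bar>w (exp (real k) *\<^sub>R x) - cp\<bar>) \<le> \<epsilon>2"
    using k2[OF k(2), of 1] by auto
  obtain cm where cm: "\<bar>cm\<bar> \<le> W"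
    "(LINT x|nu. indicator (shell (exp (-1)) (exp 1)) x * \<bar>w (exp (- real k) *\<^sub>R x) - cm\<bar>) \<le> \<epsilon>2"
    using k2[OF k(2), of "-1"] by auto
  have T: "0 < real k" using k by simp
  have low: "\<delta> \<le> (LINT x|nu. \<eta> (real k) x * gap x)"
  proof (rule \<delta>(3))
    show "integrable nu (\<lambda>x. \<eta> (real k) x * gap x)" by (rule integrable_\<eta>(1)[OF T gap_cont])
    show "0 \<le> \<eta> (real k) x * gap x" for x by (intro mult_nonneg_nonneg cutoff_bounds gap_nonneg)
    fix x :: 'a assume x: "x \<in> shell (exp (- S)) (exp S)"
    have "exp (- real k) \<le> exp (- S)" "exp S \<le> exp (real k)" using k by auto
    then have "x \<in> shell (exp (- real k)) (exp (real k))"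
      using x unfolding shell_def mem_Collect_eq by linarith
    then show "gap x \<le> \<eta> (real k) x * gap x" by (simp add: cutoff_eq_1)
  qed
  have main: "0 < \<beta> * \<alpha> * (H \<sigma> cp - H \<sigma> cm)" if \<sigma>: "\<sigma> = 1 \<or> \<sigma> = -1" for \<sigma>
  proof -
    define Ip where "Ip = (LINT x|nu. kernel 1 x * H \<sigma> (w (exp (real k) *\<^sub>R x)))"
    define Im where "Im = (LINT x|nu. kernel (-1) x * H \<sigma> (w (exp (- real k) *\<^sub>R x)))"
    let ?e = "2 * real m * ?B * \<epsilon>2"
    have ap: "\<bar>Ip - \<alpha> * H \<sigma> cp\<bar> \<le> ?e"
      unfolding Ip_def using cp by (intro kernel_approx \<sigma>) auto
    have am: "\<bar>Im - \<alpha> * H \<sigma> cm\<bar> \<le> ?e"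
      unfolding Im_def using cm by (intro kernel_approx \<sigma>) auto
    have bd: "(LINT x|nu. \<eta>' (real k) x * H \<sigma> (w x)) = Im - Ip"
      unfolding Ip_def Im_def by (rule cutoff'_integral_kernel[OF Hw_cont])
    have "?A * \<delta> \<le> ?A * (LINT x|nu. \<eta> (real k) x * gap x)"
      using low by (rule mult_left_mono) simp
    also have "\<dots> \<le> ?B * (LINT x|nu. \<bar>\<eta>' (real k) x\<bar> * \<bar>M x \<bullet> sgn x\<bar>) - \<beta> * (Im - Ip)"
      using energy_inequality[OF T \<sigma>] unfolding bd .
    also have "\<dots> \<le> ?B * \<epsilon>1 - \<beta> * (Im - Ip)"
      using mult_left_mono[OF k1[OF k(1,3)], of ?B] by simp
    also have "?B * \<epsilon>1 = ?A * \<delta> / 4" by (simp add: \<epsilon>1_def)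
    finally have 1: "3 / 4 * (?A * \<delta>) \<le> \<beta> * (Ip - Im)" by (simp add: algebra_simps)
    have "\<bar>(Ip - Im) - \<alpha> * (H \<sigma> cp - H \<sigma> cm)\<bar> \<le> ?e + ?e"
      using ap am by (simp add: algebra_simps abs_le_iff)
    then have "\<bar>\<beta>\<bar> * \<bar>(Ip - Im) - \<alpha> * (H \<sigma> cp - H \<sigma> cm)\<bar> \<le> (\<bar>\<beta>\<bar> + 1) * (?e + ?e)"
      by (intro mult_mono) auto
    also have "(\<bar>\<beta>\<bar> + 1) * (?e + ?e) = ?A * \<delta> / 4"
    proof -
      define X where "X = (\<bar>\<beta>\<bar> + 1) * (2 * real m * ?B)"
      have "X \<noteq> 0" using m(1) by (auto simp: X_def)
      then have "X * (y / X) = y" for y by simp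
      then have "X * \<epsilon>2 = ?A * \<delta> / 8" unfolding \<epsilon>2_def X_def[symmetric] .
      have "(\<bar>\<beta>\<bar> + 1) * (?e + ?e) = 2 * (X * \<epsilon>2)" by (simp add: X_def algebra_simps)
      also have "\<dots> = ?A * \<delta> / 4" unfolding \<open>X * \<epsilon>2 = ?A * \<delta> / 8\<close> by simp
      finally show ?thesis .
    qed
    finally have "\<bar>\<beta> * (Ip - Im) - \<beta> * (\<alpha> * (H \<sigma> cp - H \<sigma> cm))\<bar> \<le> ?A * \<delta> / 4"
      unfolding abs_mult[symmetric] right_diff_distrib .
    moreover have "0 < ?A * \<delta>" using \<delta> by simp
    ultimately show ?thesis using 1 unfolding abs_le_iff mult.assoc by linarith
  qed
  have "cp \<noteq> cm" using main[of 1] by auto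
  then consider "cm < cp" | "cp < cm" by linarith
  then have "(H 1 cp - H 1 cm) * (H (-1) cp - H (-1) cm) < 0"
  proof cases
    case 1
    then show ?thesis using H_strict_mono[of 1 cm cp] H_strict_mono[of "-1" cm cp] by (intro mult_pos_neg) auto
  next
    case 2
    then show ?thesis using H_strict_mono[of 1 cp cm] H_strict_mono[of "-1" cp cm] by (intro mult_neg_pos) auto
  qed
  \<comment> \<open>Multiplying the two inequalities leaves the square of
    \<open>\<beta> * \<alpha>\<close>, so neither sign has to be determined.\<close>
  moreover have "0 < (\<beta> * \<alpha> * (H 1 cp - H 1 cm)) * (\<beta> * \<alpha> * (H (-1) cp - H (-1) cm))"
    by (rule mult_pos_pos[OF main main]) auto
  moreover have "(\<beta> * \<alpha> * (H 1 cp - H 1 cm)) * (\<beta> * \<alpha> * (H (-1) cp - H (-1) cm))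
    = (\<beta> * \<alpha>)\<^sup>2 * ((H 1 cp - H 1 cm) * (H (-1) cp - H (-1) cm))"
    by (simp add: power2_eq_square mult_ac)
  ultimately show False using mult_nonneg_nonpos[OF zero_le_power2[of "\<beta> * \<alpha>"], of "(H 1 cp - H 1 cm) * (H (-1) cp - H (-1) cm)"]
    by linarith
qed

end

lemma Q_zero:
  assumes "x \<noteq> 0"
  shows "Q x = 0"
proof -
  obtain m :: nat where "p \<le> real m" using real_arch_simple by blast
  then have "max m 2 \<ge> 2" "real (max m 2) \<ge> p" by auto
  then have "gap x = 0" using gap_zero assms by blast
  then show ?thesis using mono_gap_eq_0D[OF p] by (simp add: gap_eq Q_def)
qed

end

theorem theorem1p4:
  fixes u :: "real ^ 'n \<Rightarrow> real" and n p a \<mu> \<gamma> \<alpha> C\<^sub>1 C\<^sub>2 :: real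
  assumes "n = real CARD('n)" and "n \<ge> 2"
    and "1 < p" and "p < n"
    and "\<mu> \<le> \<bar>(n - (a + 1) * p) / p\<bar> powr p"
    and "\<bar>\<gamma>\<bar> powr (p - 2) * \<gamma> * (n - (a + 1) * p - (p - 1) * \<gamma>) = \<mu>"
    and "0 < \<alpha>" and "\<alpha> < 1" and "C1_holder_loc \<alpha> (UNIV - {0}) u"
    and "weak_solution p a \<mu> (UNIV - {0}) u"
    and "C\<^sub>1 > 0" and "C\<^sub>2 > 0"
    and "\<And>x. x \<noteq> 0 \<Longrightarrow> C\<^sub>1 * norm x powr (- \<gamma>) \<le> u x \<and> u x \<le> C\<^sub>2 * norm x powr (- \<gamma>)"
  shows "\<exists>C>0. \<forall>x. x \<noteq> 0 \<longrightarrow> u x = C * norm x powr (- \<gamma>)"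
proof -
  have u: "C1_punctured u (gradient u)"
    by (rule C1_holder_loc_imp_C1_punctured[OF assms(9,7)])
  \<comment> \<open>Provides connectedness of the punctured space and the third face that links
    opposite faces of a cubical shell.\<close>
  have dim: "2 \<le> DIM(real ^ 'n)" using assms(1,2) by simp
  interpret positive_solution u p a \<mu> \<gamma> C\<^sub>1 C\<^sub>2
    by unfold_locales (use assms u in auto)
  show ?thesis
  proof (cases "\<gamma> = 0")
    case True
    interpret zero_exponent u p a \<mu> \<gamma> C\<^sub>1 C\<^sub>2 by unfold_locales (rule True)
    obtain c where c: "\<And>x. x \<noteq> 0 \<Longrightarrow> u x = c"
      using C1_punctured_constant[OF dim u gradient_u_zero] by blast
    obtain b :: "real ^ 'n" where b: "b \<noteq> 0" using nonempty_Basis nonzero_Basis by blast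
    have "0 < c" using c[OF b] u_pos[OF b] by simp
    then show ?thesis using c True by (intro exI[of _ c]) auto
  next
    case False
    interpret nonzero_exponent u p a \<mu> \<gamma> C\<^sub>1 C\<^sub>2 by unfold_locales (rule False, rule dim)
    obtain c where c: "\<And>x. x \<noteq> 0 \<Longrightarrow> w x = c"
      using C1_punctured_constant[OF dim w_C1] Q_zero by auto
    have "u x = exp c * norm x powr (- \<gamma>)" if "x \<noteq> 0" for x
    proof -
      have "ln (u x) = c - \<gamma> * ln (norm x)" using c[OF that] by (simp add: w_def)
      then have "u x = exp (c - \<gamma> * ln (norm x))" using u_pos[OF that] by (metis exp_ln)
      then show ?thesis using that by (simp add: powr_def exp_diff exp_minus field_simps)
    qed
    then show ?thesis by (intro exI[of _ "exp c"]) auto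
  qed
qed

end
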